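(* Assume the monotonicity condition (M) stated in the context holds and let $T>0$ be fixed. Let $(\Delta x_p)_{p\in\mathbb{N}}$ be a sequence of positive space-steps such that $\lim_{p\to+\infty}\Delta x_p=0$. For each $p$, let $\boldsymbol{f}_{\Delta_p}$ and $u_{\Delta_p}$ be the space-time piecewise constant reconstructions of the numerical solution of the scheme with space-step $\Delta x_p$. Then there exist a subsequence of space-steps, still denoted $(\Delta x_p)_{p\in\mathbb{N}}$, and a function $\overline{\boldsymbol{f}}=(\overline{f}_i)_{i\in I}$ such that, for $t\in(0,T)$, $\overline{\boldsymbol{f}}(t,\cdot)\in L^1((\mathbb{R}_+^* )^2)$ and $\overline{\boldsymbol{f}}(t,\boldsymbol{x})\in K$ for a.e. $\boldsymbol{x}$, and $$\lim_{p\to+\infty}\|\boldsymbol{f}_{\Delta_p}-\overline{\boldsymbol{f}}\|_{L^\infty_t(0,T)L^1_{\boldsymbol{x}}((\mathbb{R}_+^* )^2)}=0.$$ Moreover, setting $\overline{u}:=\sum_{i\in I}\overline{f}_i$, one has $\overline{u}(t,\boldsymbol{x})\in[-u_\infty,u_\infty]$ for a.e. $\boldsymbol{x}$, and $$\lim_{p\to+\infty}\|u_{\Delta_p}-\overline{u}\|_{L^\infty_t(0,T)L^1_{\boldsymbol{x}}((\mathbb{R}_+^* )^2)}=0.$$ Finally, the limit is at equilibrium: $\overline{\boldsymbol{f}}(t,\boldsymbol{x})=\boldsymbol{f}^{\mathrm{eq}}(\overline{u}(t,\boldsymbol{x}))$ for a.e. $\boldsymbol{x}$.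
   Context: Setting (scalar two-relaxation-times D2Q5 lattice Boltzmann scheme on a quarter plane, with equilibrium boundary conditions). $\mathbb{R}_+^*=(0,+\infty)$; $\boldsymbol{x}=(x,y)$; $\boldsymbol{e}_x=(1,0)$, $\boldsymbol{e}_y=(0,1)$; $⨍$ (written $\frac{1}{|\cdot|}\int$ below) denotes averages. Data and parameters. $T>0$ and $\lambda>0$ are fixed. Fluxes $\varphi_x,\varphi_y\in C^1(\mathbb{R})$ with $\varphi_x(0)=\varphi_y(0)=0$. Initial datum $u^\circ\in L^\infty\cap BV\cap L^1((\mathbb{R}_+^* )^2)$. Western and southern boundary data $\tilde u_W,\tilde u_S\in L^\infty\cap BV\cap L^1((0,T)\times\mathbb{R}_+^* )$, with $\tilde u_W=\tilde u_W(t,y)$ and $\tilde u_S=\tilde u_S(t,x)$. Set $u_\infty:=\max(\|u^\circ\|_{L^\infty},\|\tilde u_W\|_{L^\infty},\|\tilde u_S\|_{L^\infty})$. Relaxation parameters $\omega_s,\omega_a\in(0,2]$ and $L_x,L_y\in\mathbb{R}$. Grid. $\Delta x>0$, $\Delta t:=\Delta x/\lambda$, with $N\Delta t=T$ for some integer $N\ge1$; $t^n:=n\Delta t$. Cells $C_{\boldsymbol{j}}:=(j_x\Delta x,(j_x+1)\Delta x)\times(j_y\Delta x,(j_y+1)\Delta x)$, $\boldsymbol{j}=(j_x,j_y)\in\mathbb{N}^2$ ($0\in\mathbb{N}$). Equilibria. Index set $I=\{0,x+,x-,y+,y-\}$ and $f^{\mathrm{eq}}_0(u)=(1-2L_x-2L_y)u$,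 $f^{\mathrm{eq}}_{x\pm}(u)=L_xu\pm\frac{1}{2\lambda}\varphi_x(u)$, $f^{\mathrm{eq}}_{y\pm}(u)=L_yu\pm\frac{1}{2\lambda}\varphi_y(u)$; $\boldsymbol{f}^{\mathrm{eq}}=(f^{\mathrm{eq}}_i)_{i\in I}$. Scheme. Initialization: $f^0_{i,\boldsymbol{j}}=f^{\mathrm{eq}}_i\big(\frac{1}{\Delta x^2}\int_{C_{\boldsymbol{j}}}u^\circ\,d\boldsymbol{x}\big)$. For $n=0,\dots,N-1$, with $u^n_{\boldsymbol{j}}:=\sum_{i\in I}f^n_{i,\boldsymbol{j}}$ (at all times), relaxation: $f^{n,\star}_{0,\boldsymbol{j}}=(1-\omega_s)f^n_{0,\boldsymbol{j}}+\omega_sf^{\mathrm{eq}}_0(u^n_{\boldsymbol{j}})$ and, for $a\in\{x,y\}$, $$f^{n,\star}_{a\pm,\boldsymbol{j}}=\big(1-\tfrac12(\omega_s+\omega_a)\big)f^n_{a\pm,\boldsymbol{j}}+\tfrac12(\omega_s+\omega_a)f^{\mathrm{eq}}_{a\pm}(u^n_{\boldsymbol{j}})+\tfrac12(\omega_s-\omega_a)\big(f^{\mathrm{eq}}_{a\mp}(u^n_{\boldsymbol{j}})-f^n_{a\mp,\boldsymbol{j}}\big).$$ Transport: $f^{n+1}_{0,\boldsymbol{j}}=f^{n,\star}_{0,\boldsymbol{j}}$, $f^{n+1}_{a\pm,\boldsymbol{j}}=f^{n,\star}_{a\pm,\boldsymbol{j}\mp\boldsymbol{e}_a}$ for $a\in\{x,y\}$,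 where ghost values are $f^{n,\star}_{x+,(-1,j_y)}=f^{\mathrm{eq}}_{x+}(\tilde u^n_{W,j_y})$ and $f^{n,\star}_{y+,(j_x,-1)}=f^{\mathrm{eq}}_{y+}(\tilde u^n_{S,j_x})$, with $\tilde u^n_{\alpha,j}:=\frac{1}{\Delta t\Delta x}\int_{t^n}^{t^{n+1}}\int_{j\Delta x}^{(j+1)\Delta x}\tilde u_\alpha(t,s)\,ds\,dt$, $\alpha\in\{W,S\}$. Monotonicity condition (M): $$\omega_s(1-2L_x-2L_y)\ge\max(0,\omega_s-1),\qquad \frac{\omega_a}{2}\max_{|u|\le u_\infty}\frac{|\varphi_a'(u)|}{\lambda}\le\omega_sL_a+\tfrac12\min(2-\omega_s-\omega_a,0,\omega_a-\omega_s)\quad(a=x,y).$$ The trivial case where both $\max_{|u|\le u_\infty}|\varphi_x'(u)|=0$ and $\max_{|u|\le u_\infty}|\varphi_y'(u)|=0$ is excluded throughout. Reconstructions. $\boldsymbol{f}^n_\Delta(\boldsymbol{x}):=\sum_{\boldsymbol{j}}(f^n_{i,\boldsymbol{j}})_{i\in I}\mathbf{1}_{C_{\boldsymbol{j}}}(\boldsymbol{x})$, $u^n_\Delta(\boldsymbol{x}):=\sum_{\boldsymbol{j}}u^n_{\boldsymbol{j}}\mathbf{1}_{C_{\boldsymbol{j}}}(\boldsymbol{x})$, $\boldsymbol{f}_\Delta(t,\boldsymbol{x}):=\sum_{n=0}^{N-1}\boldsymbol{f}^n_\Delta(\boldsymbol{x})\mathbf{1}_{[t^n,t^{n+1})}(t)$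 and likewise $u_\Delta$. Norms of vector-valued functions use the $\ell^1$-norm over the components $i\in I$. $K:=\prod_{i\in I}[f^{\mathrm{eq}}_i(-u_\infty),f^{\mathrm{eq}}_i(u_\infty)]$. All space-steps in the sequence are such that $T/\Delta t$ is an integer, with $\lambda,\omega_s,\omega_a,L_x,L_y$ and the data fixed. *)

theory Defs
  imports "HOL-Analysis.Analysis" "HOL-Probability.Essential_Supremum"
begin

text \<open>All function spaces are with respect to Lebesgue measure. Membership in $L^1$ is
  the library notion \<^term>\<open>u absolutely_integrable_on \<Omega>\<close>. A function is evaluated only on
  \<^term>\<open>\<Omega>\<close>; its values elsewhere are irrelevant.\<close>

definition Linf_norm :: "'a::euclidean_space set \<Rightarrow> ('a \<Rightarrow> real) \<Rightarrow> ennreal" where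
  "Linf_norm \<Omega> u = esssup (lebesgue_on \<Omega>) (\<lambda>x. ennreal \<bar>u x\<bar>)"

definition in_Linf :: "'a::euclidean_space set \<Rightarrow> ('a \<Rightarrow> real) \<Rightarrow> bool" where
  "in_Linf \<Omega> u \<longleftrightarrow> u \<in> borel_measurable (lebesgue_on \<Omega>) \<and> Linf_norm \<Omega> u < \<infinity>"

text \<open>$C^1$ with compact support in \<^term>\<open>\<Omega>\<close>; continuity of the derivative is
  expressed direction by direction.\<close>

definition test_fields :: "'a::euclidean_space set \<Rightarrow> ('a \<Rightarrow> 'a) set" where
  "test_fields \<Omega> = {\<psi>.
     (\<forall>x. \<psi> differentiable (at x)) \<and>
     (\<forall>b. continuous_on UNIV (\<lambda>x. frechet_derivative \<psi> (at x) b)) \<and>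
     (\<exists>K. compact K \<and> K \<subseteq> \<Omega> \<and> (\<forall>x. x \<notin> K \<longrightarrow> \<psi> x = 0)) \<and>
     (\<forall>x. norm (\<psi> x) \<le> 1)}"

definition divergence :: "('a::euclidean_space \<Rightarrow> 'a) \<Rightarrow> 'a \<Rightarrow> real" where
  "divergence \<psi> x = (\<Sum>b\<in>Basis. frechet_derivative \<psi> (at x) b \<bullet> b)"

definition total_variation :: "'a::euclidean_space set \<Rightarrow> ('a \<Rightarrow> real) \<Rightarrow> ereal" where
  "total_variation \<Omega> u =
     (SUP \<psi>\<in>test_fields \<Omega>. ereal (LINT x:\<Omega>|lebesgue. u x * divergence \<psi> x))"

definition in_BV :: "'a::euclidean_space set \<Rightarrow> ('a \<Rightarrow> real) \<Rightarrow> bool" where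
  "in_BV \<Omega> u \<longleftrightarrow> u absolutely_integrable_on \<Omega> \<and> total_variation \<Omega> u < \<infinity>"

definition quadrant :: "(real \<times> real) set" where
  "quadrant = {0<..} \<times> {0<..}"

definition LinfL1_norm :: "real \<Rightarrow> (real \<Rightarrow> real \<times> real \<Rightarrow> real) \<Rightarrow> ennreal" where
  "LinfL1_norm T g =
     esssup (lebesgue_on {0<..<T}) (\<lambda>t. \<integral>\<^sup>+ x. ennreal \<bar>g t x\<bar> \<partial>lebesgue_on quadrant)"

datatype axis = AX | AY

datatype vel = Rest | Plus axis | Minus axis

lemma UNIV_vel: "(UNIV :: vel set) = {Rest, Plus AX, Minus AX, Plus AY, Minus AY}"
  by (auto, metis axis.exhaust vel.exhaust)

instance vel :: finite
  by standard (simp add: UNIV_vel)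

text \<open>The West datum is a function of (t, y) and the South datum of (t, x).
  In \<^term>\<open>omega_a\<close> the letter stands for ``antisymmetric''; it is one scalar shared by both axes.\<close>

record lbm =
  speed :: real                              (* lambda *)
  omega_s :: real
  omega_a :: real
  Lcoef :: "axis \<Rightarrow> real"
  flux :: "axis \<Rightarrow> real \<Rightarrow> real"
  u_init :: "real \<times> real \<Rightarrow> real"
  u_west :: "real \<times> real \<Rightarrow> real"
  u_south :: "real \<times> real \<Rightarrow> real"

definition u_inf :: "lbm \<Rightarrow> real \<Rightarrow> real" where
  "u_inf S T = enn2real (max (Linf_norm quadrant (u_init S))
     (max (Linf_norm ({0<..<T} \<times> {0<..}) (u_west S))
          (Linf_norm ({0<..<T} \<times> {0<..}) (u_south S))))"

fun feq :: "lbm \<Rightarrow> vel \<Rightarrow> real \<Rightarrow> real" where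
  "feq S Rest v = (1 - 2 * Lcoef S AX - 2 * Lcoef S AY) * v"
| "feq S (Plus a) v = Lcoef S a * v + flux S a v / (2 * speed S)"
| "feq S (Minus a) v = Lcoef S a * v - flux S a v / (2 * speed S)"

definition time_step :: "lbm \<Rightarrow> real \<Rightarrow> real" where
  "time_step S dx = dx / speed S"

definition cell :: "real \<Rightarrow> nat \<times> nat \<Rightarrow> (real \<times> real) set" where
  "cell dx j = {real (fst j) * dx <..< (real (fst j) + 1) * dx} \<times>
               {real (snd j) * dx <..< (real (snd j) + 1) * dx}"

definition init_avg :: "lbm \<Rightarrow> real \<Rightarrow> nat \<times> nat \<Rightarrow> real" where
  "init_avg S dx j = (1 / dx\<^sup>2) * (LINT x:cell dx j|lebesgue. u_init S x)"

definition bdry_avg :: "lbm \<Rightarrow> (real \<times> real \<Rightarrow> real) \<Rightarrow> real \<Rightarrow> nat \<Rightarrow> nat \<Rightarrow> real" where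
  "bdry_avg S w dx n j = (1 / (time_step S dx * dx)) *
     (LINT z:{real n * time_step S dx <..< (real n + 1) * time_step S dx} \<times>
             {real j * dx <..< (real j + 1) * dx}|lebesgue. w z)"

fun relax :: "lbm \<Rightarrow> (vel \<Rightarrow> real) \<Rightarrow> vel \<Rightarrow> real" where
  "relax S g Rest =
     (1 - omega_s S) * g Rest + omega_s S * feq S Rest (\<Sum>i\<in>UNIV. g i)"
| "relax S g (Plus a) =
     (1 - (omega_s S + omega_a S) / 2) * g (Plus a)
     + (omega_s S + omega_a S) / 2 * feq S (Plus a) (\<Sum>i\<in>UNIV. g i)
     + (omega_s S - omega_a S) / 2 * (feq S (Minus a) (\<Sum>i\<in>UNIV. g i) - g (Minus a))"
| "relax S g (Minus a) =
     (1 - (omega_s S + omega_a S) / 2) * g (Minus a)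
     + (omega_s S + omega_a S) / 2 * feq S (Minus a) (\<Sum>i\<in>UNIV. g i)
     + (omega_s S - omega_a S) / 2 * (feq S (Plus a) (\<Sum>i\<in>UNIV. g i) - g (Plus a))"

text \<open>Transport of post-relaxation values \<^term>\<open>h\<close> from level \<^term>\<open>n\<close> to the next one; the
  index -1 is met only by incoming velocities, where the boundary equilibria are used.\<close>

fun transport ::
  "lbm \<Rightarrow> real \<Rightarrow> nat \<Rightarrow> (nat \<times> nat \<Rightarrow> vel \<Rightarrow> real) \<Rightarrow> nat \<times> nat \<Rightarrow> vel \<Rightarrow> real" where
  "transport S dx n h (jx, jy) Rest = h (jx, jy) Rest"
| "transport S dx n h (jx, jy) (Plus AX) =
     (if jx = 0 then feq S (Plus AX) (bdry_avg S (u_west S) dx n jy) else h (jx - 1, jy) (Plus AX))"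
| "transport S dx n h (jx, jy) (Minus AX) = h (jx + 1, jy) (Minus AX)"
| "transport S dx n h (jx, jy) (Plus AY) =
     (if jy = 0 then feq S (Plus AY) (bdry_avg S (u_south S) dx n jx) else h (jx, jy - 1) (Plus AY))"
| "transport S dx n h (jx, jy) (Minus AY) = h (jx, jy + 1) (Minus AY)"

primrec fsol :: "lbm \<Rightarrow> real \<Rightarrow> nat \<Rightarrow> nat \<times> nat \<Rightarrow> vel \<Rightarrow> real" where
  "fsol S dx 0 = (\<lambda>j i. feq S i (init_avg S dx j))"
| "fsol S dx (Suc n) = transport S dx n (\<lambda>j. relax S (fsol S dx n j))"

definition usol :: "lbm \<Rightarrow> real \<Rightarrow> nat \<Rightarrow> nat \<times> nat \<Rightarrow> real" where
  "usol S dx n j = (\<Sum>i\<in>UNIV. fsol S dx n j i)"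

text \<open>Piecewise constant reconstruction of grid values over the first \<^term>\<open>N\<close> time levels. For
  \<^term>\<open>dx > 0\<close> the cells are disjoint, so the infinite sum has at most one nonzero term.\<close>

definition reconstruct ::
  "lbm \<Rightarrow> real \<Rightarrow> nat \<Rightarrow> (nat \<Rightarrow> nat \<times> nat \<Rightarrow> real) \<Rightarrow> real \<Rightarrow> real \<times> real \<Rightarrow> real" where
  "reconstruct S dx N v t x =
     (\<Sum>n<N. (\<Sum>\<^sub>\<infinity>j\<in>UNIV. v n j * indicat_real (cell dx j) x) *
        indicat_real {real n * time_step S dx ..< (real n + 1) * time_step S dx} t)"

definition f_rec :: "lbm \<Rightarrow> real \<Rightarrow> nat \<Rightarrow> real \<Rightarrow> real \<times> real \<Rightarrow> vel \<Rightarrow> real" where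
  "f_rec S dx N t x i = reconstruct S dx N (\<lambda>n j. fsol S dx n j i) t x"

definition u_rec :: "lbm \<Rightarrow> real \<Rightarrow> nat \<Rightarrow> real \<Rightarrow> real \<times> real \<Rightarrow> real" where
  "u_rec S dx N t x = reconstruct S dx N (usol S dx) t x"

text \<open>For a continuously differentiable flux the supremum is a maximum.\<close>

definition max_flux_speed :: "lbm \<Rightarrow> real \<Rightarrow> axis \<Rightarrow> real" where
  "max_flux_speed S T a = (SUP v\<in>{- u_inf S T .. u_inf S T}. \<bar>deriv (flux S a) v\<bar>)"

definition monotonicity_cond :: "lbm \<Rightarrow> real \<Rightarrow> bool" where
  "monotonicity_cond S T \<longleftrightarrow>
     omega_s S * (1 - 2 * Lcoef S AX - 2 * Lcoef S AY) \<ge> max 0 (omega_s S - 1) \<and>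
     (\<forall>a. omega_a S / 2 * (max_flux_speed S T a / speed S)
        \<le> omega_s S * Lcoef S a
          + 1 / 2 * min (2 - omega_s S - omega_a S) (min 0 (omega_a S - omega_s S)))"

end

theory Submission
  imports Defs "HOL-Library.Diagonal_Subsequence"
begin

text \<open>Under the monotonicity condition the relaxation operator acts on differences of admissible
  states as a nonnegative matrix with unit column sums, hence preserves the invariant box and
  contracts $\ell^1$. Ghost cells at equilibrium are fixed by relaxation, so the spatial variation
  including the jumps across the boundary grows only by variations of the boundary data; the $L^1$
  distance of consecutive levels and the distance to equilibrium are then of order $\Delta x$, and mass
  far away is controlled by finite speed of propagation. Sums are always taken over finite boxes
  which grow by one cell per time step, so that no summability is needed.

  The data enter through cell averages whose discrete variation is bounded by testing the total
  variation against $C^1$ approximations of hat functions. For the scalar $u_\Delta$ the translation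
  estimate makes averages over coarse cells at coarse times approximate it uniformly; quantising
  these averages colours the sequence with finitely many colours, and a diagonal argument gives a
  Cauchy subsequence in $L^\infty_t L^1_x$. Its limit $\bar u$ yields
  $\bar f = f^{\mathrm{eq}}(\bar u)$.\<close>

section \<open>Relaxation operator\<close>

text \<open>Compactness is needed only for the scalar u: the populations stay within O(dx) of
  \<open>feq\<close> of it, and \<open>feq\<close> is an l1 isometry on [-U, U], so every component
  inherits the convergence of u. Scaling fixes the form of the estimates. A sum of jumps over cells
  is of order 1/dx, since dx times it is a total variation. Each discrete bound is therefore a
  numerical multiple of one quantity \<open>A\<close>, later \<open>C / h\<close> with
  \<open>C\<close> independent of the mesh, and the cell area turns time increments and
  non-equilibrium parts into O(dx). The obstacle is the boundary: neither the initial and boundary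
  data, nor the two boundary data at the corner, are compatible. The first mismatch costs l1 norms
  of traces, controlled by averaging over a layer of fixed width; the second costs at most 2U in
  each of T * lambda / dx steps, again O(1/dx). Variations in x and in y do not interact, so x is
  treated in an abstract scheme that is closed under exchange of the axes. The limit is defined
  pointwise as a limit of values, because the norm in time calls for measurability in the pair of t
  and x.\<close>

lemma sum_vel: "(\<Sum>i\<in>UNIV. g i) = g Rest + g (Plus AX) + g (Minus AX) + g (Plus AY) + g (Minus AY)"
  for g :: "vel \<Rightarrow> real"
  by (simp add: UNIV_vel algebra_simps)

text \<open>Unit column sums express conservation: each \<open>j\<close> distributes its mass over
  the \<open>i\<close> without gain, so absolute values can only cancel. Row sums would control the
  supremum norm instead.\<close>

lemma stochastic_contraction:
  fixes M :: "vel \<Rightarrow> vel \<Rightarrow> real"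
  assumes "\<And>i j. 0 \<le> M i j" "\<And>j. (\<Sum>i\<in>UNIV. M i j) = 1"
  shows "(\<Sum>i\<in>UNIV. \<bar>\<Sum>j\<in>UNIV. M i j * d j\<bar>) \<le> (\<Sum>j\<in>UNIV. \<bar>d j\<bar>)"
proof -
  have "(\<Sum>i\<in>UNIV. \<bar>\<Sum>j\<in>UNIV. M i j * d j\<bar>) \<le> (\<Sum>i\<in>UNIV. \<Sum>j\<in>UNIV. M i j * \<bar>d j\<bar>)"
    by (intro sum_mono order_trans[OF sum_abs]) (simp add: abs_mult assms(1))
  also have "\<dots> = (\<Sum>j\<in>UNIV. (\<Sum>i\<in>UNIV. M i j) * \<bar>d j\<bar>)"
    by (subst sum.swap) (simp add: sum_distrib_right)
  finally show ?thesis by (simp add: assms(2))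
qed

locale monotone_lbm =
  fixes S :: lbm and T :: real
  assumes speed: "speed S > 0"
    and flux_C1: "\<And>a. flux S a C1_differentiable_on UNIV"
    and flux_0: "\<And>a. flux S a 0 = 0"
    and omega_pos: "0 < omega_s S" "0 < omega_a S"
    and monotone: "monotonicity_cond S T"
begin

definition U where "U = u_inf S T"

lemma U_nonneg: "0 \<le> U"
  by (simp add: U_def u_inf_def enn2real_nonneg)

text \<open>The mean value point lies between \<open>v\<close> and \<open>v'\<close>, hence in
  [-U, U], where continuity makes the supremum of the derivative finite. A slope, unlike a Lipschitz
  bound, keeps its sign, and one slope can then be used for both directions of an axis.\<close>

lemma flux_slope:
  assumes "\<bar>v\<bar> \<le> U" "\<bar>v'\<bar> \<le> U"
  obtains c where "\<bar>c\<bar> \<le> max_flux_speed S T a" "flux S a v - flux S a v' = c * (v - v')"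
proof -
  obtain D where D: "\<And>x. (flux S a has_vector_derivative D x) (at x)" "continuous_on UNIV D"
    using flux_C1[of a] unfolding C1_differentiable_on_def by auto
  have D1: "(flux S a has_real_derivative D x) (at x)" for x
    using D(1)[of x] by (simp add: has_real_derivative_iff_has_vector_derivative)
  have dD: "deriv (flux S a) x = D x" for x
    using D1 by (rule DERIV_imp_deriv)
  have "compact ((\<lambda>x. \<bar>D x\<bar>) ` {-U..U})"
    by (intro compact_continuous_image continuous_intros continuous_on_subset[OF D(2)]) auto
  then have bdd: "bdd_above ((\<lambda>x. \<bar>D x\<bar>) ` {-U..U})"
    by (intro bounded_imp_bdd_above compact_imp_bounded)
  have le: "\<bar>D x\<bar> \<le> max_flux_speed S T a" if "\<bar>x\<bar> \<le> U" for x
    unfolding max_flux_speed_def dD U_def[symmetric]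
    by (rule cSUP_upper[OF _ bdd]) (use that in auto)
  have mvt: "\<exists>c. \<bar>c\<bar> \<le> max_flux_speed S T a \<and> flux S a y - flux S a x = c * (y - x)"
    if xy: "x < y" "\<bar>x\<bar> \<le> U" "\<bar>y\<bar> \<le> U" for x y
  proof -
    obtain z where z: "x < z" "z < y" "flux S a y - flux S a x = (y - x) * D z"
      using MVT2[OF xy(1), of "flux S a" D] D1 by blast
    then show ?thesis using le[of z] xy by (intro exI[of _ "D z"]) (auto simp: mult.commute)
  qed
  consider "v = v'" | "v < v'" | "v' < v" by linarith
  then show thesis
  proof cases
    case 1
    then show thesis using that[of "D v"] le assms by auto
  next
    case 2
    obtain c where c: "\<bar>c\<bar> \<le> max_flux_speed S T a" "flux S a v' - flux S a v = c * (v' - v)"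
      using mvt[OF 2 assms] by blast
    show thesis by (rule that[of c]) (use c in \<open>auto simp: algebra_simps\<close>)
  next
    case 3
    then show thesis using mvt[OF 3 assms(2,1)] that by blast
  qed
qed

text \<open>The first three are the entries of the matrix of \<open>relax_matrix\<close> in a row of
  axis \<open>a\<close>: off the axis, on the diagonal, and for the opposite velocity. They match
  the three arguments of the minimum in (M). The last one is monotonicity of the equilibrium, which
  has to be derived from (M).\<close>

lemma relax_bounds:
  assumes "\<bar>c\<bar> \<le> max_flux_speed S T a"
  shows "0 \<le> omega_s S * Lcoef S a + omega_a S * c / (2 * speed S)"
    "0 \<le> (1 - (omega_s S + omega_a S) / 2) + (omega_s S * Lcoef S a + omega_a S * c / (2 * speed S))"
    "0 \<le> - ((omega_s S - omega_a S) / 2) + (omega_s S * Lcoef S a + omega_a S * c / (2 * speed S))"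
    "0 \<le> Lcoef S a" "0 \<le> Lcoef S a + c / (2 * speed S)"
proof -
  let ?m = "1 / 2 * min (2 - omega_s S - omega_a S) (min 0 (omega_a S - omega_s S))"
  have M: "omega_a S / 2 * (max_flux_speed S T b / speed S) \<le> omega_s S * Lcoef S b + ?m" for b
    using monotone unfolding monotonicity_cond_def by blast
  have "\<bar>c / speed S\<bar> \<le> max_flux_speed S T a / speed S"
    using assms speed by (simp add: divide_right_mono)
  then have "omega_a S / 2 * \<bar>c / speed S\<bar> \<le> omega_a S / 2 * (max_flux_speed S T a / speed S)"
    using omega_pos by (intro mult_left_mono) auto
  with M[of a] have 1: "omega_a S / 2 * \<bar>c / speed S\<bar> \<le> omega_s S * Lcoef S a + ?m" by linarith
  have e: "omega_a S * c / (2 * speed S) = omega_a S / 2 * (c / speed S)" by simp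
  have "\<bar>omega_a S * c / (2 * speed S)\<bar> = omega_a S / 2 * \<bar>c / speed S\<bar>"
    using omega_pos unfolding e abs_mult by simp
  with 1 have 2: "- (omega_s S * Lcoef S a + ?m) \<le> omega_a S * c / (2 * speed S)" by linarith
  have mm: "?m \<le> 0" "?m \<le> (2 - omega_s S - omega_a S) / 2" "?m \<le> (omega_a S - omega_s S) / 2"
    by auto
  show "0 \<le> omega_s S * Lcoef S a + omega_a S * c / (2 * speed S)"
    "0 \<le> (1 - (omega_s S + omega_a S) / 2) + (omega_s S * Lcoef S a + omega_a S * c / (2 * speed S))"
    "0 \<le> - ((omega_s S - omega_a S) / 2) + (omega_s S * Lcoef S a + omega_a S * c / (2 * speed S))"
    using 2 mm by (auto simp: field_simps)
  have L: "0 \<le> Lcoef S b" for b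
  proof -
    obtain c' where c': "\<bar>c'\<bar> \<le> max_flux_speed S T b"
      using flux_slope[of 0 0 b] U_nonneg by auto
    then have "0 \<le> max_flux_speed S T b" by linarith
    then have "0 \<le> omega_a S / 2 * (max_flux_speed S T b / speed S)" using omega_pos speed by simp
    with M[of b] mm(1) have "0 \<le> omega_s S * Lcoef S b" by linarith
    then show ?thesis using omega_pos by (simp add: zero_le_mult_iff)
  qed
  then show "0 \<le> Lcoef S a" .
  have "max 0 (omega_s S - 1) \<le> omega_s S * (1 - 2 * Lcoef S AX - 2 * Lcoef S AY)"
    using monotone unfolding monotonicity_cond_def by blast
  then have "0 \<le> 1 - 2 * Lcoef S AX - 2 * Lcoef S AY"
    using omega_pos by (metis max.boundedE mult_le_cancel_left_pos mult_zero_right)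
  then have "Lcoef S a \<le> 1 / 2" using L[of AX] L[of AY] by (cases a) auto
  \<comment> \<open>(M) contains \<open>omega_s S * Lcoef S a\<close>, while monotonicity of the
    equilibrium needs \<open>omega_a S\<close> in front of \<open>Lcoef S a\<close>. The minimum in
    (M) pays for the difference: if \<open>omega_a S\<close> is the smaller one,
    \<open>Lcoef S a \<le> 1 / 2\<close> bounds the loss by half of
    \<open>omega_s S - omega_a S\<close>.\<close>
  then have 3: "?m \<le> (omega_a S - omega_s S) * Lcoef S a"
  proof (cases "omega_s S \<le> omega_a S")
    case True
    then have "0 \<le> (omega_a S - omega_s S) * Lcoef S a" using L[of a] by simp
    then show ?thesis using mm(1) by linarith
  next
    case False
    then have "(omega_a S - omega_s S) * (1/2) \<le> (omega_a S - omega_s S) * Lcoef S a"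
      using \<open>Lcoef S a \<le> 1 / 2\<close> by (intro mult_left_mono_neg) auto
    then show ?thesis using mm(3) by linarith
  qed
  have "0 \<le> omega_a S * Lcoef S a + omega_a S * c / (2 * speed S)"
    using 2 3 by (simp add: algebra_simps)
  also have "\<dots> = omega_a S * (Lcoef S a + c / (2 * speed S))" by (simp add: algebra_simps)
  finally show "0 \<le> Lcoef S a + c / (2 * speed S)"
    using omega_pos by (simp add: zero_le_mult_iff)
qed

lemma rest_bounds:
  "0 \<le> 1 - 2 * Lcoef S AX - 2 * Lcoef S AY"
  "0 \<le> omega_s S * (1 - 2 * Lcoef S AX - 2 * Lcoef S AY)"
  "0 \<le> (1 - omega_s S) + omega_s S * (1 - 2 * Lcoef S AX - 2 * Lcoef S AY)"
proof -
  have *: "max 0 (omega_s S - 1) \<le> omega_s S * (1 - 2 * Lcoef S AX - 2 * Lcoef S AY)"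
    using monotone unfolding monotonicity_cond_def by blast
  then show "0 \<le> 1 - 2 * Lcoef S AX - 2 * Lcoef S AY"
    using omega_pos by (metis max.boundedE mult_le_cancel_left_pos mult_zero_right)
  show "0 \<le> omega_s S * (1 - 2 * Lcoef S AX - 2 * Lcoef S AY)"
    "0 \<le> (1 - omega_s S) + omega_s S * (1 - 2 * Lcoef S AX - 2 * Lcoef S AY)"
    using * by linarith+
qed

text \<open>The flux slope enters \<open>Plus a\<close> and \<open>Minus a\<close> with opposite
  signs and drops out of the sum, leaving the weights of the linear part, which add up to one.
  Nonnegativity applies \<open>relax_bounds\<close> to the slope and to its negative.\<close>

lemma feq_slopes:
  assumes "\<bar>v\<bar> \<le> U" "\<bar>v'\<bar> \<le> U"
  obtains b where "\<And>i. 0 \<le> b i" "(\<Sum>i\<in>UNIV. b i) = 1" "\<And>i. feq S i v - feq S i v' = b i * (v - v')"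
proof -
  have "\<exists>c. \<bar>c\<bar> \<le> max_flux_speed S T a \<and> flux S a v - flux S a v' = c * (v - v')" for a
    using flux_slope[OF assms, of a] by metis
  then obtain c where c: "\<And>a. \<bar>c a\<bar> \<le> max_flux_speed S T a"
    "\<And>a. flux S a v - flux S a v' = c a * (v - v')" by metis
  define b where "b i = (case i of Rest \<Rightarrow> 1 - 2 * Lcoef S AX - 2 * Lcoef S AY
     | Plus a \<Rightarrow> Lcoef S a + c a / (2 * speed S) | Minus a \<Rightarrow> Lcoef S a + (- c a) / (2 * speed S))" for i
  show thesis
  proof (rule that[of b])
    fix i
    show "0 \<le> b i"
      using relax_bounds(5)[OF c(1)] relax_bounds(5)[of "- c a" a for a] c(1) rest_bounds(1)
      by (cases i) (auto simp: b_def)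
    show "feq S i v - feq S i v' = b i * (v - v')"
    proof (cases i)
      case Rest
      then show ?thesis by (simp add: b_def algebra_simps)
    next
      case (Plus a)
      have "feq S i v - feq S i v' = Lcoef S a * (v - v') + (flux S a v - flux S a v') / (2 * speed S)"
        by (simp add: Plus diff_divide_distrib algebra_simps)
      then show ?thesis unfolding c(2) by (simp add: Plus b_def algebra_simps)
    next
      case (Minus a)
      have "feq S i v - feq S i v' = Lcoef S a * (v - v') - (flux S a v - flux S a v') / (2 * speed S)"
        by (simp add: Minus diff_divide_distrib algebra_simps)
      then show ?thesis unfolding c(2) by (simp add: Minus b_def algebra_simps)
    qed
  next
    show "(\<Sum>i\<in>UNIV. b i) = 1" by (simp add: sum_vel b_def)
  qed
qed

text \<open>All components move in the direction of \<open>v\<close>, so nothing cancels and the l1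
  distance equals that of the sums. This transfers variations, traces and limits from u to the
  equilibria without loss.\<close>

lemma feq_l1_isometry:
  assumes "\<bar>v\<bar> \<le> U" "\<bar>v'\<bar> \<le> U"
  shows "(\<Sum>i\<in>UNIV. \<bar>feq S i v - feq S i v'\<bar>) = \<bar>v - v'\<bar>"
proof -
  obtain b where b: "\<And>i. 0 \<le> b i" "(\<Sum>i\<in>UNIV. b i) = 1"
    "\<And>i. feq S i v - feq S i v' = b i * (v - v')" by (rule feq_slopes[OF assms]) blast
  have "(\<Sum>i\<in>UNIV. \<bar>feq S i v - feq S i v'\<bar>) = (\<Sum>i\<in>UNIV. b i) * \<bar>v - v'\<bar>"
    by (simp add: b(1,3) abs_mult sum_distrib_right)
  then show ?thesis by (simp add: b(2))
qed

lemma feq_mono: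
  assumes "\<bar>v\<bar> \<le> U" "\<bar>v'\<bar> \<le> U" "v \<le> v'"
  shows "feq S i v \<le> feq S i v'"
proof -
  obtain b where b: "\<And>i. 0 \<le> b i" "\<And>i. feq S i v' - feq S i v = b i * (v' - v)"
    by (rule feq_slopes[OF assms(2,1)]) blast
  have "0 \<le> b i * (v' - v)" using b(1)[of i] assms(3) by simp
  then show ?thesis using b(2)[of i] by linarith
qed

lemma feq_sum: "(\<Sum>i\<in>UNIV. feq S i v) = v"
  by (simp add: sum_vel algebra_simps)

lemma feq_0: "feq S i 0 = 0"
  by (cases i) (auto simp: flux_0)

lemma relax_feq: "relax S (\<lambda>i. feq S i v) i = feq S i v"
proof -
  have *: "(\<Sum>i\<in>UNIV. feq S i v) = v" by (rule feq_sum)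
  show ?thesis
    by (cases i) (simp_all only: relax.simps *, simp_all add: field_simps del: feq.simps)
qed

text \<open>By the mean value theorem one slope per axis serves both directions, which makes the column
  sums equal to one; the monotonicity condition is what makes the entries nonnegative.\<close>

lemma relax_matrix:
  assumes "\<bar>\<Sum>i\<in>UNIV. g i\<bar> \<le> U" "\<bar>\<Sum>i\<in>UNIV. h i\<bar> \<le> U"
  obtains M where "\<And>i j. 0 \<le> M i j" "\<And>j. (\<Sum>i\<in>UNIV. M i j) = 1"
    "\<And>i. relax S g i - relax S h i = (\<Sum>j\<in>UNIV. M i j * (g j - h j))"
proof -
  define v where "v = (\<Sum>i\<in>UNIV. g i)"
  define v' where "v' = (\<Sum>i\<in>UNIV. h i)"
  have "\<exists>c. \<bar>c\<bar> \<le> max_flux_speed S T a \<and> flux S a v - flux S a v' = c * (v - v')" for a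
    using flux_slope[OF assms, of a] unfolding v_def v'_def by metis
  then obtain c where c: "\<And>a. \<bar>c a\<bar> \<le> max_flux_speed S T a"
    "\<And>a. flux S a v - flux S a v' = c a * (v - v')" by metis
  \<comment> \<open>Coefficient of the change of the conserved sum:
    \<open>(omega_s S + omega_a S) / 2\<close> times the equilibrium slope of one direction plus
    \<open>(omega_s S - omega_a S) / 2\<close> times that of the opposite one. The
    \<open>Lcoef\<close> terms add up to \<open>omega_s\<close>, the flux terms to
    \<open>omega_a\<close>.\<close>
  let ?\<kappa> = "\<lambda>a c. omega_s S * Lcoef S a + omega_a S * c / (2 * speed S)"
  define M where "M i j = (case i of
       Rest \<Rightarrow> (if j = Rest then 1 - omega_s S else 0) + omega_s S * (1 - 2 * Lcoef S AX - 2 * Lcoef S AY)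
     | Plus a \<Rightarrow> (if j = Plus a then 1 - (omega_s S + omega_a S) / 2
                  else if j = Minus a then - ((omega_s S - omega_a S) / 2) else 0) + ?\<kappa> a (c a)
     | Minus a \<Rightarrow> (if j = Minus a then 1 - (omega_s S + omega_a S) / 2
                  else if j = Plus a then - ((omega_s S - omega_a S) / 2) else 0) + ?\<kappa> a (- c a))" for i j
  have fl: "flux S a v = flux S a v' + c a * (v - v')" for a using c(2)[of a] by linarith
  show thesis
  proof (rule that[of M])
    fix i j
    have m: "\<bar>- c a\<bar> \<le> max_flux_speed S T a" for a using c(1)[of a] by simp
    show "0 \<le> M i j"
      using relax_bounds(1-3)[OF c(1)] relax_bounds(1-3)[OF m] rest_bounds(2,3)
      unfolding M_def by (cases i) (auto simp del: mult_minus_right minus_divide_left)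
  next
    fix j
    show "(\<Sum>i\<in>UNIV. M i j) = 1"
    proof (cases j)
      case (Plus a) then show ?thesis by (cases a) (auto simp: sum_vel M_def field_simps)
    next
      case (Minus a) then show ?thesis by (cases a) (auto simp: sum_vel M_def field_simps)
    qed (auto simp: sum_vel M_def field_simps)
  next
    fix i
    have vv: "v - v' = (\<Sum>j\<in>UNIV. g j - h j)" by (simp add: v_def v'_def sum_subtractf)
    \<comment> \<open>Every row is a sparse part plus a constant \<open>K\<close>; the constant sees
      only the total difference \<open>v - v'\<close>.\<close>
    have red: "(\<Sum>j\<in>UNIV. (A j + K) * (g j - h j)) = (\<Sum>j\<in>UNIV. A j * (g j - h j)) + K * (v - v')"
      for A K unfolding vv by (simp add: distrib_right sum.distrib sum_distrib_left)
    show "relax S g i - relax S h i = (\<Sum>j\<in>UNIV. M i j * (g j - h j))"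
    proof (cases i)
      case Rest
      have "(\<Sum>j\<in>UNIV. M i j * (g j - h j)) = (1 - omega_s S) * (g Rest - h Rest)
        + omega_s S * (1 - 2 * Lcoef S AX - 2 * Lcoef S AY) * (v - v')"
        unfolding M_def Rest vel.case red by (simp add: sum_vel)
      then show ?thesis by (simp add: Rest v_def[symmetric] v'_def[symmetric] algebra_simps)
    next
      case (Plus a)
      have "(\<Sum>j\<in>UNIV. M i j * (g j - h j)) = (1 - (omega_s S + omega_a S) / 2) * (g i - h i)
        - (omega_s S - omega_a S) / 2 * (g (Minus a) - h (Minus a)) + ?\<kappa> a (c a) * (v - v')"
        unfolding M_def Plus vel.case red by (cases a) (simp_all add: sum_vel)
      then show ?thesis using speed
        by (simp add: Plus v_def[symmetric] v'_def[symmetric] fl) (simp add: field_simps)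
    next
      case (Minus a)
      have "(\<Sum>j\<in>UNIV. M i j * (g j - h j)) = (1 - (omega_s S + omega_a S) / 2) * (g i - h i)
        - (omega_s S - omega_a S) / 2 * (g (Plus a) - h (Plus a)) + ?\<kappa> a (- c a) * (v - v')"
        unfolding M_def Minus vel.case red by (cases a) (simp_all add: sum_vel)
      then show ?thesis using speed
        by (simp add: Minus v_def[symmetric] v'_def[symmetric] fl) (simp add: field_simps)
    qed
  qed
qed

lemma relax_contraction:
  assumes "\<bar>\<Sum>i\<in>UNIV. g i\<bar> \<le> U" "\<bar>\<Sum>i\<in>UNIV. h i\<bar> \<le> U"
  shows "(\<Sum>i\<in>UNIV. \<bar>relax S g i - relax S h i\<bar>) \<le> (\<Sum>i\<in>UNIV. \<bar>g i - h i\<bar>)"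
proof -
  obtain M where "\<And>i j. 0 \<le> M i j" "\<And>j. (\<Sum>i\<in>UNIV. M i j) = 1"
    "\<And>i. relax S g i - relax S h i = (\<Sum>j\<in>UNIV. M i j * (g j - h j))"
    by (rule relax_matrix[OF assms]) blast
  then show ?thesis using stochastic_contraction[of M "\<lambda>j. g j - h j"] by simp
qed

section \<open>The invariant box and the distance to equilibrium\<close>

definition invariant_box :: "(vel \<Rightarrow> real) \<Rightarrow> bool" where
  "invariant_box g \<longleftrightarrow> (\<forall>i. g i \<in> {feq S i (- U) .. feq S i U})"

lemma invariant_box_sum: "invariant_box g \<Longrightarrow> \<bar>\<Sum>i\<in>UNIV. g i\<bar> \<le> U"
  using sum_mono[of UNIV "\<lambda>i. feq S i (- U)" g] sum_mono[of UNIV g "\<lambda>i. feq S i U"]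
  by (auto simp: invariant_box_def feq_sum abs_le_iff)

lemma invariant_box_feq: "\<bar>v\<bar> \<le> U \<Longrightarrow> feq S i v \<in> {feq S i (- U) .. feq S i U}"
  using U_nonneg by (auto intro!: feq_mono)

lemma relax_mono:
  assumes "\<bar>\<Sum>i\<in>UNIV. g i\<bar> \<le> U" "\<bar>\<Sum>i\<in>UNIV. h i\<bar> \<le> U" "\<And>i. h i \<le> g i"
  shows "relax S h i \<le> relax S g i"
proof -
  obtain M where M: "\<And>i j. 0 \<le> M i j"
    "\<And>i. relax S g i - relax S h i = (\<Sum>j\<in>UNIV. M i j * (g j - h j))"
    by (rule relax_matrix[OF assms(1,2)]) blast
  have "0 \<le> (\<Sum>j\<in>UNIV. M i j * (g j - h j))"
    by (intro sum_nonneg mult_nonneg_nonneg M(1)) (simp add: assms(3))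
  then show ?thesis using M(2)[of i] by simp
qed

text \<open>The extreme corners of the box are the equilibria of \<open>- U\<close> and
  \<open>U\<close>, which relaxation fixes; monotonicity compares any state in the box with them. It
  applies because the sum of such a state lies between the sums \<open>- U\<close> and
  \<open>U\<close> of the corners.\<close>

lemma invariant_box_relax:
  assumes "invariant_box g"
  shows "invariant_box (relax S g)"
proof -
  have s: "\<bar>\<Sum>i\<in>UNIV. feq S i (- U)\<bar> \<le> U" "\<bar>\<Sum>i\<in>UNIV. feq S i U\<bar> \<le> U"
    using U_nonneg by (auto simp: feq_sum)
  show ?thesis
    using relax_mono[OF invariant_box_sum[OF assms] s(1)] relax_mono[OF s(2) invariant_box_sum[OF assms]]
      assms by (auto simp: invariant_box_def relax_feq)
qed

text \<open>The relaxation multiplies the non-equilibrium part by $1-\omega_s$ on rest and symmetric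
  components and by $1-\omega_a$ on antisymmetric ones, so it can be recovered from the increment.\<close>

lemma nonequilibrium_le:
  fixes g :: "vel \<Rightarrow> real"
  defines "v \<equiv> \<Sum>i\<in>UNIV. g i"
  shows "(\<Sum>i\<in>UNIV. \<bar>g i - feq S i v\<bar>)
    \<le> (1 / omega_s S + 1 / omega_a S) * (\<Sum>i\<in>UNIV. \<bar>g i - relax S g i\<bar>)"
proof -
  let ?\<kappa> = "1 / omega_s S + 1 / omega_a S"
  have rest: "\<bar>g Rest - feq S Rest v\<bar> \<le> ?\<kappa> * \<bar>g Rest - relax S g Rest\<bar>"
  proof -
    have "g Rest - relax S g Rest = omega_s S * (g Rest - feq S Rest v)"
      by (simp add: v_def[symmetric] algebra_simps)
    then have "\<bar>g Rest - feq S Rest v\<bar> = 1 / omega_s S * \<bar>g Rest - relax S g Rest\<bar>"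
      using omega_pos by (simp add: abs_mult)
    also have "\<dots> \<le> ?\<kappa> * \<bar>g Rest - relax S g Rest\<bar>"
      using omega_pos by (intro mult_right_mono) auto
    finally show ?thesis .
  qed
  have ax: "\<bar>g (Plus a) - feq S (Plus a) v\<bar> + \<bar>g (Minus a) - feq S (Minus a) v\<bar>
     \<le> ?\<kappa> * (\<bar>g (Plus a) - relax S g (Plus a)\<bar> + \<bar>g (Minus a) - relax S g (Minus a)\<bar>)" for a
  proof -
    define p m where "p = g (Plus a) - feq S (Plus a) v" and "m = g (Minus a) - feq S (Minus a) v"
    define d e where "d = g (Plus a) - relax S g (Plus a)" and "e = g (Minus a) - relax S g (Minus a)"
    have "d + e = omega_s S * (p + m)" "d - e = omega_a S * (p - m)"
      unfolding p_def m_def d_def e_def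
      by (simp_all add: v_def[symmetric] del: feq.simps) (simp_all add: field_simps del: feq.simps)
    then have pm: "\<bar>p + m\<bar> = 1 / omega_s S * \<bar>d + e\<bar>" "\<bar>p - m\<bar> = 1 / omega_a S * \<bar>d - e\<bar>"
      using omega_pos by (simp_all add: abs_mult)
    have "\<bar>p\<bar> + \<bar>m\<bar> \<le> \<bar>p + m\<bar> + \<bar>p - m\<bar>" by linarith
    also have "\<dots> \<le> 1 / omega_s S * (\<bar>d\<bar> + \<bar>e\<bar>) + 1 / omega_a S * (\<bar>d\<bar> + \<bar>e\<bar>)"
      unfolding pm using omega_pos by (intro add_mono mult_left_mono) auto
    finally show ?thesis unfolding p_def m_def d_def e_def by (simp add: distrib_right)
  qed
  show ?thesis using rest ax[of AX] ax[of AY]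
    unfolding sum_vel by (simp add: distrib_left del: feq.simps relax.simps)
qed

end

section \<open>Discrete estimates\<close>

definition box_sum :: "nat \<Rightarrow> (nat \<Rightarrow> nat \<Rightarrow> real) \<Rightarrow> real" where
  "box_sum J g = (\<Sum>j<J. \<Sum>k<J. g j k)"

lemma box_sum_swap: "box_sum J (\<lambda>j k. g k j) = box_sum J g"
  unfolding box_sum_def by (rule sum.swap)

lemma box_sum_mono: "(\<And>j k. j < J \<Longrightarrow> k < J \<Longrightarrow> g j k \<le> h j k) \<Longrightarrow> box_sum J g \<le> box_sum J h"
  unfolding box_sum_def by (intro sum_mono) auto

lemma box_sum_mono_box: "(\<And>j k. 0 \<le> g j k) \<Longrightarrow> J \<le> J' \<Longrightarrow> box_sum J g \<le> box_sum J' g"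
  unfolding box_sum_def
  by (rule order_trans[OF sum_mono[of _ "\<lambda>j. \<Sum>k<J. g j k" "\<lambda>j. \<Sum>k<J'. g j k"]])
     (auto intro!: sum_mono2 sum_nonneg)

lemma box_sum_add: "box_sum J (\<lambda>j k. g j k + h j k) = box_sum J g + box_sum J h"
  by (simp add: box_sum_def sum.distrib)

lemma box_sum_cmult: "box_sum J (\<lambda>j k. c * g j k) = c * box_sum J g"
  by (simp add: box_sum_def sum_distrib_left)

lemma box_sum_shift_fst:
  assumes "\<And>j k. 0 \<le> g j k"
  shows "box_sum J (\<lambda>j k. g (Suc j) k) \<le> box_sum (Suc J) g"
proof -
  have "box_sum J (\<lambda>j k. g (Suc j) k) \<le> (\<Sum>j<J. \<Sum>k<Suc J. g (Suc j) k)"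
    unfolding box_sum_def by (intro sum_mono sum_mono2) (auto simp: assms)
  also have "\<dots> \<le> (\<Sum>j<Suc J. \<Sum>k<Suc J. g j k)"
    by (subst (3) sum.lessThan_Suc_shift) (simp add: sum_nonneg assms)
  finally show ?thesis by (simp add: box_sum_def)
qed

lemma box_sum_shift_snd:
  assumes "\<And>j k. 0 \<le> g j k"
  shows "box_sum J (\<lambda>j k. g j (Suc k)) \<le> box_sum (Suc J) g"
  using box_sum_shift_fst[of "\<lambda>j k. g k j" J] assms
  unfolding box_sum_swap[of _ g] box_sum_swap[of _ "\<lambda>j k. g j (Suc k)"] by simp

text \<open>The pattern of transport by an incoming velocity: each value comes from the left
  neighbour, the first one from the boundary, and the last old value leaves the range of
  summation.\<close>

lemma sum_shift_le:
  fixes G G' :: "nat \<Rightarrow> real"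
  assumes "\<And>j. 0 \<le> G j" "\<And>j. G' (Suc j) \<le> G j" "G' 0 \<le> c" "0 \<le> c"
  shows "(\<Sum>j<J. G' j) \<le> (\<Sum>j<J. G j) + c"
proof (cases J)
  case (Suc J')
  have "(\<Sum>j<J. G' j) = G' 0 + (\<Sum>j<J'. G' (Suc j))"
    unfolding Suc by (rule sum.lessThan_Suc_shift)
  also have "\<dots> \<le> c + (\<Sum>j<J'. G j)" using assms(2,3) by (intro add_mono sum_mono) auto
  also have "\<dots> \<le> (\<Sum>j<J. G j) + c" using assms(1)[of J'] by (simp add: Suc)
  finally show ?thesis .
qed (simp add: assms)

text \<open>One transport step in $\ell^1$. The term \<^term>\<open>e\<close> collects errors caused by the
  western ghost column, \<^term>\<open>b\<close> those of the southern ghost row. The extra summand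
  \<^term>\<open>G 0 k (Minus AX)\<close> is needed for variations: the jump across the western boundary
  absorbs the jump which leaves the domain.\<close>

lemma transport_l1:
  fixes G G' :: "nat \<Rightarrow> nat \<Rightarrow> vel \<Rightarrow> real"
  assumes G: "\<And>j k i. 0 \<le> G j k i" and e: "\<And>k. 0 \<le> e k" and b: "\<And>j. 0 \<le> b j"
    and rest: "\<And>j k. G' j k Rest \<le> G j k Rest + (if j = 0 then e k else 0)"
    and px: "\<And>k. G' 0 k (Plus AX) \<le> e k" "\<And>j k. G' (Suc j) k (Plus AX) \<le> G j k (Plus AX)"
    and mx: "\<And>k. G' 0 k (Minus AX) \<le> G 0 k (Minus AX) + G (Suc 0) k (Minus AX) + e k"
      "\<And>j k. G' (Suc j) k (Minus AX) \<le> G (Suc (Suc j)) k (Minus AX)"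
    and py: "\<And>j. G' j 0 (Plus AY) \<le> b j"
      "\<And>j k. G' j (Suc k) (Plus AY) \<le> G j k (Plus AY) + (if j = 0 then e (Suc k) else 0)"
    and my: "\<And>j k. G' j k (Minus AY) \<le> G j (Suc k) (Minus AY) + (if j = 0 then e k else 0)"
  shows "box_sum J (\<lambda>j k. \<Sum>i\<in>UNIV. G' j k i)
    \<le> box_sum (Suc J) (\<lambda>j k. \<Sum>i\<in>UNIV. G j k i) + 5 * (\<Sum>k<J. e k) + (\<Sum>j<J. b j)"
proof -
  define E where "E = (\<Sum>k<J. e k)"
  have ee: "box_sum J (\<lambda>j k. if j = 0 then e k else 0) \<le> E"
  proof (cases J)
    case (Suc J')
    show ?thesis unfolding box_sum_def E_def Suc sum.lessThan_Suc_shift[of _ J'] by simp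
  qed (simp add: box_sum_def E_def)
  have grow: "box_sum J (\<lambda>j k. G j k i) \<le> box_sum (Suc J) (\<lambda>j k. G j k i)" for i
    by (rule box_sum_mono_box) (auto simp: G)
  have 1: "box_sum J (\<lambda>j k. G' j k Rest) \<le> box_sum (Suc J) (\<lambda>j k. G j k Rest) + E"
  proof -
    have "box_sum J (\<lambda>j k. G' j k Rest) \<le> box_sum J (\<lambda>j k. G j k Rest + (if j = 0 then e k else 0))"
      by (rule box_sum_mono) (rule rest)
    then show ?thesis using grow[of Rest] ee unfolding box_sum_add by linarith
  qed
  have 2: "box_sum J (\<lambda>j k. G' j k (Plus AX)) \<le> box_sum (Suc J) (\<lambda>j k. G j k (Plus AX)) + E"
  proof -
    have "(\<Sum>j<J. G' j k (Plus AX)) \<le> (\<Sum>j<J. G j k (Plus AX)) + e k" for k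
      by (rule sum_shift_le) (auto simp: G px e)
    then have "(\<Sum>k<J. \<Sum>j<J. G' j k (Plus AX)) \<le> (\<Sum>k<J. (\<Sum>j<J. G j k (Plus AX)) + e k)"
      by (intro sum_mono)
    then have "box_sum J (\<lambda>k j. G' j k (Plus AX)) \<le> box_sum J (\<lambda>k j. G j k (Plus AX)) + E"
      by (simp add: box_sum_def sum.distrib E_def)
    then show ?thesis using grow[of "Plus AX"]
      unfolding box_sum_swap[of J "\<lambda>j k. G' j k (Plus AX)"] box_sum_swap[of J "\<lambda>j k. G j k (Plus AX)"]
      by linarith
  qed
  have 3: "box_sum J (\<lambda>j k. G' j k (Minus AX)) \<le> box_sum (Suc J) (\<lambda>j k. G j k (Minus AX)) + E"
  proof -
    \<comment> \<open>The new first column uses the old columns 0 and 1, and the new column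
      \<open>Suc j\<close> the old column \<open>Suc (Suc j)\<close>. Each old column up to
      \<open>J\<close> is used once, which is why the box grows.\<close>
    have *: "(\<Sum>j<J. G' j k (Minus AX)) \<le> (\<Sum>j<Suc J. G j k (Minus AX)) + e k" for k
    proof (cases J)
      case (Suc J')
      have "(\<Sum>j<J. G' j k (Minus AX)) = G' 0 k (Minus AX) + (\<Sum>j<J'. G' (Suc j) k (Minus AX))"
        unfolding Suc by (rule sum.lessThan_Suc_shift)
      also have "\<dots> \<le> (G 0 k (Minus AX) + G (Suc 0) k (Minus AX) + e k)
          + (\<Sum>j<J'. G (Suc (Suc j)) k (Minus AX))"
        by (intro add_mono sum_mono mx)
      also have "\<dots> = (\<Sum>j<Suc J. G j k (Minus AX)) + e k"
        unfolding Suc sum.lessThan_Suc_shift by simp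
      finally show ?thesis .
    qed (auto intro!: add_nonneg_nonneg sum_nonneg G e)
    have "(\<Sum>k<J. \<Sum>j<J. G' j k (Minus AX)) \<le> (\<Sum>k<J. (\<Sum>j<Suc J. G j k (Minus AX)) + e k)"
      by (intro sum_mono *)
    also have "\<dots> = (\<Sum>k<J. \<Sum>j<Suc J. G j k (Minus AX)) + E"
      by (simp only: sum.distrib E_def)
    also have "\<dots> \<le> (\<Sum>k<Suc J. \<Sum>j<Suc J. G j k (Minus AX)) + E"
      by (intro add_right_mono sum_mono2 sum_nonneg G) auto
    finally have "box_sum J (\<lambda>k j. G' j k (Minus AX)) \<le> box_sum (Suc J) (\<lambda>k j. G j k (Minus AX)) + E"
      by (simp only: box_sum_def)
    then show ?thesis
      unfolding box_sum_swap[of _ "\<lambda>j k. G' j k (Minus AX)"] box_sum_swap[of _ "\<lambda>j k. G j k (Minus AX)"] .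
  qed
  have 4: "box_sum J (\<lambda>j k. G' j k (Plus AY)) \<le> box_sum (Suc J) (\<lambda>j k. G j k (Plus AY)) + E + (\<Sum>j<J. b j)"
  proof -
    \<comment> \<open>Subtracting the ghost error at the new index leaves a plain shift in
      \<open>k\<close>. At \<open>k = 0\<close> the subtraction does no harm, since \<open>e\<close>
      is nonnegative.\<close>
    have *: "(\<Sum>k<J. G' j k (Plus AY) - (if j = 0 then e k else 0)) \<le> (\<Sum>k<J. G j k (Plus AY)) + b j" for j
      by (rule sum_shift_le)
        (use G b py e in \<open>auto simp: algebra_simps intro: order_trans[OF py(1)]\<close>)
    have "box_sum J (\<lambda>j k. G' j k (Plus AY))
        = box_sum J (\<lambda>j k. G' j k (Plus AY) - (if j = 0 then e k else 0))
          + box_sum J (\<lambda>j k. if j = 0 then e k else 0)"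
      unfolding box_sum_add[symmetric] by simp
    moreover have "box_sum J (\<lambda>j k. G' j k (Plus AY) - (if j = 0 then e k else 0))
        \<le> box_sum J (\<lambda>j k. G j k (Plus AY)) + (\<Sum>j<J. b j)"
      unfolding box_sum_def sum.distrib[symmetric] by (intro sum_mono *)
    ultimately show ?thesis using ee grow[of "Plus AY"] by linarith
  qed
  have 5: "box_sum J (\<lambda>j k. G' j k (Minus AY)) \<le> box_sum (Suc J) (\<lambda>j k. G j k (Minus AY)) + E"
  proof -
    have "box_sum J (\<lambda>j k. G' j k (Minus AY))
      \<le> box_sum J (\<lambda>j k. G j (Suc k) (Minus AY) + (if j = 0 then e k else 0))"
      by (rule box_sum_mono) (rule my)
    moreover have "box_sum J (\<lambda>j k. G j (Suc k) (Minus AY)) \<le> box_sum (Suc J) (\<lambda>j k. G j k (Minus AY))"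
      by (rule box_sum_shift_snd[of "\<lambda>j k. G j k (Minus AY)"]) (rule G)
    ultimately show ?thesis using ee unfolding box_sum_add by linarith
  qed
  \<comment> \<open>Each of the five velocities is charged with at most one \<open>E\<close>, and
    only \<open>Plus AY\<close> with the southern errors.\<close>
  show ?thesis using 1 2 3 4 5
    unfolding sum_vel box_sum_add E_def[symmetric] by linarith
qed

section \<open>The abstract scheme and the exchange of its axes\<close>

fun swap_axis :: "axis \<Rightarrow> axis" where
  "swap_axis AX = AY" | "swap_axis AY = AX"

fun swap_vel :: "vel \<Rightarrow> vel" where
  "swap_vel Rest = Rest" | "swap_vel (Plus a) = Plus (swap_axis a)"
| "swap_vel (Minus a) = Minus (swap_axis a)"

lemma swap_vel_idem [simp]: "swap_vel (swap_vel i) = i"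
proof -
  have "swap_axis (swap_axis a) = a" for a by (cases a) auto
  then show ?thesis by (cases i) auto
qed

lemma sum_swap_vel: "(\<Sum>i\<in>UNIV. g (swap_vel i)) = (\<Sum>i\<in>UNIV. g i)" for g :: "vel \<Rightarrow> real"
  by (simp add: sum_vel)

text \<open>The scheme is detached from the parameter record so that exchanging the axes yields an
  instance again. \<open>A\<close> bounds all variations and traces of the data at once and will be
  of order 1/dx; by \<open>NU\<close> it also pays for an error of size \<open>U\<close> in each of
  the \<open>N\<close> steps. Time variations have \<open>N - 1\<close> increments because boundary
  data belong to the levels below \<open>N\<close>.\<close>

locale grid_scheme =
  fixes q :: "vel \<Rightarrow> real \<Rightarrow> real" and R :: "(vel \<Rightarrow> real) \<Rightarrow> vel \<Rightarrow> real"
    and U :: real and N :: nat and A :: real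
    and f :: "nat \<Rightarrow> nat \<Rightarrow> nat \<Rightarrow> vel \<Rightarrow> real" and w s :: "nat \<Rightarrow> nat \<Rightarrow> real"
    and u0 :: "nat \<Rightarrow> nat \<Rightarrow> real"
  assumes q_sum: "\<And>v. (\<Sum>i\<in>UNIV. q i v) = v"
    and q_iso: "\<And>v v'. \<bar>v\<bar> \<le> U \<Longrightarrow> \<bar>v'\<bar> \<le> U \<Longrightarrow> (\<Sum>i\<in>UNIV. \<bar>q i v - q i v'\<bar>) = \<bar>v - v'\<bar>"
    and q_0: "\<And>i. q i 0 = 0"
    and R_q: "\<And>i v. R (\<lambda>i. q i v) i = q i v"
    and R_contr: "\<And>g h. \<bar>\<Sum>i\<in>UNIV. g i\<bar> \<le> U \<Longrightarrow> \<bar>\<Sum>i\<in>UNIV. h i\<bar> \<le> U \<Longrightarrow>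
       (\<Sum>i\<in>UNIV. \<bar>R g i - R h i\<bar>) \<le> (\<Sum>i\<in>UNIV. \<bar>g i - h i\<bar>)"
    and U: "0 \<le> U"
    and f_0: "\<And>j k i. f 0 j k i = q i (u0 j k)"
    and f_rest: "\<And>n j k. n < N \<Longrightarrow> f (Suc n) j k Rest = R (f n j k) Rest"
    and f_px0: "\<And>n k. n < N \<Longrightarrow> f (Suc n) 0 k (Plus AX) = q (Plus AX) (w n k)"
    and f_px: "\<And>n j k. n < N \<Longrightarrow> f (Suc n) (Suc j) k (Plus AX) = R (f n j k) (Plus AX)"
    and f_mx: "\<And>n j k. n < N \<Longrightarrow> f (Suc n) j k (Minus AX) = R (f n (Suc j) k) (Minus AX)"
    and f_py0: "\<And>n j. n < N \<Longrightarrow> f (Suc n) j 0 (Plus AY) = q (Plus AY) (s n j)"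
    and f_py: "\<And>n j k. n < N \<Longrightarrow> f (Suc n) j (Suc k) (Plus AY) = R (f n j k) (Plus AY)"
    and f_my: "\<And>n j k. n < N \<Longrightarrow> f (Suc n) j k (Minus AY) = R (f n j (Suc k)) (Minus AY)"
    and f_bound: "\<And>n j k. n \<le> N \<Longrightarrow> \<bar>\<Sum>i\<in>UNIV. f n j k i\<bar> \<le> U"
    and w_bound: "\<And>n k. n < N \<Longrightarrow> \<bar>w n k\<bar> \<le> U"
    and s_bound: "\<And>n j. n < N \<Longrightarrow> \<bar>s n j\<bar> \<le> U"
    and NU: "real N * U \<le> A"
    and u0_x: "\<And>J. box_sum J (\<lambda>j k. \<bar>u0 (Suc j) k - u0 j k\<bar>) \<le> A"
    and u0_y: "\<And>J. box_sum J (\<lambda>j k. \<bar>u0 j (Suc k) - u0 j k\<bar>) \<le> A"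
    and u0_x0: "\<And>J. (\<Sum>k<J. \<bar>u0 0 k\<bar>) \<le> A"
    and u0_y0: "\<And>J. (\<Sum>j<J. \<bar>u0 j 0\<bar>) \<le> A"
    and w_t: "\<And>J. (\<Sum>n<N - 1. \<Sum>k<J. \<bar>w (Suc n) k - w n k\<bar>) \<le> A"
    and s_t: "\<And>J. (\<Sum>n<N - 1. \<Sum>k<J. \<bar>s (Suc n) k - s n k\<bar>) \<le> A"
    and w_s: "\<And>J. (\<Sum>n<N. \<Sum>k<J. \<bar>w n (Suc k) - w n k\<bar>) \<le> A"
    and s_s: "\<And>J. (\<Sum>n<N. \<Sum>k<J. \<bar>s n (Suc k) - s n k\<bar>) \<le> A"
    and w_l1: "\<And>n J. n < N \<Longrightarrow> (\<Sum>k<J. \<bar>w n k\<bar>) \<le> A"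
    and s_l1: "\<And>n J. n < N \<Longrightarrow> (\<Sum>k<J. \<bar>s n k\<bar>) \<le> A"
begin

section \<open>Spatial variation up to the boundary\<close>

lemma A_nonneg: "0 \<le> A"
  using NU U by (meson mult_nonneg_nonneg of_nat_0_le_iff order_trans)

lemma q_lip: "\<bar>v\<bar> \<le> U \<Longrightarrow> \<bar>v'\<bar> \<le> U \<Longrightarrow> \<bar>q i v - q i v'\<bar> \<le> \<bar>v - v'\<bar>"
  using q_iso[of v v'] member_le_sum[of i UNIV "\<lambda>i. \<bar>q i v - q i v'\<bar>"] by simp

text \<open>Here \<open>j\<close> counts interfaces: \<open>0\<close> is the western boundary,
  \<open>Suc j'\<close> separates the cells \<open>j'\<close> and \<open>Suc j'\<close>. At the
  boundary all five velocities are compared with the ghost equilibrium, outgoing ones too, because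
  relaxation contracts whole states and not single components.\<close>

definition jump :: "nat \<Rightarrow> nat \<Rightarrow> nat \<Rightarrow> vel \<Rightarrow> real" where
  "jump n j k i = (case j of 0 \<Rightarrow> \<bar>f n 0 k i - q i (w n k)\<bar> | Suc j' \<Rightarrow> \<bar>f n (Suc j') k i - f n j' k i\<bar>)"

definition relaxed_jump :: "nat \<Rightarrow> nat \<Rightarrow> nat \<Rightarrow> vel \<Rightarrow> real" where
  "relaxed_jump n j k i = (case j of 0 \<Rightarrow> \<bar>R (f n 0 k) i - q i (w n k)\<bar>
     | Suc j' \<Rightarrow> \<bar>R (f n (Suc j') k) i - R (f n j' k) i\<bar>)"

definition variation :: "nat \<Rightarrow> nat \<Rightarrow> real" where
  "variation n J = box_sum J (\<lambda>j k. \<Sum>i\<in>UNIV. jump n j k i)"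

lemma jump_nonneg: "0 \<le> jump n j k i" "0 \<le> relaxed_jump n j k i"
  by (auto simp: jump_def relaxed_jump_def split: nat.splits)

lemma relaxed_jump_le:
  assumes "n < N"
  shows "(\<Sum>i\<in>UNIV. relaxed_jump n j k i) \<le> (\<Sum>i\<in>UNIV. jump n j k i)"
proof (cases j)
  case 0
  have "(\<Sum>i\<in>UNIV. \<bar>R (f n 0 k) i - R (\<lambda>i. q i (w n k)) i\<bar>)
      \<le> (\<Sum>i\<in>UNIV. \<bar>f n 0 k i - q i (w n k)\<bar>)"
    by (rule R_contr) (use assms in \<open>auto intro!: f_bound simp: q_sum w_bound\<close>)
  then show ?thesis by (simp add: 0 R_q relaxed_jump_def jump_def)
next
  case (Suc j')
  then show ?thesis unfolding relaxed_jump_def jump_def Suc nat.case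
    by (intro R_contr) (use assms in \<open>auto intro!: f_bound\<close>)
qed

lemma relaxed_variation_le:
  "n < N \<Longrightarrow> box_sum J (\<lambda>j k. \<Sum>i\<in>UNIV. relaxed_jump n j k i) \<le> variation n J"
  unfolding variation_def by (intro box_sum_mono relaxed_jump_le)

text \<open>Away from the boundary, transport only moves jumps. Errors arise because the ghost
  column changes in time, because motion along y compares a cell with the ghost value of another
  row, and because the southern row brings in its own jumps. Two tangential differences in
  \<open>e\<close>, each counted five times, give the factor 10.\<close>

lemma variation_step:
  assumes n: "Suc n < N"
  shows "variation (Suc n) J \<le> variation n (Suc J)
    + 5 * (\<Sum>k<J. \<bar>w (Suc n) k - w n k\<bar>) + 10 * (\<Sum>k<J. \<bar>w n (Suc k) - w n k\<bar>)
    + (\<Sum>j<J. \<bar>s n (Suc j) - s n j\<bar>) + 2 * U"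
proof -
  \<comment> \<open>The backward difference serves \<open>Plus AY\<close>, the forward one
    \<open>Minus AY\<close>. At \<open>k = 0\<close> truncated subtraction makes the backward
    difference zero.\<close>
  define e where "e k = \<bar>w (Suc n) k - w n k\<bar> + \<bar>w n (Suc k) - w n k\<bar> + \<bar>w n k - w n (k - 1)\<bar>" for k
  \<comment> \<open>At the corner two unrelated data meet, and only the bound \<open>2 * U\<close>
    is available, once per time step.\<close>
  define b where "b j = (case j of 0 \<Rightarrow> 2 * U | Suc j' \<Rightarrow> \<bar>s n (Suc j') - s n j'\<bar>)" for j
  have n': "n < N" using n by simp
  note bd = w_bound[OF n] w_bound[OF n'] s_bound[OF n']
  note ev = f_rest[OF n'] f_px0[OF n'] f_px[OF n'] f_mx[OF n'] f_py0[OF n'] f_py[OF n'] f_my[OF n']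
  have wt: "\<bar>q i (w n k) - q i (w (Suc n) k)\<bar> \<le> \<bar>w (Suc n) k - w n k\<bar>" for i k
    using q_lip[of "w n k" "w (Suc n) k" i] bd by (simp add: abs_minus_commute)
  have tri: "\<bar>x - z\<bar> \<le> \<bar>x - y\<bar> + (a + \<bar>c\<bar>)" if "\<bar>y - z\<bar> \<le> a" for x y z a c :: real
    using that by linarith
  have "variation (Suc n) J \<le> box_sum (Suc J) (\<lambda>j k. \<Sum>i\<in>UNIV. relaxed_jump n j k i)
      + 5 * (\<Sum>k<J. e k) + (\<Sum>j<J. b j)"
    unfolding variation_def
  proof (rule transport_l1)
    fix j k
    show "jump (Suc n) j k Rest \<le> relaxed_jump n j k Rest + (if j = 0 then e k else 0)"
    proof (cases j)
      case 0
      have "\<bar>w (Suc n) k - w n k\<bar> \<le> e k" by (simp add: e_def)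
      then show ?thesis using wt[of Rest k] unfolding 0 by (simp add: jump_def relaxed_jump_def ev)
    next
      case (Suc j')
      then show ?thesis by (simp add: jump_def relaxed_jump_def ev)
    qed
    show "jump (Suc n) 0 k (Plus AX) \<le> e k"
      using wt[of "Plus AX" k] by (auto simp: jump_def ev e_def)
    show "jump (Suc n) (Suc j) k (Plus AX) \<le> relaxed_jump n j k (Plus AX)"
      by (cases j) (auto simp: jump_def relaxed_jump_def ev)
    show "jump (Suc n) 0 k (Minus AX)
      \<le> relaxed_jump n 0 k (Minus AX) + relaxed_jump n (Suc 0) k (Minus AX) + e k"
    proof -
      have "jump (Suc n) 0 k (Minus AX) = \<bar>R (f n (Suc 0) k) (Minus AX) - q (Minus AX) (w (Suc n) k)\<bar>"
        "relaxed_jump n 0 k (Minus AX) = \<bar>R (f n 0 k) (Minus AX) - q (Minus AX) (w n k)\<bar>"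
        "relaxed_jump n (Suc 0) k (Minus AX) = \<bar>R (f n (Suc 0) k) (Minus AX) - R (f n 0 k) (Minus AX)\<bar>"
        by (simp_all add: jump_def relaxed_jump_def ev)
      moreover have "\<bar>w (Suc n) k - w n k\<bar> \<le> e k" by (simp add: e_def)
      ultimately show ?thesis using wt[of "Minus AX" k] by linarith
    qed
    show "jump (Suc n) (Suc j) k (Minus AX) \<le> relaxed_jump n (Suc (Suc j)) k (Minus AX)"
      by (auto simp: jump_def relaxed_jump_def ev)
    show "jump (Suc n) j 0 (Plus AY) \<le> b j"
    proof (cases j)
      case 0
      have "\<bar>q (Plus AY) (s n 0) - q (Plus AY) (w (Suc n) 0)\<bar> \<le> \<bar>s n 0 - w (Suc n) 0\<bar>"
        by (intro q_lip bd)
      also have "\<dots> \<le> 2 * U" using bd(3)[of 0] bd(1)[of 0] by linarith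
      finally show ?thesis by (simp add: 0 jump_def b_def ev)
    next
      case (Suc j')
      then show ?thesis by (simp add: jump_def b_def ev q_lip bd)
    qed
    show "jump (Suc n) j (Suc k) (Plus AY) \<le> relaxed_jump n j k (Plus AY) + (if j = 0 then e (Suc k) else 0)"
    proof (cases j)
      case 0
      have "\<bar>q (Plus AY) (w n k) - q (Plus AY) (w (Suc n) (Suc k))\<bar> \<le> \<bar>w n k - w (Suc n) (Suc k)\<bar>"
        by (intro q_lip bd)
      then show ?thesis by (auto simp: 0 jump_def relaxed_jump_def ev e_def)
    next
      case (Suc j')
      then show ?thesis by (simp add: jump_def relaxed_jump_def ev)
    qed
    show "jump (Suc n) j k (Minus AY) \<le> relaxed_jump n j (Suc k) (Minus AY) + (if j = 0 then e k else 0)"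
    proof (cases j)
      case 0
      have "\<bar>q (Minus AY) (w n (Suc k)) - q (Minus AY) (w (Suc n) k)\<bar> \<le> \<bar>w n (Suc k) - w (Suc n) k\<bar>"
        by (intro q_lip bd)
      also have "\<dots> \<le> \<bar>w (Suc n) k - w n k\<bar> + \<bar>w n (Suc k) - w n k\<bar>" by linarith
      finally have le: "\<bar>q (Minus AY) (w n (Suc k)) - q (Minus AY) (w (Suc n) k)\<bar>
        \<le> \<bar>w (Suc n) k - w n k\<bar> + \<bar>w n (Suc k) - w n k\<bar>" .
      have "jump (Suc n) 0 k (Minus AY) = \<bar>R (f n 0 (Suc k)) (Minus AY) - q (Minus AY) (w (Suc n) k)\<bar>"
        "relaxed_jump n 0 (Suc k) (Minus AY) = \<bar>R (f n 0 (Suc k)) (Minus AY) - q (Minus AY) (w n (Suc k))\<bar>"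
        by (simp_all add: jump_def relaxed_jump_def ev)
      then show ?thesis using tri[OF le] by (simp add: 0 e_def)
    next
      case (Suc j')
      then show ?thesis by (simp add: jump_def relaxed_jump_def ev)
    qed
    show "0 \<le> b j" using U by (auto simp: b_def split: nat.splits)
  qed (auto simp: jump_nonneg e_def)
  moreover have "box_sum (Suc J) (\<lambda>j k. \<Sum>i\<in>UNIV. relaxed_jump n j k i) \<le> variation n (Suc J)"
    by (rule relaxed_variation_le[OF n'])
  moreover have "(\<Sum>k<J. \<bar>w n k - w n (k - 1)\<bar>) \<le> (\<Sum>k<J. \<bar>w n (Suc k) - w n k\<bar>) + 0"
    by (rule sum_shift_le) auto
  moreover have "(\<Sum>j<J. b j) \<le> (\<Sum>j<J. \<bar>s n (Suc j) - s n j\<bar>) + 2 * U"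
    by (rule sum_shift_le) (use U in \<open>auto simp: b_def\<close>)
  ultimately show ?thesis unfolding e_def sum.distrib by simp
qed

text \<open>The initial state is at equilibrium, so its jumps are those of \<open>u0\<close>.
  Nothing relates \<open>u0\<close> to \<open>w\<close>, so the jump across the western boundary is
  bounded by the two traces; this makes three terms.\<close>

lemma variation_0: 
  assumes "0 < N"
  shows "variation 0 J \<le> 3 * A"
proof -
  have ub: "\<bar>u0 j k\<bar> \<le> U" for j k
    using f_bound[of 0 j k] by (simp add: f_0 q_sum)
  have j0: "(\<Sum>i\<in>UNIV. jump 0 0 k i) \<le> \<bar>u0 0 k\<bar> + \<bar>w 0 k\<bar>" for k
    using q_iso[OF ub w_bound[OF assms], of 0 k k] by (simp add: jump_def f_0)
  have js: "(\<Sum>i\<in>UNIV. jump 0 (Suc j) k i) = \<bar>u0 (Suc j) k - u0 j k\<bar>" for j k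
    using q_iso[OF ub ub] by (simp add: jump_def f_0)
  have "variation 0 J \<le> (\<Sum>j<J. \<Sum>k<J. \<bar>u0 (Suc j) k - u0 j k\<bar>) + (\<Sum>k<J. \<bar>u0 0 k\<bar> + \<bar>w 0 k\<bar>)"
    unfolding variation_def box_sum_def
    by (rule sum_shift_le) (auto intro!: sum_nonneg sum_mono simp: js j0)
  also have "\<dots> \<le> A + (A + A)"
    unfolding sum.distrib using u0_x[of J] u0_x0[of J] w_l1[OF assms, of J]
    by (intro add_mono) (auto simp: box_sum_def)
  finally show ?thesis by simp
qed

lemma sum_part_le:
  fixes g :: "nat \<Rightarrow> nat \<Rightarrow> real"
  assumes "\<And>J. (\<Sum>n<M. \<Sum>k<J. g n k) \<le> A" "\<And>n k. 0 \<le> g n k" "m \<le> M"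
  shows "(\<Sum>n<m. \<Sum>k<J. g n k) \<le> A"
  by (rule order_trans[OF _ assms(1)[of J]]) (use assms in \<open>auto intro!: sum_mono2 sum_nonneg\<close>)

text \<open>21 = 3 + 5 + 10 + 1 + 2: initial variation, change of the western data in time and along
  the boundary, variation of the southern data, and the corner. \<open>J\<close> varies in the
  induction since the box grows with each step back in time.\<close>

lemma variation_bound:
  assumes "n < N"
  shows "variation n J \<le> 21 * A"
proof -
  let ?B = "\<lambda>m J. 5 * (\<Sum>k<J. \<bar>w (Suc m) k - w m k\<bar>) + 10 * (\<Sum>k<J. \<bar>w m (Suc k) - w m k\<bar>)
    + (\<Sum>j<J. \<bar>s m (Suc j) - s m j\<bar>) + 2 * U"
  have Bmono: "?B m J \<le> ?B m J'" if "J \<le> J'" for m J J'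
    by (intro add_mono mult_left_mono sum_mono2) (use that in auto)
  have "variation n J \<le> variation 0 (J + n) + (\<Sum>m<n. ?B m (J + n))"
    using assms
  proof (induction n arbitrary: J)
    case (Suc n)
    have "variation (Suc n) J \<le> variation n (Suc J) + ?B n J"
      using variation_step[OF Suc.prems, of J] by (simp only: add.assoc)
    also have "variation n (Suc J) \<le> variation 0 (Suc J + n) + (\<Sum>m<n. ?B m (Suc J + n))"
      by (rule Suc.IH) (use Suc.prems in simp)
    also have "?B n J \<le> ?B n (J + Suc n)" by (rule Bmono) simp
    finally show ?case by simp
  qed simp
  also have "(\<Sum>m<n. ?B m (J + n)) = 5 * (\<Sum>m<n. \<Sum>k<J + n. \<bar>w (Suc m) k - w m k\<bar>)
     + 10 * (\<Sum>m<n. \<Sum>k<J + n. \<bar>w m (Suc k) - w m k\<bar>)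
     + (\<Sum>m<n. \<Sum>j<J + n. \<bar>s m (Suc j) - s m j\<bar>) + 2 * (real n * U)"
    by (simp add: sum.distrib sum_distrib_left)
  also have "variation 0 (J + n) \<le> 3 * A" by (rule variation_0) (use assms in simp)
  also have "(\<Sum>m<n. \<Sum>k<J + n. \<bar>w (Suc m) k - w m k\<bar>) \<le> A"
    by (rule sum_part_le[OF w_t]) (use assms in auto)
  also have "(\<Sum>m<n. \<Sum>k<J + n. \<bar>w m (Suc k) - w m k\<bar>) \<le> A"
    by (rule sum_part_le[OF w_s]) (use assms in auto)
  also have "(\<Sum>m<n. \<Sum>k<J + n. \<bar>s m (Suc k) - s m k\<bar>) \<le> A"
    by (rule sum_part_le[OF s_s]) (use assms in auto)
  also have "real n * U \<le> A"
    using mult_right_mono[of "real n" "real N" U] assms U NU by simp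
  finally show ?thesis by simp
qed

lemma u_variation_x:
  assumes "n < N"
  shows "box_sum J (\<lambda>j k. \<bar>(\<Sum>i\<in>UNIV. f n (Suc j) k i) - (\<Sum>i\<in>UNIV. f n j k i)\<bar>) \<le> 21 * A"
proof -
  have "box_sum J (\<lambda>j k. \<bar>(\<Sum>i\<in>UNIV. f n (Suc j) k i) - (\<Sum>i\<in>UNIV. f n j k i)\<bar>)
    \<le> box_sum J (\<lambda>j k. \<Sum>i\<in>UNIV. jump n (Suc j) k i)"
    by (intro box_sum_mono) (simp add: jump_def sum_subtractf[symmetric] sum_abs)
  also have "\<dots> \<le> variation n (Suc J)"
    unfolding variation_def
    by (rule box_sum_shift_fst[of "\<lambda>j k. \<Sum>i\<in>UNIV. jump n j k i"]) (intro sum_nonneg jump_nonneg)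
  also have "\<dots> \<le> 21 * A" by (rule variation_bound[OF assms])
  finally show ?thesis .
qed

text \<open>The first column differs from the western data by the boundary jumps, which are part of
  the variation; the data add one more \<open>A\<close>.\<close>

lemma u_trace_x:
  assumes "n < N"
  shows "(\<Sum>k<J. \<bar>\<Sum>i\<in>UNIV. f n 0 k i\<bar>) \<le> 22 * A"
proof (cases J)
  case (Suc J')
  have "\<bar>\<Sum>i\<in>UNIV. f n 0 k i\<bar> \<le> (\<Sum>i\<in>UNIV. jump n 0 k i) + \<bar>w n k\<bar>" for k
  proof -
    have "\<bar>(\<Sum>i\<in>UNIV. f n 0 k i) - w n k\<bar> = \<bar>\<Sum>i\<in>UNIV. f n 0 k i - q i (w n k)\<bar>"
      by (simp add: sum_subtractf q_sum)
    also have "\<dots> \<le> (\<Sum>i\<in>UNIV. jump n 0 k i)" by (simp add: jump_def sum_abs)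
    finally show ?thesis by linarith
  qed
  then have "(\<Sum>k<J. \<bar>\<Sum>i\<in>UNIV. f n 0 k i\<bar>) \<le> (\<Sum>k<J. (\<Sum>i\<in>UNIV. jump n 0 k i) + \<bar>w n k\<bar>)"
    by (intro sum_mono)
  also have "\<dots> = (\<Sum>k<J. \<Sum>i\<in>UNIV. jump n 0 k i) + (\<Sum>k<J. \<bar>w n k\<bar>)" by (rule sum.distrib)
  also have "(\<Sum>k<J. \<Sum>i\<in>UNIV. jump n 0 k i) \<le> variation n J"
    unfolding variation_def box_sum_def Suc sum.lessThan_Suc_shift[of _ J']
    by (simp add: sum_nonneg jump_nonneg)
  also have "\<dots> \<le> 21 * A" by (rule variation_bound[OF assms])
  also have "(\<Sum>k<J. \<bar>w n k\<bar>) \<le> A" by (rule w_l1[OF assms])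
  finally show ?thesis by simp
qed (simp add: A_nonneg)

section \<open>Transport gap, mass tails and time increments\<close>

definition transport_gap :: "nat \<Rightarrow> nat \<Rightarrow> nat \<Rightarrow> vel \<Rightarrow> real" where
  "transport_gap n j k i = \<bar>f (Suc n) j k i - R (f n j k) i\<bar>"

text \<open>The gap of \<open>Plus AX\<close> is the relaxed jump across the left interface of the
  cell, that of \<open>Minus AX\<close> the one across the right interface. The variation therefore
  controls it up to and including the ghost column.\<close>

lemma transport_gap_x:
  assumes n: "n < N"
  shows "box_sum J (\<lambda>j k. transport_gap n j k (Plus AX) + transport_gap n j k (Minus AX)) \<le> 21 * A"
proof -
  let ?P = "relaxed_jump n"
  have "transport_gap n j k (Plus AX) = ?P j k (Plus AX)"
    "transport_gap n j k (Minus AX) = ?P (Suc j) k (Minus AX)" for j k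
    by (cases j; auto simp: transport_gap_def relaxed_jump_def f_px0[OF n] f_px[OF n] f_mx[OF n])+
  then have "box_sum J (\<lambda>j k. transport_gap n j k (Plus AX) + transport_gap n j k (Minus AX))
    = box_sum J (\<lambda>j k. ?P j k (Plus AX)) + box_sum J (\<lambda>j k. ?P (Suc j) k (Minus AX))"
    by (simp add: box_sum_add)
  also have "\<dots> \<le> box_sum (Suc J) (\<lambda>j k. ?P j k (Plus AX)) + box_sum (Suc J) (\<lambda>j k. ?P j k (Minus AX))"
    by (intro add_mono box_sum_mono_box box_sum_shift_fst[of "\<lambda>j k. ?P j k (Minus AX)"])
       (auto simp: jump_nonneg)
  also have "\<dots> \<le> box_sum (Suc J) (\<lambda>j k. \<Sum>i\<in>UNIV. ?P j k i)"
    unfolding box_sum_add[symmetric] by (intro box_sum_mono) (simp add: sum_vel jump_nonneg)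
  also have "\<dots> \<le> variation n (Suc J)" by (rule relaxed_variation_le[OF n])
  also have "\<dots> \<le> 21 * A" by (rule variation_bound[OF n])
  finally show ?thesis .
qed

text \<open>Information travels one cell per step: from column \<open>Suc a\<close> on, only old
  cells from column \<open>a\<close> on and the southern row matter. The western ghosts lie further
  left, whence the zero error sequence in \<open>transport_l1\<close>. Mass does not grow because
  relaxation contracts the distance to the zero state, which it fixes.\<close>

lemma mass_step:
  assumes n: "n < N"
  shows "box_sum J (\<lambda>j k. if Suc a \<le> j then \<Sum>i\<in>UNIV. \<bar>f (Suc n) j k i\<bar> else 0)
    \<le> box_sum (Suc J) (\<lambda>j k. if a \<le> j then \<Sum>i\<in>UNIV. \<bar>f n j k i\<bar> else 0)
      + (\<Sum>j<J. if a \<le> j then \<bar>s n j\<bar> else 0)"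
proof -
  note ev = f_rest[OF n] f_px0[OF n] f_px[OF n] f_mx[OF n] f_py0[OF n] f_py[OF n] f_my[OF n]
  have pull: "(\<Sum>i\<in>UNIV. if c then g i else 0) = (if c then \<Sum>i\<in>UNIV. g i else 0)"
    for c and g :: "vel \<Rightarrow> real" by simp
  have "box_sum J (\<lambda>j k. \<Sum>i\<in>UNIV. if Suc a \<le> j then \<bar>f (Suc n) j k i\<bar> else 0)
    \<le> box_sum (Suc J) (\<lambda>j k. \<Sum>i\<in>UNIV. if a \<le> j then \<bar>R (f n j k) i\<bar> else 0)
      + 5 * (\<Sum>k<J. 0) + (\<Sum>j<J. if a \<le> j then \<bar>s n j\<bar> else 0)"
  proof (rule transport_l1)
    fix j
    have "\<bar>q (Plus AY) (s n j)\<bar> \<le> \<bar>s n j\<bar>"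
      using q_lip[of "s n j" 0 "Plus AY"] s_bound[OF n] U by (simp add: q_0)
    then show "(if Suc a \<le> j then \<bar>f (Suc n) j 0 (Plus AY)\<bar> else 0) \<le> (if a \<le> j then \<bar>s n j\<bar> else 0)"
      by (simp add: ev)
  qed (auto simp: ev)
  also have "box_sum (Suc J) (\<lambda>j k. \<Sum>i\<in>UNIV. if a \<le> j then \<bar>R (f n j k) i\<bar> else 0)
     \<le> box_sum (Suc J) (\<lambda>j k. if a \<le> j then \<Sum>i\<in>UNIV. \<bar>f n j k i\<bar> else 0)"
  proof (rule box_sum_mono)
    fix j k
    have R0: "R (\<lambda>i. 0) i = 0" for i using R_q[of 0 i] by (simp add: q_0)
    have "(\<Sum>i\<in>UNIV. \<bar>R (f n j k) i - R (\<lambda>i. 0) i\<bar>) \<le> (\<Sum>i\<in>UNIV. \<bar>f n j k i - 0\<bar>)"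
      by (rule R_contr) (use n in \<open>auto intro!: f_bound simp: U\<close>)
    then show "(\<Sum>i\<in>UNIV. if a \<le> j then \<bar>R (f n j k) i\<bar> else 0)
       \<le> (if a \<le> j then \<Sum>i\<in>UNIV. \<bar>f n j k i\<bar> else 0)"
      by (simp add: R0)
  qed
  finally show ?thesis by (simp add: pull)
qed

text \<open>The cut on the left advances with the front, so that the data are always cut at the same
  column \<open>a\<close>. At level zero the state is at equilibrium, and its l1 norm is that of
  \<open>u0\<close>.\<close>

lemma mass_tail:
  assumes "n \<le> N"
  shows "box_sum J (\<lambda>j k. if a + n \<le> j then \<bar>\<Sum>i\<in>UNIV. f n j k i\<bar> else 0)
    \<le> box_sum (J + n) (\<lambda>j k. if a \<le> j then \<bar>u0 j k\<bar> else 0)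
      + (\<Sum>m<n. \<Sum>j<J + n. if a \<le> j then \<bar>s m j\<bar> else 0)"
proof -
  have smono: "(\<Sum>j<J. if b \<le> j then \<bar>s m j\<bar> else 0) \<le> (\<Sum>j<J'. if a \<le> j then \<bar>s m j\<bar> else 0)"
    if "J \<le> J'" "a \<le> b" for m J J' b
    by (rule order_trans[OF sum_mono[of "{..<J}" _ "\<lambda>j. if a \<le> j then \<bar>s m j\<bar> else 0"] sum_mono2])
      (use that in auto)
  have "box_sum J (\<lambda>j k. if a + n \<le> j then \<Sum>i\<in>UNIV. \<bar>f n j k i\<bar> else 0)
    \<le> box_sum (J + n) (\<lambda>j k. if a \<le> j then \<Sum>i\<in>UNIV. \<bar>f 0 j k i\<bar> else 0)
      + (\<Sum>m<n. \<Sum>j<J + n. if a \<le> j then \<bar>s m j\<bar> else 0)"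
    using assms
  proof (induction n arbitrary: J)
    case (Suc n)
    have "box_sum J (\<lambda>j k. if a + Suc n \<le> j then \<Sum>i\<in>UNIV. \<bar>f (Suc n) j k i\<bar> else 0)
      \<le> box_sum (Suc J) (\<lambda>j k. if a + n \<le> j then \<Sum>i\<in>UNIV. \<bar>f n j k i\<bar> else 0)
        + (\<Sum>j<J. if a + n \<le> j then \<bar>s n j\<bar> else 0)"
      using mass_step[of n J "a + n"] Suc.prems by simp
    also have "(\<Sum>j<J. if a + n \<le> j then \<bar>s n j\<bar> else 0) \<le> (\<Sum>j<J + Suc n. if a \<le> j then \<bar>s n j\<bar> else 0)"
      by (rule smono) auto
    also have "box_sum (Suc J) (\<lambda>j k. if a + n \<le> j then \<Sum>i\<in>UNIV. \<bar>f n j k i\<bar> else 0)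
      \<le> box_sum (Suc J + n) (\<lambda>j k. if a \<le> j then \<Sum>i\<in>UNIV. \<bar>f 0 j k i\<bar> else 0)
      + (\<Sum>m<n. \<Sum>j<Suc J + n. if a \<le> j then \<bar>s m j\<bar> else 0)"
      by (rule Suc.IH) (use Suc.prems in simp)
    finally show ?case by simp
  qed simp
  moreover have u0: "(\<Sum>i\<in>UNIV. \<bar>f 0 j k i\<bar>) = \<bar>u0 j k\<bar>" for j k
    using q_iso[of "u0 j k" 0] f_bound[of 0 j k] U by (simp add: f_0 q_0 q_sum)
  moreover have "box_sum J (\<lambda>j k. if a + n \<le> j then \<bar>\<Sum>i\<in>UNIV. f n j k i\<bar> else 0)
    \<le> box_sum J (\<lambda>j k. if a + n \<le> j then \<Sum>i\<in>UNIV. \<bar>f n j k i\<bar> else 0)"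
    by (rule box_sum_mono) auto
  ultimately show ?thesis unfolding u0 by linarith
qed

text \<open>Reflection in the diagonal: cell indices and velocities are exchanged, and west becomes
  south. Every estimate in x thereby has a counterpart in y.\<close>

lemma swapped:
  "grid_scheme (\<lambda>i. q (swap_vel i)) (\<lambda>g i. R (\<lambda>i. g (swap_vel i)) (swap_vel i)) U N A
     (\<lambda>n j k i. f n k j (swap_vel i)) s w (\<lambda>j k. u0 k j)"
proof unfold_locales
  fix v v' assume "\<bar>v\<bar> \<le> U" "\<bar>v'\<bar> \<le> U"
  then show "(\<Sum>i\<in>UNIV. \<bar>q (swap_vel i) v - q (swap_vel i) v'\<bar>) = \<bar>v - v'\<bar>"
    using q_iso[of v v'] sum_swap_vel[of "\<lambda>i. \<bar>q i v - q i v'\<bar>"] by simp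
next
  fix g h :: "vel \<Rightarrow> real" assume "\<bar>\<Sum>i\<in>UNIV. g i\<bar> \<le> U" "\<bar>\<Sum>i\<in>UNIV. h i\<bar> \<le> U"
  then show "(\<Sum>i\<in>UNIV. \<bar>R (\<lambda>i. g (swap_vel i)) (swap_vel i) - R (\<lambda>i. h (swap_vel i)) (swap_vel i)\<bar>)
     \<le> (\<Sum>i\<in>UNIV. \<bar>g i - h i\<bar>)"
    using R_contr[of "\<lambda>i. g (swap_vel i)" "\<lambda>i. h (swap_vel i)"]
      sum_swap_vel[of "\<lambda>i. \<bar>R (\<lambda>i. g (swap_vel i)) i - R (\<lambda>i. h (swap_vel i)) i\<bar>"]
      sum_swap_vel[of "\<lambda>i. \<bar>g i - h i\<bar>"] sum_swap_vel[of g] sum_swap_vel[of h] by simp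
next
  fix J
  show "box_sum J (\<lambda>j k. \<bar>u0 k (Suc j) - u0 k j\<bar>) \<le> A" "box_sum J (\<lambda>j k. \<bar>u0 (Suc k) j - u0 k j\<bar>) \<le> A"
    using u0_y[of J] u0_x[of J] box_sum_swap[of J "\<lambda>j k. \<bar>u0 j (Suc k) - u0 j k\<bar>"]
      box_sum_swap[of J "\<lambda>j k. \<bar>u0 (Suc j) k - u0 j k\<bar>"] by simp_all
qed (use q_sum sum_swap_vel[of "\<lambda>i. q i v" for v] f_bound sum_swap_vel[of "\<lambda>i. f n j k i" for n j k] in
  \<open>auto simp: q_0 R_q U f_0 f_rest f_px0 f_px f_mx f_py0 f_py f_my w_bound s_bound NU u0_x0 u0_y0
     w_t[unfolded One_nat_def] s_t[unfolded One_nat_def] w_s s_s w_l1 s_l1\<close>)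

end

text \<open>Reopening the context makes all x-estimates proved so far available for the reflected
  scheme.\<close>

context grid_scheme
begin

interpretation sw: grid_scheme "\<lambda>i. q (swap_vel i)" "\<lambda>g i. R (\<lambda>i. g (swap_vel i)) (swap_vel i)" U N A
    "\<lambda>n j k i. f n k j (swap_vel i)" s w "\<lambda>j k. u0 k j"
  by (rule swapped)

lemma u_variation_y:
  assumes "n < N"
  shows "box_sum J (\<lambda>j k. \<bar>(\<Sum>i\<in>UNIV. f n j (Suc k) i) - (\<Sum>i\<in>UNIV. f n j k i)\<bar>) \<le> 21 * A"
  using sw.u_variation_x[OF assms, of J] sum_swap_vel[of "\<lambda>i. f n j k i" for n j k]
    box_sum_swap[of J "\<lambda>j k. \<bar>(\<Sum>i\<in>UNIV. f n j (Suc k) i) - (\<Sum>i\<in>UNIV. f n j k i)\<bar>"]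
  by simp

lemma u_trace_y:
  assumes "n < N"
  shows "(\<Sum>j<J. \<bar>\<Sum>i\<in>UNIV. f n j 0 i\<bar>) \<le> 22 * A"
  using sw.u_trace_x[OF assms, of J] sum_swap_vel[of "\<lambda>i. f n j k i" for n j k] by simp

lemma mass_tail_y:
  assumes "n \<le> N"
  shows "box_sum J (\<lambda>j k. if a + n \<le> k then \<bar>\<Sum>i\<in>UNIV. f n j k i\<bar> else 0)
    \<le> box_sum (J + n) (\<lambda>j k. if a \<le> k then \<bar>u0 j k\<bar> else 0)
      + (\<Sum>m<n. \<Sum>k<J + n. if a \<le> k then \<bar>w m k\<bar> else 0)"
  using sw.mass_tail[OF assms, of J a] sum_swap_vel[of "\<lambda>i. f n j k i" for n j k]
    box_sum_swap[of J "\<lambda>j k. if a + n \<le> k then \<bar>\<Sum>i\<in>UNIV. f n j k i\<bar> else 0"]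
    box_sum_swap[of "J + n" "\<lambda>j k. if a \<le> k then \<bar>u0 j k\<bar> else 0"]
  by (simp cong: if_cong)

text \<open>The rest velocity has no gap, and each axis contributes 21.\<close>

lemma transport_gap_bound:
  assumes n: "n < N"
  shows "box_sum J (\<lambda>j k. \<Sum>i\<in>UNIV. \<bar>f (Suc n) j k i - R (f n j k) i\<bar>) \<le> 42 * A"
proof -
  have e: "(\<Sum>i\<in>UNIV. \<bar>f (Suc n) j k i - R (f n j k) i\<bar>)
    = (transport_gap n j k (Plus AX) + transport_gap n j k (Minus AX))
     + (sw.transport_gap n k j (Plus AX) + sw.transport_gap n k j (Minus AX))" for j k
    by (simp add: sum_vel transport_gap_def sw.transport_gap_def f_rest[OF n])
  show ?thesis
    using transport_gap_x[OF n, of J] sw.transport_gap_x[OF n, of J]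
      box_sum_swap[of J "\<lambda>j k. sw.transport_gap n j k (Plus AX) + sw.transport_gap n j k (Minus AX)"]
    unfolding e box_sum_add by linarith
qed

text \<open>At level zero relaxation does nothing, so the first increment is a pure transport gap,
  42. Later increments are transported in the same way after contraction by relaxation, and only
  time changes of the boundary data are added: 42 + 5 + 1.\<close>

lemma time_step_bound:
  assumes "n < N"
  shows "box_sum J (\<lambda>j k. \<Sum>i\<in>UNIV. \<bar>f (Suc n) j k i - f n j k i\<bar>) \<le> 48 * A"
proof -
  let ?T = "\<lambda>n J. box_sum J (\<lambda>j k. \<Sum>i\<in>UNIV. \<bar>f (Suc n) j k i - f n j k i\<bar>)"
  let ?B = "\<lambda>m J. 5 * (\<Sum>k<J. \<bar>w (Suc m) k - w m k\<bar>) + (\<Sum>j<J. \<bar>s (Suc m) j - s m j\<bar>)"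
  have Bmono: "?B m J \<le> ?B m J'" if "J \<le> J'" for m J J'
    by (intro add_mono mult_left_mono sum_mono2) (use that in auto)
  have step: "?T (Suc n) J \<le> ?T n (Suc J) + ?B n J" if n: "Suc n < N" for n J
  proof -
    have n': "n < N" using n by simp
    note ev = f_rest[OF n'] f_px0[OF n'] f_px[OF n'] f_mx[OF n'] f_py0[OF n'] f_py[OF n'] f_my[OF n']
      f_rest[OF n] f_px0[OF n] f_px[OF n] f_mx[OF n] f_py0[OF n] f_py[OF n] f_my[OF n]
    have "?T (Suc n) J \<le> box_sum (Suc J) (\<lambda>j k. \<Sum>i\<in>UNIV. \<bar>R (f (Suc n) j k) i - R (f n j k) i\<bar>)
        + 5 * (\<Sum>k<J. \<bar>w (Suc n) k - w n k\<bar>) + (\<Sum>j<J. \<bar>s (Suc n) j - s n j\<bar>)"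
      by (rule transport_l1) (auto simp: ev intro!: q_lip w_bound s_bound n n')
    also have "box_sum (Suc J) (\<lambda>j k. \<Sum>i\<in>UNIV. \<bar>R (f (Suc n) j k) i - R (f n j k) i\<bar>) \<le> ?T n (Suc J)"
      by (intro box_sum_mono R_contr f_bound) (use n in auto)
    finally show ?thesis by simp
  qed
  have "?T n J \<le> ?T 0 (J + n) + (\<Sum>m<n. ?B m (J + n))"
    using assms
  proof (induction n arbitrary: J)
    case (Suc n)
    have "?T (Suc n) J \<le> ?T n (Suc J) + ?B n J"
      by (rule step[OF Suc.prems])
    also have "?T n (Suc J) \<le> ?T 0 (Suc J + n) + (\<Sum>m<n. ?B m (Suc J + n))"
      by (rule Suc.IH) (use Suc.prems in simp)
    also have "?B n J \<le> ?B n (J + Suc n)" by (rule Bmono) simp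
    finally show ?case by simp
  qed simp
  also have "(\<Sum>m<n. ?B m (J + n)) = 5 * (\<Sum>m<n. \<Sum>k<J + n. \<bar>w (Suc m) k - w m k\<bar>)
     + (\<Sum>m<n. \<Sum>j<J + n. \<bar>s (Suc m) j - s m j\<bar>)"
    by (simp add: sum.distrib sum_distrib_left)
  also have "(\<Sum>m<n. \<Sum>k<J + n. \<bar>w (Suc m) k - w m k\<bar>) \<le> A"
    by (rule sum_part_le[OF w_t]) (use assms in auto)
  also have "(\<Sum>m<n. \<Sum>k<J + n. \<bar>s (Suc m) k - s m k\<bar>) \<le> A"
    by (rule sum_part_le[OF s_t]) (use assms in auto)
  also have "?T 0 (J + n) \<le> 42 * A"
  proof -
    have "R (f 0 j k) i = f 0 j k i" for j k i
    proof -
      have "f 0 j k = (\<lambda>i. q i (u0 j k))" by (rule ext) (rule f_0)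
      then show ?thesis by (simp only: R_q)
    qed
    then show ?thesis using transport_gap_bound[of 0 "J + n"] assms by simp
  qed
  finally show ?thesis by simp
qed

text \<open>Time increment and transport gap together: 48 + 42. By \<open>nonequilibrium_le\<close>
  this controls the distance to equilibrium.\<close>

lemma relaxation_gap_bound:
  assumes "n < N"
  shows "box_sum J (\<lambda>j k. \<Sum>i\<in>UNIV. \<bar>f n j k i - R (f n j k) i\<bar>) \<le> 90 * A"
proof -
  have "box_sum J (\<lambda>j k. \<Sum>i\<in>UNIV. \<bar>f n j k i - R (f n j k) i\<bar>)
     \<le> box_sum J (\<lambda>j k. (\<Sum>i\<in>UNIV. \<bar>f (Suc n) j k i - f n j k i\<bar>)
         + (\<Sum>i\<in>UNIV. \<bar>f (Suc n) j k i - R (f n j k) i\<bar>))"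
    unfolding sum.distrib[symmetric] by (intro box_sum_mono sum_mono) auto
  then show ?thesis
    using time_step_bound[OF assms, of J] transport_gap_bound[OF assms, of J]
    unfolding box_sum_add by linarith
qed

lemma u_time_step_bound:
  assumes "n < N"
  shows "box_sum J (\<lambda>j k. \<bar>(\<Sum>i\<in>UNIV. f (Suc n) j k i) - (\<Sum>i\<in>UNIV. f n j k i)\<bar>) \<le> 48 * A"
  by (rule order_trans[OF box_sum_mono time_step_bound[OF assms, of J]])
     (simp add: sum_subtractf[symmetric] sum_abs)

end

section \<open>Cell averages of functions of bounded variation\<close>

lemma DERIV_max_0_sq: "((\<lambda>z. (max 0 z)\<^sup>2) has_real_derivative 2 * max 0 z) (at z)" for z :: real
proof -
  consider "z < 0" | "z = 0" | "z > 0" by linarith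
  then show ?thesis
  proof cases
    case 1
    have "((\<lambda>z. 0) has_real_derivative 2 * max 0 z) (at z)" using 1 by simp
    then show ?thesis
      by (rule has_field_derivative_transform_within_open[of _ _ _ "{..<0}"]) (use 1 in auto)
  next
    case 2
    have "((\<lambda>h. ((max 0 (0 + h))\<^sup>2 - (max 0 0)\<^sup>2) / h) \<longlongrightarrow> 0) (at (0::real))"
    proof (rule Lim_null_comparison)
      show "\<forall>\<^sub>F h in at (0::real). norm (((max 0 (0 + h))\<^sup>2 - (max 0 0)\<^sup>2) / h) \<le> \<bar>h\<bar>"
        by (rule always_eventually) (auto simp: max_def power2_eq_square)
      show "((\<lambda>h. \<bar>h\<bar>) \<longlongrightarrow> 0) (at (0::real))" by (intro tendsto_rabs_zero tendsto_ident_at)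
    qed
    then show ?thesis unfolding 2 DERIV_def by simp
  next
    case 3
    have "((\<lambda>z. z\<^sup>2) has_real_derivative 2 * max 0 z) (at z)"
      using 3 by (auto intro!: derivative_eq_intros)
    then show ?thesis
      by (rule has_field_derivative_transform_within_open[of _ _ _ "{0<..}"]) (use 3 in auto)
  qed
qed

text \<open>$C^1$ functions with compact support in the open unit interval, converging to its indicator.\<close>

definition unit_bump :: "nat \<Rightarrow> real \<Rightarrow> real" where
  "unit_bump k t = (let m = (max 0 (t * (1 - t) - 1 / real (Suc k)))\<^sup>2 in
     1 - 1 / (1 + real (Suc k) * m))"

definition unit_bump_deriv :: "nat \<Rightarrow> real \<Rightarrow> real" where
  "unit_bump_deriv k t = (let z = max 0 (t * (1 - t) - 1 / real (Suc k)) in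
     real (Suc k) * (2 * z * (1 - 2 * t)) / (1 + real (Suc k) * z\<^sup>2)\<^sup>2)"

lemma unit_bump_denom: "1 + real (Suc k) * (max 0 z)\<^sup>2 > 0"
  by (intro add_pos_nonneg) auto

lemma DERIV_unit_bump: "(unit_bump k has_real_derivative unit_bump_deriv k t) (at t)"
proof -
  have "((\<lambda>t. t * (1 - t) - 1 / real (Suc k)) has_real_derivative 1 - 2 * t) (at t)"
    by (auto intro!: derivative_eq_intros)
  from DERIV_chain2[OF DERIV_max_0_sq this]
  have d: "((\<lambda>t. (max 0 (t * (1 - t) - 1 / real (Suc k)))\<^sup>2) has_real_derivative
     2 * max 0 (t * (1 - t) - 1 / real (Suc k)) * (1 - 2 * t)) (at t)" .
  have q: "((\<lambda>t. 1 - 1 / (1 + K * m t)) has_real_derivative K * D / (1 + K * m t)\<^sup>2) (at t)"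
    if "(m has_real_derivative D) (at t)" "0 < 1 + K * m t" for m D and K :: real
    by (rule derivative_eq_intros that refl)+ (use that(2) in \<open>auto simp: power2_eq_square\<close>)
  show ?thesis
    using q[OF d unit_bump_denom]
    unfolding unit_bump_def[abs_def] unit_bump_deriv_def Let_def .
qed

lemma continuous_unit_bump: "continuous_on A (unit_bump k)"
  using DERIV_unit_bump by (meson DERIV_isCont continuous_at_imp_continuous_on)

lemma continuous_unit_bump_deriv: "continuous_on A (unit_bump_deriv k)"
  unfolding unit_bump_deriv_def[abs_def] Let_def
  by (intro continuous_intros) (use unit_bump_denom[of k] in \<open>auto simp: less_le\<close>)

lemma unit_bump_range: "0 \<le> unit_bump k t" "unit_bump k t \<le> 1"
proof -
  have r: "0 \<le> 1 - 1 / (1 + x)" "1 - 1 / (1 + x) \<le> 1" if "0 \<le> x" for x :: real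
    using that by (auto simp: field_simps)
  show "0 \<le> unit_bump k t" "unit_bump k t \<le> 1"
    unfolding unit_bump_def Let_def by (intro r mult_nonneg_nonneg; simp)+
qed

lemma unit_bump_support:
  assumes "t \<le> 1 / real (Suc k) \<or> 1 - 1 / real (Suc k) \<le> t"
  shows "unit_bump k t = 0"
proof -
  have k: "0 < 1 / real (Suc k)" "1 / real (Suc k) \<le> 1" by auto
  have "t * (1 - t) \<le> 1 / real (Suc k)"
  proof (cases "0 \<le> t \<and> t \<le> 1")
    case True
    then show ?thesis using assms mult_mono[of t "1 / real (Suc k)" "1 - t" 1]
        mult_mono[of t 1 "1 - t" "1 / real (Suc k)"] by auto
  next
    case False
    then have "t * (1 - t) \<le> 0" by (auto simp: mult_le_0_iff)
    then show ?thesis using k by linarith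
  qed
  then show ?thesis by (simp add: unit_bump_def)
qed

text \<open>For \<open>c = t * (1 - t)\<close> positive, the truncated argument is at least
  \<open>c / 2\<close> once \<open>1 / real (Suc k)\<close> is below \<open>c / 2\<close>, so the
  deviation from one is at most \<open>4 / c^2\<close> times \<open>1 / real (Suc k)\<close>.
  Outside the interval the bumps vanish.\<close>

lemma unit_bump_tendsto: "(\<lambda>k. unit_bump k t) \<longlonglongrightarrow> indicator {0<..<1} t"
proof (cases "0 < t \<and> t < 1")
  case True
  define c where "c = t * (1 - t)"
  have c: "0 < c" using True by (simp add: c_def)
  have "\<forall>\<^sub>F k in sequentially. 1 / real (Suc k) < c / 2"
    using c by (intro order_tendstoD(2)[OF LIMSEQ_Suc[OF lim_1_over_n]]) auto
  then have ev: "\<forall>\<^sub>F k in sequentially. norm (unit_bump k t - 1) \<le> (4 / c\<^sup>2) * (1 / real (Suc k))"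
  proof eventually_elim
    case (elim k)
    have m: "c / 2 \<le> max 0 (c - 1 / real (Suc k))"
      by (rule max.coboundedI2) (use elim in linarith)
    have "(c / 2)\<^sup>2 \<le> (max 0 (c - 1 / real (Suc k)))\<^sup>2" by (rule power_mono[OF m]) (use c in simp)
    then have *: "real (Suc k) * (c / 2)\<^sup>2 \<le> 1 + real (Suc k) * (max 0 (c - 1 / real (Suc k)))\<^sup>2"
      by (smt (verit) mult_left_mono of_nat_0_le_iff)
    have "norm (unit_bump k t - 1) = 1 / (1 + real (Suc k) * (max 0 (c - 1 / real (Suc k)))\<^sup>2)"
      unfolding unit_bump_def Let_def c_def[symmetric]
      using unit_bump_denom[of k "c - 1 / real (Suc k)"] by simp
    also have "\<dots> \<le> 1 / (real (Suc k) * (c / 2)\<^sup>2)"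
      using * c unit_bump_denom[of k "c - 1 / real (Suc k)"] by (intro divide_left_mono mult_pos_pos) auto
    also have "\<dots> = (4 / c\<^sup>2) * (1 / real (Suc k))" by (simp add: power_divide)
    finally show ?case .
  qed
  have "(\<lambda>k. (4 / c\<^sup>2) * (1 / real (Suc k))) \<longlonglongrightarrow> 0"
    by (intro tendsto_mult_right_zero LIMSEQ_Suc[OF lim_1_over_n])
  from Lim_null_comparison[OF ev this] have "(\<lambda>k. unit_bump k t - 1) \<longlonglongrightarrow> 0" .
  then show ?thesis using True by (simp add: LIM_zero_iff)
next
  case False
  have "unit_bump k t = 0" for k
    using False by (intro unit_bump_support) (smt (verit) divide_nonneg_nonneg of_nat_0_le_iff)
  then show ?thesis using False by simp
qed

text \<open>A difference \<open>X t - X (t - 1)\<close> is a C^1 hat function supported in (0, 2).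
  Constancy of \<open>X\<close> on the two outer half-lines gives the compact support, and the bound
  on its increments keeps telescoping sums of hats at most one.\<close>

lemma unit_bump_antiderivative:
  obtains X where "\<And>t. (X has_real_derivative unit_bump k t) (at t)"
    "\<And>s t. s \<le> t \<Longrightarrow> X s \<le> X t" "\<And>s t. X t - X s \<le> 1"
    "\<And>s t. s \<le> 1 / real (Suc k) \<Longrightarrow> t \<le> 1 / real (Suc k) \<Longrightarrow> X s = X t"
    "\<And>s t. 1 - 1 / real (Suc k) \<le> s \<Longrightarrow> 1 - 1 / real (Suc k) \<le> t \<Longrightarrow> X s = X t"
proof -
  have "\<exists>X. \<forall>x. (- \<infinity> :: ereal) < ereal x \<longrightarrow> ereal x < \<infinity> \<longrightarrow> (X has_vector_derivative unit_bump k x) (at x)"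
    by (rule einterval_antiderivative)
       (use continuous_unit_bump[of UNIV k] in \<open>auto simp: continuous_on_eq_continuous_at\<close>)
  then obtain X where X: "\<And>t. (X has_real_derivative unit_bump k t) (at t)"
    by (auto simp: has_real_derivative_iff_has_vector_derivative)
  have mono: "X s \<le> X t" if "s \<le> t" for s t
    by (rule DERIV_nonneg_imp_nondecreasing[OF that]) (use X unit_bump_range in blast)
  have lo: "X s = X t" if st: "s < t" "t \<le> 1 / real (Suc k) \<or> 1 - 1 / real (Suc k) \<le> s" for s t
  proof -
    obtain z where "s < z" "z < t" "X t - X s = (t - s) * unit_bump k z"
      using MVT2[OF st(1), of X "unit_bump k"] X by blast
    then show ?thesis using unit_bump_support[of z k] st(2) by auto
  qed
  have c1: "X s = X t" if "s \<le> 1 / real (Suc k)" "t \<le> 1 / real (Suc k)" for s t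
    by (metis lo linorder_less_linear that)
  have c2: "X s = X t" if "1 - 1 / real (Suc k) \<le> s" "1 - 1 / real (Suc k) \<le> t" for s t
    by (metis lo linorder_less_linear that)
  have e: "0 < 1 / real (Suc k)" by simp
  have up: "X t \<le> X 1" for t
  proof (cases "t \<le> 1")
    case False
    then have "X t = X 1" using e by (intro c2) linarith+
    then show ?thesis by simp
  qed (rule mono)
  have dn: "X 0 \<le> X t" for t
  proof (cases "0 \<le> t")
    case False
    then have "X t = X 0" using e by (intro c1) linarith+
    then show ?thesis by simp
  qed (rule mono)
  obtain z where "X 1 - X 0 = unit_bump k z"
    using MVT2[of 0 1 X "unit_bump k"] X by auto
  then have "X t - X s \<le> 1" for s t using up[of t] dn[of s] unit_bump_range(2)[of k z] by linarith
  then show thesis using that X mono c1 c2 by blast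
qed

text \<open>Integer translates have disjoint supports; only the one belonging to the integer part of
  \<open>y\<close> can be nonzero.\<close>

lemma sum_unit_bump_le: "(\<Sum>c<K. unit_bump k (y - real c)) \<le> 1"
proof -
  have *: "unit_bump k (y - real c) = 0" if "c \<noteq> nat \<lfloor>y\<rfloor>" for c
  proof (rule unit_bump_support)
    have "y - real c \<le> 0 \<or> 1 \<le> y - real c"
    proof (rule ccontr)
      assume "\<not> ?thesis"
      then have "\<lfloor>y\<rfloor> = int c" by (intro floor_unique) auto
      then show False using that by simp
    qed
    then show "y - real c \<le> 1 / real (Suc k) \<or> 1 - 1 / real (Suc k) \<le> y - real c"
      by (smt (verit) divide_nonneg_nonneg of_nat_0_le_iff)
  qed
  have "(\<Sum>c<K. unit_bump k (y - real c)) = (\<Sum>c\<in>{..<K} \<inter> {nat \<lfloor>y\<rfloor>}. unit_bump k (y - real c))"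
    by (rule sum.mono_neutral_right) (auto simp: *)
  also have "\<dots> \<le> 1"
    by (cases "nat \<lfloor>y\<rfloor> < K") (auto simp: unit_bump_range)
  finally show ?thesis .
qed

text \<open>Inner products with two basis vectors, in either order, let one argument handle jumps in
  both coordinate directions. In the estimate of jumps, \<open>b\<close> is the direction in which
  neighbouring cells are compared.\<close>

definition grid_cell :: "'a::euclidean_space \<Rightarrow> 'a \<Rightarrow> real \<Rightarrow> real \<Rightarrow> nat \<Rightarrow> nat \<Rightarrow> 'a set" where
  "grid_cell b b' h h' a c = {x. real a * h < x \<bullet> b \<and> x \<bullet> b < (real a + 1) * h \<and>
     real c * h' < x \<bullet> b' \<and> x \<bullet> b' < (real c + 1) * h'}"

lemma open_grid_cell: "open (grid_cell b b' h h' a c)"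
proof -
  have "grid_cell b b' h h' a c = {x. real a * h < x \<bullet> b} \<inter> {x. x \<bullet> b < (real a + 1) * h} \<inter>
     {x. real c * h' < x \<bullet> b'} \<inter> {x. x \<bullet> b' < (real c + 1) * h'}"
    by (auto simp: grid_cell_def)
  also have "open \<dots>" by (intro open_Int open_Collect_less continuous_intros)
  finally show ?thesis .
qed

lemma grid_cell_lebesgue: "grid_cell b b' h h' a c \<in> sets lebesgue"
  by (intro sets_completionI_sets) (simp add: borel_open[OF open_grid_cell])

lemma indicator_grid_cell:
  assumes "0 < h" "0 < h'"
  shows "indicator (grid_cell b b' h h' a c) x =
    indicator {0<..<1} ((x \<bullet> b) / h - real a) * (indicator {0<..<1} ((x \<bullet> b') / h' - real c) :: real)"
  using assms by (auto simp: grid_cell_def indicator_def field_simps)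

section \<open>Cell integrals tested against the total variation\<close>

lemma bounded_total_variation:
  assumes "total_variation \<Omega> u < \<infinity>"
  obtains V where "0 \<le> V" "\<And>\<psi>. \<psi> \<in> test_fields \<Omega> \<Longrightarrow> (LINT x:\<Omega>|lebesgue. u x * divergence \<psi> x) \<le> V"
proof -
  have "\<exists>V. total_variation \<Omega> u \<le> ereal V"
    using assms by (cases "total_variation \<Omega> u") auto
  then obtain V where V: "total_variation \<Omega> u \<le> ereal V" by blast
  have "(LINT x:\<Omega>|lebesgue. u x * divergence \<psi> x) \<le> max 0 V" if "\<psi> \<in> test_fields \<Omega>" for \<psi>
    using order_trans[OF SUP_upper[OF that] V[unfolded total_variation_def]] by simp
  then show thesis using that[of "max 0 V"] by simp
qed

lemma compact_strip_Int:
  fixes b b' :: "real \<times> real"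
  assumes bb: "(b, b') = ((1,0),(0,1)) \<or> (b, b') = ((0,1),(1,0))"
  shows "compact {x. \<alpha> \<le> x \<bullet> b \<and> x \<bullet> b \<le> \<beta> \<and> \<gamma> \<le> x \<bullet> b' \<and> x \<bullet> b' \<le> \<delta>}"
  using bb
proof
  assume "(b, b') = ((1,0),(0,1))"
  then have "{x. \<alpha> \<le> x \<bullet> b \<and> x \<bullet> b \<le> \<beta> \<and> \<gamma> \<le> x \<bullet> b' \<and> x \<bullet> b' \<le> \<delta>} = {\<alpha>..\<beta>} \<times> {\<gamma>..\<delta>}"
    by auto
  then show ?thesis by (simp add: compact_Times)
next
  assume "(b, b') = ((0,1),(1,0))"
  then have "{x. \<alpha> \<le> x \<bullet> b \<and> x \<bullet> b \<le> \<beta> \<and> \<gamma> \<le> x \<bullet> b' \<and> x \<bullet> b' \<le> \<delta>} = {\<gamma>..\<delta>} \<times> {\<alpha>..\<beta>}"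
    by auto
  then show ?thesis by (simp add: compact_Times)
qed

text \<open>Differences of neighbouring cell integrals are tested against a $C^1$ approximation of the
  sum of signed hat functions, whose supremum norm is at most one.\<close>

lemma cell_jumps_le_total_variation:
  fixes u :: "real \<times> real \<Rightarrow> real"
  assumes u: "u absolutely_integrable_on \<Omega>" and \<Omega>: "\<Omega> \<in> sets lebesgue"
    and V: "\<And>\<psi>. \<psi> \<in> test_fields \<Omega> \<Longrightarrow> (LINT x:\<Omega>|lebesgue. u x * divergence \<psi> x) \<le> V"
    and bb: "(b, b') = ((1,0),(0,1)) \<or> (b, b') = ((0,1),(1,0))"
    and h: "0 < h" "0 < h'"
    and sub: "\<And>x. 0 < x \<bullet> b \<Longrightarrow> x \<bullet> b < (real M + 1) * h \<Longrightarrow> 0 < x \<bullet> b' \<Longrightarrow> x \<bullet> b' < real K * h' \<Longrightarrow> x \<in> \<Omega>"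
  shows "(\<Sum>a<M. \<Sum>c<K. \<bar>(LINT x:grid_cell b b' h h' (Suc a) c|lebesgue. u x)
     - (LINT x:grid_cell b b' h h' a c|lebesgue. u x)\<bar>) \<le> h * V"
proof -
  define I where "I a c = (LINT x:grid_cell b b' h h' a c|lebesgue. u x)" for a c
  \<comment> \<open>The signs turn the tested sum into a sum of absolute values in the limit. The
    divergence produces cell \<open>a\<close> minus cell \<open>Suc a\<close>, hence the order of
    the two integrals.\<close>
  define \<sigma> where "\<sigma> a c = sgn (I a c - I (Suc a) c)" for a c
  \<comment> \<open>Integrand of a cell integral smoothed by bumps; it is dominated by u, so its
    integrals \<open>E\<close> converge to the sharp cell integrals.\<close>
  define F where "F k a c x = indicat_real \<Omega> x *\<^sub>R (u x *
      (unit_bump k ((x \<bullet> b) / h - real a) * unit_bump k ((x \<bullet> b') / h' - real c)))" for k a c x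
  define E where "E k a c = (LINT x|lebesgue. F k a c x)" for k a c
  have Basis: "Basis = {b, b'}" "b \<noteq> b'" "b \<bullet> b = 1" "b \<bullet> b' = 0" "b' \<bullet> b = 0"
  proof -
    have B: "Basis = {(1,0), (0,1::real) :: real \<times> real}" by (auto simp: Basis_prod_def)
    show "Basis = {b, b'}" "b \<noteq> b'" "b \<bullet> b = 1" "b \<bullet> b' = 0" "b' \<bullet> b = 0"
      using bb unfolding B by (elim disjE; clarsimp simp: insert_commute)+
  qed
  have sub': "grid_cell b b' h h' a c \<subseteq> \<Omega>" if "a \<le> M" "c < K" for a c
  proof
    fix x assume x: "x \<in> grid_cell b b' h h' a c"
    have "0 \<le> real a * h" "0 \<le> real c * h'" "(real a + 1) * h \<le> (real M + 1) * h"
      "(real c + 1) * h' \<le> real K * h'"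
      using h that by (auto intro!: mult_right_mono)
    then show "x \<in> \<Omega>" using x by (intro sub) (auto simp: grid_cell_def)
  qed
  have ui: "set_integrable lebesgue \<Omega> u" using u by simp
  have um: "(\<lambda>x. indicat_real \<Omega> x *\<^sub>R u x) \<in> borel_measurable lebesgue"
    using ui unfolding set_integrable_def by auto
  have bump_meas: "(\<lambda>x::real \<times> real. unit_bump k ((x \<bullet> d) / l - r)) \<in> borel_measurable lebesgue" if "0 < l" for k d l r
  proof -
    have "continuous_on UNIV (\<lambda>x. (x \<bullet> d) / l - r)" using that by (intro continuous_intros) auto
    from continuous_on_compose2[OF continuous_unit_bump[of UNIV k] this]
    have "(\<lambda>x::real \<times> real. unit_bump k ((x \<bullet> d) / l - r)) \<in> borel_measurable lborel"
      by (auto intro: borel_measurable_continuous_onI)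
    then show ?thesis by (rule measurable_completion)
  qed
  have F_le: "norm (F k a c x) \<le> norm (indicat_real \<Omega> x *\<^sub>R u x)" for k a c x
  proof -
    have "\<bar>unit_bump k s * unit_bump k t\<bar> \<le> 1" for s t
      using unit_bump_range[of k s] unit_bump_range[of k t] by (simp add: abs_mult mult_le_one)
    then show ?thesis by (simp add: F_def abs_mult indicator_def mult_left_le)
  qed
  have F_int: "integrable lebesgue (F k a c)" for k a c
  proof (rule Bochner_Integration.integrable_bound)
    show "integrable lebesgue (\<lambda>x. indicat_real \<Omega> x *\<^sub>R u x)" using ui by (simp add: set_integrable_def)
    have "(\<lambda>x. (indicat_real \<Omega> x *\<^sub>R u x) * (unit_bump k ((x \<bullet> b) / h - real a) * unit_bump k ((x \<bullet> b') / h' - real c)))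
       \<in> borel_measurable lebesgue"
      by (intro borel_measurable_times um bump_meas h)
    then show "F k a c \<in> borel_measurable lebesgue"
      unfolding F_def[abs_def] by (simp add: mult.assoc)
  qed (intro AE_I2 F_le)
  have Elim: "(\<lambda>k. E k a c) \<longlonglongrightarrow> I a c" if ac: "a \<le> M" "c < K" for a c
  proof -
    have "(\<lambda>k. LINT x|lebesgue. F k a c x)
      \<longlonglongrightarrow> (LINT x|lebesgue. indicat_real (grid_cell b b' h h' a c) x *\<^sub>R u x)"
    proof (rule integral_dominated_convergence[where w = "\<lambda>x. norm (indicat_real \<Omega> x *\<^sub>R u x)"])
      show "integrable lebesgue (\<lambda>x. norm (indicat_real \<Omega> x *\<^sub>R u x))"
        using ui unfolding set_integrable_def by (rule integrable_norm)
      have "set_integrable lebesgue (grid_cell b b' h h' a c) u"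
        by (rule set_integrable_subset[OF ui grid_cell_lebesgue sub'[OF ac]])
      then show "(\<lambda>x. indicat_real (grid_cell b b' h h' a c) x *\<^sub>R u x) \<in> borel_measurable lebesgue"
        unfolding set_integrable_def by auto
    next
      show "AE x in lebesgue. (\<lambda>k. F k a c x) \<longlonglongrightarrow> indicat_real (grid_cell b b' h h' a c) x *\<^sub>R u x"
      proof (intro AE_I2)
        fix x
        have "(\<lambda>k. F k a c x) \<longlonglongrightarrow> indicat_real \<Omega> x *\<^sub>R (u x *
            (indicator {0<..<1} ((x \<bullet> b) / h - real a) * indicator {0<..<1} ((x \<bullet> b') / h' - real c)))"
          unfolding F_def by (intro tendsto_intros unit_bump_tendsto)
        then show "(\<lambda>k. F k a c x) \<longlonglongrightarrow> indicat_real (grid_cell b b' h h' a c) x *\<^sub>R u x"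
          unfolding indicator_grid_cell[OF h, symmetric] using sub'[OF ac] by (auto simp: indicator_def split: if_splits)
      qed
    qed (use F_int F_le in auto)
    then show ?thesis by (simp add: E_def I_def set_lebesgue_integral_def)
  qed
  have bound: "(\<Sum>a<M. \<Sum>c<K. \<sigma> a c * (E k a c - E k (Suc a) c)) \<le> h * V" for k
  proof -
    obtain X where X: "\<And>t. (X has_real_derivative unit_bump k t) (at t)"
      "\<And>s t. s \<le> t \<Longrightarrow> X s \<le> X t" "\<And>s t. X t - X s \<le> 1"
      "\<And>s t. s \<le> 1 / real (Suc k) \<Longrightarrow> t \<le> 1 / real (Suc k) \<Longrightarrow> X s = X t"
      "\<And>s t. 1 - 1 / real (Suc k) \<le> s \<Longrightarrow> 1 - 1 / real (Suc k) \<le> t \<Longrightarrow> X s = X t"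
      by (rule unit_bump_antiderivative) blast
    \<comment> \<open>A C^1 hat over two neighbouring cells: its derivative is the bump of the first
      minus the bump of the second.\<close>
    define p where "p t = X t - X (t - 1)" for t
    have p_deriv: "(p has_real_derivative unit_bump k t - unit_bump k (t - 1)) (at t)" for t
      unfolding p_def[abs_def]
      by (rule derivative_eq_intros X(1) DERIV_chain2[OF X(1)] refl)+ simp
    have p_nonneg: "0 \<le> p t" for t using X(2)[of "t - 1" t] by (simp add: p_def)
    have p_cont: "continuous_on A p" for A
      using p_deriv by (meson DERIV_isCont continuous_at_imp_continuous_on)
    \<comment> \<open>Shifted hats telescope to a single increment of \<open>X\<close>.\<close>
    have p_sum: "(\<Sum>a<M. p (t - real a)) \<le> 1" for t
    proof -
      have "(\<Sum>a<n. p (t - real a)) = X t - X (t - real n)" for n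
        by (induction n) (simp_all add: p_def algebra_simps)
      then show ?thesis using X(3) by simp
    qed
    have p_supp: "p t = 0" if "t \<le> 1 / real (Suc k) \<or> 2 - 1 / real (Suc k) \<le> t" for t
      using that X(4)[of t "t - 1"] X(5)[of t "t - 1"] by (auto simp: p_def)
    define \<Psi> where "\<Psi> x = (\<Sum>a<M. \<Sum>c<K. \<sigma> a c * (p ((x \<bullet> b) / h - real a) * unit_bump k ((x \<bullet> b') / h' - real c)))" for x
    define \<Psi>1 where "\<Psi>1 x = (\<Sum>a<M. \<Sum>c<K. \<sigma> a c *
       ((unit_bump k ((x \<bullet> b) / h - real a) - unit_bump k ((x \<bullet> b) / h - real a - 1)) / h
         * unit_bump k ((x \<bullet> b') / h' - real c)))" for x
    define \<Psi>2 where "\<Psi>2 x = (\<Sum>a<M. \<Sum>c<K. \<sigma> a c *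
       (p ((x \<bullet> b) / h - real a) * (unit_bump_deriv k ((x \<bullet> b') / h' - real c) / h')))" for x
    have \<Psi>_deriv: "(\<Psi> has_derivative (\<lambda>v. (v \<bullet> b) * \<Psi>1 x + (v \<bullet> b') * \<Psi>2 x)) (at x)" for x
    proof -
      have lin: "((\<lambda>x. (x \<bullet> d) / l - r) has_derivative (\<lambda>v. (v \<bullet> d) / l)) (at x)" if "0 < l" for d l r
        using that by (auto intro!: derivative_eq_intros)
      have d1: "((\<lambda>x. p ((x \<bullet> b) / h - real a)) has_derivative
         (\<lambda>v. (unit_bump k ((x \<bullet> b) / h - real a) - unit_bump k ((x \<bullet> b) / h - real a - 1)) * ((v \<bullet> b) / h))) (at x)" for a
        using has_derivative_compose[OF lin[OF h(1)] p_deriv[unfolded has_field_derivative_def]] by simp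
      have d2: "((\<lambda>x. unit_bump k ((x \<bullet> b') / h' - real c)) has_derivative
         (\<lambda>v. unit_bump_deriv k ((x \<bullet> b') / h' - real c) * ((v \<bullet> b') / h'))) (at x)" for c
        using has_derivative_compose[OF lin[OF h(2)] DERIV_unit_bump[unfolded has_field_derivative_def]] by simp
      have alg: "\<sigma> * (P * (D * (v' / h')) + (A - B) * (v / h) * W)
        = v * (\<sigma> * ((A - B) / h * W)) + v' * (\<sigma> * (P * (D / h')))" for \<sigma> P D v v' A B W
        by (simp add: diff_divide_distrib algebra_simps)
      have "(\<Psi> has_derivative (\<lambda>v. \<Sum>a<M. \<Sum>c<K. \<sigma> a c *
         (p ((x \<bullet> b) / h - real a) * (unit_bump_deriv k ((x \<bullet> b') / h' - real c) * ((v \<bullet> b') / h'))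
          + (unit_bump k ((x \<bullet> b) / h - real a) - unit_bump k ((x \<bullet> b) / h - real a - 1)) * ((v \<bullet> b) / h)
            * unit_bump k ((x \<bullet> b') / h' - real c)))) (at x)"
        unfolding \<Psi>_def[abs_def]
        by (intro has_derivative_sum has_derivative_mult_right has_derivative_mult d1 d2)
      also have "(\<lambda>v. \<Sum>a<M. \<Sum>c<K. \<sigma> a c *
         (p ((x \<bullet> b) / h - real a) * (unit_bump_deriv k ((x \<bullet> b') / h' - real c) * ((v \<bullet> b') / h'))
          + (unit_bump k ((x \<bullet> b) / h - real a) - unit_bump k ((x \<bullet> b) / h - real a - 1)) * ((v \<bullet> b) / h)
            * unit_bump k ((x \<bullet> b') / h' - real c))) = (\<lambda>v. (v \<bullet> b) * \<Psi>1 x + (v \<bullet> b') * \<Psi>2 x)"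
        unfolding \<Psi>1_def \<Psi>2_def sum_distrib_left sum.distrib[symmetric]
        by (intro ext sum.cong refl alg)
      finally show ?thesis .
    qed
    \<comment> \<open>The field points along \<open>b\<close> only, so its divergence is the partial
      derivative \<open>\<Psi>1\<close>.\<close>
    define \<psi> where "\<psi> x = \<Psi> x *\<^sub>R b" for x
    have \<psi>_deriv: "(\<psi> has_derivative (\<lambda>v. ((v \<bullet> b) * \<Psi>1 x + (v \<bullet> b') * \<Psi>2 x) *\<^sub>R b)) (at x)" for x
      unfolding \<psi>_def[abs_def] by (rule has_derivative_scaleR_left[OF \<Psi>_deriv])
    have fd: "frechet_derivative \<psi> (at x) = (\<lambda>v. ((v \<bullet> b) * \<Psi>1 x + (v \<bullet> b') * \<Psi>2 x) *\<^sub>R b)" for x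
      by (rule frechet_derivative_at[OF \<psi>_deriv, symmetric])
    have div: "divergence \<psi> x = \<Psi>1 x" for x
      unfolding divergence_def fd Basis(1) using Basis(2-5) by simp
    have \<Psi>_bound: "\<bar>\<Psi> x\<bar> \<le> 1" for x
    proof -
      have "\<bar>\<sigma> a c\<bar> \<le> 1" for a c by (simp add: \<sigma>_def sgn_if)
      then have t: "\<bar>\<sigma> a c * (p s * unit_bump k t)\<bar> \<le> p s * unit_bump k t" for a c s t
        using p_nonneg[of s] unit_bump_range(1)[of k t] by (simp add: abs_mult mult_left_le_one_le)
      have "\<bar>\<Psi> x\<bar> \<le> (\<Sum>a<M. \<Sum>c<K. p ((x \<bullet> b) / h - real a) * unit_bump k ((x \<bullet> b') / h' - real c))"
        unfolding \<Psi>_def by (intro order_trans[OF sum_abs] sum_mono order_trans[OF sum_abs] t)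
      also have "\<dots> = (\<Sum>a<M. p ((x \<bullet> b) / h - real a)) * (\<Sum>c<K. unit_bump k ((x \<bullet> b') / h' - real c))"
        by (simp add: sum_product)
      also have "\<dots> \<le> 1"
        by (intro mult_le_one p_sum sum_unit_bump_le sum_nonneg unit_bump_range)
      finally show ?thesis .
    qed
    have "\<psi> \<in> test_fields \<Omega>"
      unfolding test_fields_def
    proof (intro CollectI conjI allI)
      fix x
      show "\<psi> differentiable at x" using \<psi>_deriv unfolding differentiable_def by blast
      show "norm (\<psi> x) \<le> 1" using \<Psi>_bound[of x] bb by (auto simp: \<psi>_def norm_Pair)
    next
      fix v
      have cb: "continuous_on UNIV (\<lambda>x::real\<times>real. unit_bump k ((x \<bullet> d) / l - r))" if "0 < l" for d l r
        by (intro continuous_on_compose2[OF continuous_unit_bump[of UNIV]] continuous_intros) (use that in auto)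
      have cb1: "continuous_on UNIV (\<lambda>x::real\<times>real. unit_bump k ((x \<bullet> d) / l - r - 1))" if "0 < l" for d l r
        by (intro continuous_on_compose2[OF continuous_unit_bump[of UNIV]] continuous_intros) (use that in auto)
      have cd: "continuous_on UNIV (\<lambda>x::real\<times>real. unit_bump_deriv k ((x \<bullet> d) / l - r))" if "0 < l" for d l r
        by (intro continuous_on_compose2[OF continuous_unit_bump_deriv[of UNIV]] continuous_intros) (use that in auto)
      have cp: "continuous_on UNIV (\<lambda>x::real\<times>real. p ((x \<bullet> d) / l - r))" if "0 < l" for d l r
        by (intro continuous_on_compose2[OF p_cont[of UNIV]] continuous_intros) (use that in auto)
      have "continuous_on UNIV \<Psi>1" "continuous_on UNIV \<Psi>2"
        unfolding \<Psi>1_def[abs_def] \<Psi>2_def[abs_def]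
        by (intro continuous_intros cb cb1 cd cp h; use h in simp)+
      then show "continuous_on UNIV (\<lambda>x. frechet_derivative \<psi> (at x) v)"
        unfolding fd by (intro continuous_intros)
    next
      let ?\<epsilon> = "1 / real (Suc k)"
      \<comment> \<open>The hats reach over \<open>M + 1\<close> cells along \<open>b\<close>, the
        bumps over \<open>K\<close> cells along \<open>b'\<close>. The margin of
        \<open>?\<epsilon>\<close> cells places the support in a compact subset of the open
        rectangle.\<close>
      let ?C = "{x. ?\<epsilon> * h \<le> x \<bullet> b \<and> x \<bullet> b \<le> (real M + 1 - ?\<epsilon>) * h \<and>
                   ?\<epsilon> * h' \<le> x \<bullet> b' \<and> x \<bullet> b' \<le> (real K - ?\<epsilon>) * h'}"
      have e: "0 < ?\<epsilon>" by simp
      have "compact ?C" by (rule compact_strip_Int[OF bb])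
      moreover have "?C \<subseteq> \<Omega>"
      proof
        fix x assume x: "x \<in> ?C"
        have "0 < ?\<epsilon> * h" "0 < ?\<epsilon> * h'" using h by auto
        moreover have "(real M + 1 - ?\<epsilon>) * h < (real M + 1) * h" "(real K - ?\<epsilon>) * h' < real K * h'"
          using h e by (auto intro!: mult_strict_right_mono)
        ultimately show "x \<in> \<Omega>" using x by (intro sub) auto
      qed
      moreover have "\<psi> x = 0" if "x \<notin> ?C" for x
      proof -
        have "p ((x \<bullet> b) / h - real a) * unit_bump k ((x \<bullet> b') / h' - real c) = 0" if ac: "a < M" "c < K" for a c
        proof (rule ccontr)
          assume "\<not> ?thesis"
          then have "?\<epsilon> < (x \<bullet> b) / h - real a" "(x \<bullet> b) / h - real a < 2 - ?\<epsilon>"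
            "?\<epsilon> < (x \<bullet> b') / h' - real c" "(x \<bullet> b') / h' - real c < 1 - ?\<epsilon>"
            using p_supp[of "(x \<bullet> b) / h - real a"] unit_bump_support[of "(x \<bullet> b') / h' - real c" k]
            by (auto simp: not_le[symmetric])
          moreover have "real a + 1 \<le> real M" "real c + 1 \<le> real K" using ac by linarith+
          moreover have "0 \<le> real a" "0 \<le> real c" by auto
          ultimately have "?\<epsilon> \<le> (x \<bullet> b) / h" "(x \<bullet> b) / h \<le> real M + 1 - ?\<epsilon>"
            "?\<epsilon> \<le> (x \<bullet> b') / h'" "(x \<bullet> b') / h' \<le> real K - ?\<epsilon>" by linarith+
          then have "x \<in> ?C" using h by (simp add: pos_le_divide_eq pos_divide_le_eq)
          then show False using \<open>x \<notin> ?C\<close> by blast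
        qed
        then have "\<Psi> x = 0" unfolding \<Psi>_def by (intro sum.neutral ballI) auto
        then show ?thesis by (simp add: \<psi>_def)
      qed
      ultimately show "\<exists>K. compact K \<and> K \<subseteq> \<Omega> \<and> (\<forall>x. x \<notin> K \<longrightarrow> \<psi> x = 0)" by blast
    qed
    then have "(LINT x:\<Omega>|lebesgue. u x * \<Psi>1 x) \<le> V" using V[of \<psi>] by (simp add: div)
    \<comment> \<open>Differentiating a hat that is measured in cell units costs
      \<open>1 / h\<close>, which becomes the factor \<open>h\<close> of the claim.\<close>
    moreover have "(LINT x:\<Omega>|lebesgue. u x * \<Psi>1 x) = (\<Sum>a<M. \<Sum>c<K. \<sigma> a c * (E k a c - E k (Suc a) c)) / h"
    proof -
      have "indicat_real \<Omega> x *\<^sub>R (u x * \<Psi>1 x)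
        = (\<Sum>a<M. \<Sum>c<K. (\<sigma> a c / h) * (F k a c x - F k (Suc a) c x))" for x
      proof -
        have e: "s - real (Suc a) = s - real a - 1" for s and a :: nat by simp
        have alg: "\<iota> *\<^sub>R (y * (\<sigma> * ((A - B) / h * W))) = \<sigma> / h * (\<iota> *\<^sub>R (y * (A * W)) - \<iota> *\<^sub>R (y * (B * W)))"
          for \<iota> y \<sigma> A B W by (simp add: diff_divide_distrib algebra_simps)
        show ?thesis unfolding F_def e \<Psi>1_def sum_distrib_left scaleR_sum_right
          by (intro sum.cong refl alg)
      qed
      then have "(LINT x:\<Omega>|lebesgue. u x * \<Psi>1 x) = (\<Sum>a<M. \<Sum>c<K. (\<sigma> a c / h) * (E k a c - E k (Suc a) c))"
        unfolding set_lebesgue_integral_def E_def using F_int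
        by (simp add: Bochner_Integration.integral_sum Bochner_Integration.integrable_sum)
      also have "\<dots> = (\<Sum>a<M. \<Sum>c<K. \<sigma> a c * (E k a c - E k (Suc a) c)) / h"
        by (simp add: sum_divide_distrib)
      finally show ?thesis .
    qed
    ultimately show ?thesis using h by (simp add: pos_divide_le_eq mult.commute)
  qed
  have "(\<lambda>k. \<Sum>a<M. \<Sum>c<K. \<sigma> a c * (E k a c - E k (Suc a) c))
     \<longlonglongrightarrow> (\<Sum>a<M. \<Sum>c<K. \<sigma> a c * (I a c - I (Suc a) c))"
    by (intro tendsto_sum tendsto_mult tendsto_const tendsto_diff Elim) auto
  then have "(\<Sum>a<M. \<Sum>c<K. \<sigma> a c * (I a c - I (Suc a) c)) \<le> h * V"
    by (rule LIMSEQ_le_const2) (use bound in auto)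
  moreover have "\<sigma> a c * (I a c - I (Suc a) c) = \<bar>I (Suc a) c - I a c\<bar>" for a c
    by (simp add: \<sigma>_def sgn_if)
  ultimately show ?thesis by (simp add: I_def)
qed

section \<open>Sums of cell integrals and discrete traces\<close>

lemma grid_cell_unique:
  assumes "0 < h" "0 < h'" "x \<in> grid_cell b b' h h' a c" "x \<in> grid_cell b b' h h' a' c'"
  shows "a = a'" "c = c'"
proof -
  have *: "m = n" if "real m * l < s" "s < (real m + 1) * l" "real n * l < s" "s < (real n + 1) * l" "0 < l"
    for m n :: nat and l s :: real
  proof -
    have "real m * l < (real n + 1) * l" "real n * l < (real m + 1) * l" using that by linarith+
    then have "real m < real n + 1" "real n < real m + 1" using that by auto
    then show ?thesis by linarith
  qed
  show "a = a'" "c = c'" using assms *[of a h "x \<bullet> b" a'] *[of c h' "x \<bullet> b'" c']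
    by (auto simp: grid_cell_def)
qed

lemma sum_abs_integrals_le:
  fixes u :: "'a::euclidean_space \<Rightarrow> real"
  assumes u: "u absolutely_integrable_on \<Omega>" and I: "finite I" "disjoint_family_on D I"
    and D: "\<And>i. i \<in> I \<Longrightarrow> D i \<in> sets lebesgue" "\<And>i. i \<in> I \<Longrightarrow> D i \<subseteq> \<Omega>"
  shows "(\<Sum>i\<in>I. \<bar>LINT x:D i|lebesgue. u x\<bar>) \<le> (LINT x:\<Omega>|lebesgue. \<bar>u x\<bar>)"
proof -
  have ui: "set_integrable lebesgue \<Omega> u" using u by simp
  have uD: "set_integrable lebesgue (D i) u" if "i \<in> I" for i
    by (rule set_integrable_subset[OF ui D(1)[OF that] D(2)[OF that]])
  have aD: "integrable lebesgue (\<lambda>x. indicat_real (D i) x *\<^sub>R \<bar>u x\<bar>)" if "i \<in> I" for i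
    using set_integrable_abs[OF uD[OF that]] by (simp add: set_integrable_def)
  have a\<Omega>: "integrable lebesgue (\<lambda>x. indicat_real \<Omega> x *\<^sub>R \<bar>u x\<bar>)"
    using set_integrable_abs[OF ui] by (simp add: set_integrable_def)
  have "(\<Sum>i\<in>I. \<bar>LINT x:D i|lebesgue. u x\<bar>) \<le> (\<Sum>i\<in>I. LINT x|lebesgue. indicat_real (D i) x *\<^sub>R \<bar>u x\<bar>)"
  proof (rule sum_mono)
    fix i assume "i \<in> I"
    show "\<bar>LINT x:D i|lebesgue. u x\<bar> \<le> (LINT x|lebesgue. indicat_real (D i) x *\<^sub>R \<bar>u x\<bar>)"
      using integral_abs_bound[of lebesgue "\<lambda>x. indicat_real (D i) x *\<^sub>R u x"]
      by (simp add: set_lebesgue_integral_def abs_mult)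
  qed
  also have "\<dots> = (LINT x|lebesgue. (\<Sum>i\<in>I. indicat_real (D i) x *\<^sub>R \<bar>u x\<bar>))"
    by (rule Bochner_Integration.integral_sum[symmetric]) (rule aD)
  also have "\<dots> \<le> (LINT x|lebesgue. indicat_real \<Omega> x *\<^sub>R \<bar>u x\<bar>)"
  proof (rule integral_mono[OF _ a\<Omega>])
    show "integrable lebesgue (\<lambda>x. \<Sum>i\<in>I. indicat_real (D i) x *\<^sub>R \<bar>u x\<bar>)"
      by (intro Bochner_Integration.integrable_sum aD)
    fix x
    have "(\<Sum>i\<in>I. indicat_real (D i) x) = indicat_real (\<Union>i\<in>I. D i) x"
      by (rule indicator_UN_disjoint[OF I, symmetric])
    also have "\<dots> \<le> indicat_real \<Omega> x" using D(2) by (auto simp: indicator_def)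
    finally show "(\<Sum>i\<in>I. indicat_real (D i) x *\<^sub>R \<bar>u x\<bar>) \<le> indicat_real \<Omega> x *\<^sub>R \<bar>u x\<bar>"
      unfolding scaleR_left.sum[symmetric] by (simp add: mult_right_mono)
  qed
  finally show ?thesis by (simp add: set_lebesgue_integral_def)
qed

lemma grid_l1_le:
  fixes u :: "'a::euclidean_space \<Rightarrow> real"
  assumes u: "u absolutely_integrable_on \<Omega>" and h: "0 < h" "0 < h'"
    and sub: "\<And>a c. a < M \<Longrightarrow> c < K \<Longrightarrow> P a c \<Longrightarrow> grid_cell b b' h h' a c \<subseteq> \<Omega>"
  shows "(\<Sum>a<M. \<Sum>c<K. if P a c then \<bar>LINT x:grid_cell b b' h h' a c|lebesgue. u x\<bar> else 0)
    \<le> (LINT x:\<Omega>|lebesgue. \<bar>u x\<bar>)"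
proof -
  let ?I = "{ac \<in> {..<M} \<times> {..<K}. P (fst ac) (snd ac)}"
  let ?D = "\<lambda>ac. grid_cell b b' h h' (fst ac) (snd ac)"
  have "(\<Sum>a<M. \<Sum>c<K. if P a c then \<bar>LINT x:grid_cell b b' h h' a c|lebesgue. u x\<bar> else 0)
    = (\<Sum>ac\<in>{..<M} \<times> {..<K}. if P (fst ac) (snd ac) then \<bar>LINT x:?D ac|lebesgue. u x\<bar> else 0)"
    by (simp add: sum.cartesian_product case_prod_unfold)
  also have "\<dots> = (\<Sum>ac\<in>?I. \<bar>LINT x:?D ac|lebesgue. u x\<bar>)"
    by (rule sum.inter_filter[symmetric]) simp
  also have "\<dots> \<le> (LINT x:\<Omega>|lebesgue. \<bar>u x\<bar>)"
  proof (rule sum_abs_integrals_le[OF u])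
    show "disjoint_family_on ?D ?I"
      unfolding disjoint_family_on_def
    proof (intro ballI impI)
      fix p q :: "nat \<times> nat" assume "p \<noteq> q"
      then show "?D p \<inter> ?D q = {}"
        by (metis disjoint_iff grid_cell_unique[OF h] prod_eqI)
    qed
  qed (auto simp: grid_cell_lebesgue dest!: sub intro: finite_subset[of _ "{..<M} \<times> {..<K}"])
  finally show ?thesis .
qed

lemma integral_tail:
  fixes u :: "'a::euclidean_space \<Rightarrow> real"
  assumes u: "u absolutely_integrable_on \<Omega>" and \<Omega>: "\<Omega> \<in> sets lebesgue" and \<epsilon>: "0 < \<epsilon>"
  obtains X where "0 \<le> X" "(LINT x:{x\<in>\<Omega>. X \<le> x \<bullet> d}|lebesgue. \<bar>u x\<bar>) < \<epsilon>"
    "u absolutely_integrable_on {x\<in>\<Omega>. X \<le> x \<bullet> d}"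
proof -
  have ui: "set_integrable lebesgue \<Omega> u" using u by simp
  have "closed {x. r \<le> x \<bullet> d}" for r by (intro closed_Collect_le continuous_intros)
  then have H: "{x. r \<le> x \<bullet> d} \<in> sets lebesgue" for r
    by (intro sets_completionI_sets) (simp add: borel_closed)
  have D: "{x\<in>\<Omega>. r \<le> x \<bullet> d} \<in> sets lebesgue" for r
    using sets.Int[OF \<Omega> H[of r]] by (simp add: Collect_conj_eq)
  have uD: "set_integrable lebesgue {x\<in>\<Omega>. r \<le> x \<bullet> d} u" for r
    by (rule set_integrable_subset[OF ui D]) auto
  have "(\<lambda>n. LINT x|lebesgue. indicat_real {x\<in>\<Omega>. real n \<le> x \<bullet> d} x *\<^sub>R \<bar>u x\<bar>) \<longlonglongrightarrow> (LINT x|(lebesgue :: 'a measure). (0::real))"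
  proof (rule integral_dominated_convergence[where w = "\<lambda>x. indicat_real \<Omega> x *\<^sub>R \<bar>u x\<bar>" and f = "\<lambda>_. 0"])
    show "integrable lebesgue (\<lambda>x. indicat_real \<Omega> x *\<^sub>R \<bar>u x\<bar>)"
      using set_integrable_abs[OF ui] by (simp add: set_integrable_def)
    show "(\<lambda>x. indicat_real {x\<in>\<Omega>. real n \<le> x \<bullet> d} x *\<^sub>R \<bar>u x\<bar>) \<in> borel_measurable lebesgue" for n
      using set_integrable_abs[OF uD[of "real n"]] unfolding set_integrable_def by (rule borel_measurable_integrable)
    show "AE x in lebesgue. norm (indicat_real {x\<in>\<Omega>. real n \<le> x \<bullet> d} x *\<^sub>R \<bar>u x\<bar>) \<le> indicat_real \<Omega> x *\<^sub>R \<bar>u x\<bar>" for n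
      by (intro AE_I2) (simp add: indicator_def)
    show "AE x in lebesgue. (\<lambda>n. indicat_real {x\<in>\<Omega>. real n \<le> x \<bullet> d} x *\<^sub>R \<bar>u x\<bar>) \<longlonglongrightarrow> 0"
    proof (intro AE_I2 tendsto_eventually)
      fix x :: 'a
      obtain n0 :: nat where "x \<bullet> d < real n0" using reals_Archimedean2 by blast
      then show "\<forall>\<^sub>F n in sequentially. indicat_real {x\<in>\<Omega>. real n \<le> x \<bullet> d} x *\<^sub>R \<bar>u x\<bar> = 0"
        by (intro eventually_sequentiallyI[of n0]) (auto simp: indicator_def)
    qed
  qed simp
  then have "(\<lambda>n. LINT x:{x\<in>\<Omega>. real n \<le> x \<bullet> d}|lebesgue. \<bar>u x\<bar>) \<longlonglongrightarrow> 0"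
    by (simp add: set_lebesgue_integral_def)
  then have "\<forall>\<^sub>F n in sequentially. (LINT x:{x\<in>\<Omega>. real n \<le> x \<bullet> d}|lebesgue. \<bar>u x\<bar>) < \<epsilon>"
    by (rule order_tendstoD(2)[OF _ \<epsilon>])
  then obtain n where "(LINT x:{x\<in>\<Omega>. real n \<le> x \<bullet> d}|lebesgue. \<bar>u x\<bar>) < \<epsilon>"
    by (meson eventually_sequentially order_refl)
  then show thesis using that[of "real n"] uD[of "real n"] by simp
qed

lemma grid_cell_measure:
  fixes b b' :: "real \<times> real"
  assumes bb: "(b, b') = ((1,0),(0,1)) \<or> (b, b') = ((0,1),(1,0))"
    and h: "0 < h" "0 < h'"
  shows "grid_cell b b' h h' a c \<in> lmeasurable" "measure lebesgue (grid_cell b b' h h' a c) = h * h'"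
proof -
  have eq: "grid_cell b b' h h' a c = (if b = (1,0)
      then {real a * h<..<(real a + 1) * h} \<times> {real c * h'<..<(real c + 1) * h'}
      else {real c * h'<..<(real c + 1) * h'} \<times> {real a * h<..<(real a + 1) * h})"
    using bb
  proof
    assume "(b, b') = ((1,0),(0,1))"
    then show ?thesis by (auto simp: grid_cell_def)
  next
    assume "(b, b') = ((0,1),(1,0))"
    then show ?thesis by (auto simp: grid_cell_def)
  qed
  have T: "emeasure lborel ({real m * l<..<(real m + 1) * l} \<times> {real n * l'<..<(real n + 1) * l'}) = ennreal (l * l')"
    if "0 < l" "0 < l'" for m n l l'
  proof -
    have "emeasure (lborel \<Otimes>\<^sub>M lborel) ({real m * l<..<(real m + 1) * l} \<times> {real n * l'<..<(real n + 1) * l'})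
      = emeasure lborel {real m * l<..<(real m + 1) * l} * emeasure lborel {real n * l'<..<(real n + 1) * l'}"
      by (rule lborel.emeasure_pair_measure_Times) auto
    also have "\<dots> = ennreal l * ennreal l'" using that by (simp add: algebra_simps)
    finally show ?thesis using that by (simp add: lborel_prod ennreal_mult)
  qed
  have e: "emeasure lebesgue (grid_cell b b' h h' a c) = ennreal (h * h')"
  proof -
    have "emeasure lebesgue (grid_cell b b' h h' a c) = emeasure lborel (grid_cell b b' h h' a c)"
      using open_grid_cell[of b b' h h' a c] by simp
    also have "\<dots> = ennreal (h * h')"
      unfolding eq using T[OF h] T[OF h(2,1)] by (simp add: mult.commute)
    finally show ?thesis .
  qed
  show "grid_cell b b' h h' a c \<in> lmeasurable"
    unfolding fmeasurable_def using e grid_cell_lebesgue[of b b' h h' a c] by simp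
  show "measure lebesgue (grid_cell b b' h h' a c) = h * h'"
    using e h by (simp add: measure_def)
qed

lemma abs_integral_le_measure:
  fixes u :: "'a::euclidean_space \<Rightarrow> real"
  assumes u: "u absolutely_integrable_on \<Omega>" and \<Omega>: "\<Omega> \<in> sets lebesgue"
    and U: "AE x in lebesgue_on \<Omega>. \<bar>u x\<bar> \<le> U"
    and D: "D \<subseteq> \<Omega>" "D \<in> lmeasurable"
  shows "\<bar>LINT x:D|lebesgue. u x\<bar> \<le> U * measure lebesgue D"
proof -
  have ui: "set_integrable lebesgue \<Omega> u" using u by simp
  have uD: "set_integrable lebesgue D u" by (rule set_integrable_subset[OF ui _ D(1)]) (use D in auto)
  have "\<bar>LINT x:D|lebesgue. u x\<bar> \<le> (LINT x|lebesgue. \<bar>indicat_real D x *\<^sub>R u x\<bar>)"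
    unfolding set_lebesgue_integral_def by (rule integral_abs_bound)
  also have "\<dots> \<le> (LINT x|lebesgue. U * indicat_real D x)"
  proof (rule integral_mono_AE)
    show "integrable lebesgue (\<lambda>x. \<bar>indicat_real D x *\<^sub>R u x\<bar>)"
      using uD unfolding set_integrable_def by (rule integrable_abs)
    show "integrable lebesgue (\<lambda>x. U * indicat_real D x)"
      using D(2) by (intro integrable_mult_right integrable_real_indicator) (auto simp: fmeasurable_def)
    have "AE x in lebesgue. x \<in> \<Omega> \<longrightarrow> \<bar>u x\<bar> \<le> U"
      using U \<Omega> by (simp add: AE_restrict_space_iff)
    then show "AE x in lebesgue. \<bar>indicat_real D x *\<^sub>R u x\<bar> \<le> U * indicat_real D x"
      by (rule AE_mp) (use D(1) in \<open>auto simp: indicator_def\<close>)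
  qed
  also have "\<dots> = U * measure lebesgue D" using D(2) by simp
  finally show ?thesis .
qed

text \<open>A discrete trace inequality: any two values differ by at most the variation, so a single
  value is at most the average plus the variation. Both sides are multiplied by \<open>N\<close> to
  avoid divisions.\<close>

lemma trace_le:
  fixes a :: "nat \<Rightarrow> real"
  assumes "n < N"
  shows "real N * \<bar>a n\<bar> \<le> (\<Sum>m<N. \<bar>a m\<bar>) + real N * (\<Sum>m<N - 1. \<bar>a (Suc m) - a m\<bar>)"
proof -
  have up: "\<bar>a l - a m\<bar> \<le> (\<Sum>m<N - 1. \<bar>a (Suc m) - a m\<bar>)" if "m \<le> l" "l < N" for l m
  proof -
    have "\<bar>a l - a m\<bar> \<le> (\<Sum>i=m..<l. \<bar>a (Suc i) - a i\<bar>)"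
      unfolding sum_Suc_diff'[OF that(1), of a, symmetric] by (rule sum_abs)
    also have "\<dots> \<le> (\<Sum>m<N - 1. \<bar>a (Suc m) - a m\<bar>)" by (rule sum_mono2) (use that in auto)
    finally show ?thesis .
  qed
  have "\<bar>a n\<bar> \<le> \<bar>a m\<bar> + (\<Sum>m<N - 1. \<bar>a (Suc m) - a m\<bar>)" if "m < N" for m
    using up[of m n] up[of n m] assms that by (cases "m \<le> n") linarith+
  then have "(\<Sum>m<N. \<bar>a n\<bar>) \<le> (\<Sum>m<N. \<bar>a m\<bar> + (\<Sum>m<N - 1. \<bar>a (Suc m) - a m\<bar>))"
    by (intro sum_mono) auto
  then show ?thesis by (simp add: sum.distrib)
qed

section \<open>Compactness of step functions\<close>

text \<open>For each \<open>k\<close> one infinite colour class beyond \<open>P\<close> is kept,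
  inside which all distances are at most \<open>(1/2) ^ k\<close>; the diagonal sequence eventually
  stays in each of them. Finite colourings play the part of total boundedness, without a metric
  space of functions of time.\<close>

lemma cauchy_subsequence:
  fixes d :: "nat \<Rightarrow> nat \<Rightarrow> ennreal"
  assumes colour: "\<And>\<epsilon>::real. 0 < \<epsilon> \<Longrightarrow> \<exists>(c :: nat \<Rightarrow> 'c) P. finite (range c) \<and>
     (\<forall>p\<ge>P. \<forall>q\<ge>P. c p = c q \<longrightarrow> d p q \<le> ennreal \<epsilon>)"
  obtains r where "strict_mono r" "\<And>k p q. k < p \<Longrightarrow> k < q \<Longrightarrow> d (r p) (r q) \<le> ennreal ((1/2) ^ k)"
proof -
  interpret subseqs "\<lambda>k s. \<forall>p q. d (s p) (s q) \<le> ennreal ((1/2) ^ k)"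
  proof
    fix k and s :: "nat \<Rightarrow> nat" assume s: "strict_mono s"
    obtain c :: "nat \<Rightarrow> 'c" and P where c: "finite (range c)"
      "\<forall>p\<ge>P. \<forall>q\<ge>P. c p = c q \<longrightarrow> d p q \<le> ennreal ((1/2) ^ k)"
      using colour[of "(1/2) ^ k"] by auto
    have "finite ((c \<circ> s) ` {P..})" by (rule finite_subset[OF _ c(1)]) auto
    then obtain p0 where p0: "infinite {p \<in> {P..}. (c \<circ> s) p = (c \<circ> s) p0}"
      using pigeonhole_infinite[of "{P..}" "c \<circ> s"] infinite_Ici by blast
    define r where "r = enumerate {p \<in> {P..}. (c \<circ> s) p = (c \<circ> s) p0}"
    have r: "strict_mono r" unfolding r_def by (rule strict_mono_enumerate[OF p0])
    have in_set: "r p \<ge> P \<and> c (s (r p)) = c (s p0)" for p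
      using enumerate_in_set[OF p0, of p] by (simp add: r_def)
    have dk: "d ((s \<circ> r) p) ((s \<circ> r) q) \<le> ennreal ((1/2) ^ k)" for p q
    proof -
      have "P \<le> s (r p)" "P \<le> s (r q)"
        using in_set[of p] in_set[of q] seq_suble[OF s] order_trans by blast+
      then show ?thesis using c(2) in_set[of p] in_set[of q] by simp
    qed
    show "\<exists>r' :: nat \<Rightarrow> nat. strict_mono r' \<and> (\<forall>p q. d ((s \<circ> r') p) ((s \<circ> r') q) \<le> ennreal ((1/2) ^ k))"
      by (intro exI[of _ r] conjI allI r dk)
  qed
  \<comment> \<open>From \<open>Suc k\<close> on the diagonal is a subsequence of the
    \<open>k\<close>-th extraction, and a bound for all pairs passes to subsequences.\<close>
  have *: "\<forall>p q. d ((diagseq \<circ> (+) (Suc k)) p) ((diagseq \<circ> (+) (Suc k)) q) \<le> ennreal ((1/2) ^ k)" for k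
    by (rule diagseq_holds) simp
  show thesis
  proof (rule that[OF subseq_diagseq])
    fix k p q :: nat assume "k < p" "k < q"
    then show "d (diagseq p) (diagseq q) \<le> ennreal ((1/2) ^ k)"
      using *[of k, rule_format, of "p - Suc k" "q - Suc k"] by simp
  qed
qed

text \<open>Defined on the whole plane and zero outside the closed quadrant, so that it can be
  translated freely. For positive \<open>h\<close> the floors give half-open cells, which partition
  the quadrant and differ from the open cells of the scheme by a null set.\<close>

definition step_fun :: "real \<Rightarrow> (nat \<Rightarrow> nat \<Rightarrow> real) \<Rightarrow> real \<times> real \<Rightarrow> real" where
  "step_fun h g x = (if 0 \<le> fst x \<and> 0 \<le> snd x then g (nat \<lfloor>fst x / h\<rfloor>) (nat \<lfloor>snd x / h\<rfloor>) else 0)"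

lemma measurable_step_fun [measurable]: "step_fun h g \<in> borel_measurable borel"
proof -
  have [measurable]: "fst \<in> borel_measurable (borel :: (real \<times> real) measure)"
    "snd \<in> borel_measurable (borel :: (real \<times> real) measure)"
    unfolding borel_prod[symmetric] by measurable
  have [measurable]: "(\<lambda>x :: real \<times> real. nat \<lfloor>fst x / h\<rfloor>) \<in> borel \<rightarrow>\<^sub>M count_space UNIV"
    "(\<lambda>x :: real \<times> real. nat \<lfloor>snd x / h\<rfloor>) \<in> borel \<rightarrow>\<^sub>M count_space UNIV"
    by measurable
  have [measurable]: "(\<lambda>x :: real \<times> real. g (nat \<lfloor>fst x / h\<rfloor>) (nat \<lfloor>snd x / h\<rfloor>)) \<in> borel_measurable borel"
    by (rule measurable_compose_countable[where f = "\<lambda>j x. g j (nat \<lfloor>snd x / h\<rfloor>)"]) measurable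
  show ?thesis unfolding step_fun_def[abs_def] by measurable
qed

lemma step_fun_swap: "step_fun h g (prod.swap x) = step_fun h (\<lambda>j k. g k j) x"
  by (auto simp: step_fun_def)

lemma nn_integral_swap_lborel:
  fixes F :: "real \<times> real \<Rightarrow> ennreal"
  assumes "F \<in> borel_measurable borel"
  shows "(\<integral>\<^sup>+ x. F (prod.swap x) \<partial>lborel) = (\<integral>\<^sup>+ x. F x \<partial>lborel)"
proof -
  have F: "F \<in> borel_measurable (lborel \<Otimes>\<^sub>M lborel)" using assms by (simp add: lborel_prod)
  have "(\<integral>\<^sup>+ x. F x \<partial>(lborel \<Otimes>\<^sub>M lborel)) = (\<integral>\<^sup>+ x. F x \<partial>distr (lborel \<Otimes>\<^sub>M lborel) (lborel \<Otimes>\<^sub>M lborel) (\<lambda>(x, y). (y, x)))"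
    by (subst lborel_pair.distr_pair_swap[symmetric]) simp
  also have "\<dots> = (\<integral>\<^sup>+ x. F ((\<lambda>(x, y). (y, x)) x) \<partial>(lborel \<Otimes>\<^sub>M lborel))"
    by (rule nn_integral_distr) (use F in auto)
  finally show ?thesis by (simp add: lborel_prod prod.swap_def case_prod_unfold)
qed

lemma nn_integral_translate_lborel:
  fixes F :: "'a::euclidean_space \<Rightarrow> ennreal"
  assumes "F \<in> borel_measurable borel"
  shows "(\<integral>\<^sup>+ x. F (x + z) \<partial>lborel) = (\<integral>\<^sup>+ x. F x \<partial>lborel)"
proof -
  have "(\<integral>\<^sup>+ x. F x \<partial>lborel) = (\<integral>\<^sup>+ x. F x \<partial>distr lborel borel ((+) z))"
    by (simp add: lborel_distr_plus)
  also have "\<dots> = (\<integral>\<^sup>+ x. F (z + x) \<partial>lborel)" by (rule nn_integral_distr) (use assms in auto)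
  finally show ?thesis by (simp add: add.commute)
qed

lemma floor_div_iff:
  assumes "0 < h"
  shows "0 \<le> s \<and> nat \<lfloor>s / h\<rfloor> = j \<longleftrightarrow> s \<in> {real j * h ..< (real j + 1) * h}"
proof -
  have "0 \<le> s \<longleftrightarrow> 0 \<le> s / h" using assms by (simp add: zero_le_divide_iff)
  moreover have "0 \<le> s / h \<and> nat \<lfloor>s / h\<rfloor> = j \<longleftrightarrow> \<lfloor>s / h\<rfloor> = int j"
    by (metis int_nat_eq nat_int of_nat_0_le_iff zero_le_floor)
  moreover have "\<lfloor>s / h\<rfloor> = int j \<longleftrightarrow> real j \<le> s / h \<and> s / h < real j + 1" by (simp add: floor_eq_iff)
  ultimately show ?thesis using assms by (simp add: pos_le_divide_eq pos_divide_less_eq)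
qed

definition half_cell :: "real \<Rightarrow> nat \<Rightarrow> nat \<Rightarrow> (real \<times> real) set" where
  "half_cell h j k = {real j * h ..< (real j + 1) * h} \<times> {real k * h ..< (real k + 1) * h}"

lemma half_cell_iff:
  assumes "0 < h"
  shows "x \<in> half_cell h j k \<longleftrightarrow> 0 \<le> fst x \<and> 0 \<le> snd x \<and> nat \<lfloor>fst x / h\<rfloor> = j \<and> nat \<lfloor>snd x / h\<rfloor> = k"
  using floor_div_iff[OF assms, of "fst x" j] floor_div_iff[OF assms, of "snd x" k]
  by (cases x) (auto simp: half_cell_def)

lemma half_cell_borel [measurable]: "half_cell h j k \<in> sets borel"
  unfolding half_cell_def borel_prod[symmetric] by auto

lemma emeasure_lborel_Times:
  fixes A B :: "real set"
  assumes "A \<in> sets borel" "B \<in> sets borel"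
  shows "emeasure lborel (A \<times> B) = emeasure lborel A * emeasure lborel B"
proof -
  have "emeasure (lborel \<Otimes>\<^sub>M lborel) (A \<times> B) = emeasure lborel A * emeasure lborel B"
    by (rule lborel.emeasure_pair_measure_Times) (use assms in auto)
  then show ?thesis by (simp add: lborel_prod)
qed

lemma emeasure_half_cell: "0 < h \<Longrightarrow> emeasure lborel (half_cell h j k) = ennreal (h\<^sup>2)"
  unfolding half_cell_def
  by (subst emeasure_lborel_Times) (auto simp: algebra_simps ennreal_mult[symmetric] power2_eq_square)

text \<open>The grid function is truncated to boxes and recovered by monotone convergence, so
  uniform bounds on finite boxes give an integral over the plane.\<close>

lemma nn_integral_step_fun_le:
  assumes h: "0 < h" and g: "\<And>j k. 0 \<le> g j k" and C: "\<And>J. h\<^sup>2 * box_sum J g \<le> C"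
  shows "(\<integral>\<^sup>+ x. ennreal (step_fun h g x) \<partial>lborel) \<le> ennreal C"
proof -
  define gJ where "gJ J j k = (if j < J \<and> k < J then g j k else 0)" for J j k :: nat
  have ind: "indicator (half_cell h j k) x = (if 0 \<le> fst x \<and> 0 \<le> snd x \<and> nat \<lfloor>fst x / h\<rfloor> = j \<and> nat \<lfloor>snd x / h\<rfloor> = k then 1 else (0::ennreal))"
    for j k x
    by (simp add: indicator_def half_cell_iff[OF h])
  have stepJ: "ennreal (step_fun h (gJ J) x) = (\<Sum>j<J. \<Sum>k<J. ennreal (g j k) * indicator (half_cell h j k) x)" for J x
  proof (cases "0 \<le> fst x \<and> 0 \<le> snd x")
    case True
    have "(\<Sum>k<J. ennreal (g j k) * indicator (half_cell h j k) x)
      = (if j = nat \<lfloor>fst x / h\<rfloor> then if nat \<lfloor>snd x / h\<rfloor> < J then ennreal (g j (nat \<lfloor>snd x / h\<rfloor>)) else 0 else 0)" for j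
      unfolding ind using True by (auto simp: if_distrib[of "\<lambda>z. _ * z"] cong: if_cong)
    then show ?thesis using True by (simp add: step_fun_def gJ_def)
  qed (auto simp: ind step_fun_def)
  have intJ: "(\<integral>\<^sup>+ x. ennreal (step_fun h (gJ J) x) \<partial>lborel) \<le> ennreal C" for J
  proof -
    have "(\<integral>\<^sup>+ x. ennreal (step_fun h (gJ J) x) \<partial>lborel)
      = (\<Sum>j<J. \<Sum>k<J. \<integral>\<^sup>+ x. ennreal (g j k) * indicator (half_cell h j k) x \<partial>lborel)"
      unfolding stepJ by (subst nn_integral_sum, measurable)+
    also have "\<dots> = (\<Sum>j<J. \<Sum>k<J. ennreal (g j k) * ennreal (h\<^sup>2))"
      by (intro sum.cong refl) (subst nn_integral_cmult_indicator, auto simp: emeasure_half_cell[OF h])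
    also have "\<dots> = ennreal (\<Sum>j<J. \<Sum>k<J. g j k * h\<^sup>2)"
      using g by (simp add: ennreal_mult sum_nonneg flip: sum_ennreal)
    also have "\<dots> \<le> ennreal C"
      using C[of J] unfolding box_sum_cmult[symmetric] by (intro ennreal_leI) (simp add: box_sum_def mult.commute)
    finally show ?thesis .
  qed
  have SUP: "ennreal (step_fun h g x) = (SUP J. ennreal (step_fun h (gJ J) x))" for x
  proof (rule antisym)
    let ?J = "Suc (max (nat \<lfloor>fst x / h\<rfloor>) (nat \<lfloor>snd x / h\<rfloor>))"
    have "step_fun h g x = step_fun h (gJ ?J) x" by (auto simp: step_fun_def gJ_def less_Suc_eq_le)
    then show "ennreal (step_fun h g x) \<le> (SUP J. ennreal (step_fun h (gJ J) x))"
      by (auto intro: SUP_upper2[of ?J])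
    show "(SUP J. ennreal (step_fun h (gJ J) x)) \<le> ennreal (step_fun h g x)"
      by (intro SUP_least ennreal_leI) (auto simp: step_fun_def gJ_def g)
  qed
  have "(\<integral>\<^sup>+ x. ennreal (step_fun h g x) \<partial>lborel) = (SUP J. \<integral>\<^sup>+ x. ennreal (step_fun h (gJ J) x) \<partial>lborel)"
    unfolding SUP
  proof (rule nn_integral_monotone_convergence_SUP)
    show "incseq (\<lambda>J x. ennreal (step_fun h (gJ J) x))"
      by (auto simp: incseq_def le_fun_def step_fun_def gJ_def g intro!: ennreal_leI)
  qed measurable
  also have "\<dots> \<le> ennreal C" by (intro SUP_least intJ)
  finally show ?thesis .
qed

text \<open>The error \<^term>\<open>h\<close> beside \<^term>\<open>\<bar>z\<bar>\<close> comes from counting whole cells; it is harmless as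
  the mesh is refined.\<close>

locale bv_step =
  fixes h C :: real and g :: "nat \<Rightarrow> nat \<Rightarrow> real"
  assumes h: "0 < h" and C: "0 \<le> C"
    and var_x: "\<And>J. h * box_sum J (\<lambda>j k. \<bar>g (Suc j) k - g j k\<bar>) \<le> C"
    and trace_x: "\<And>J. h * (\<Sum>k<J. \<bar>g 0 k\<bar>) \<le> C"
    and var_y: "\<And>J. h * box_sum J (\<lambda>j k. \<bar>g j (Suc k) - g j k\<bar>) \<le> C"
    and trace_y: "\<And>J. h * (\<Sum>j<J. \<bar>g j 0\<bar>) \<le> C"
begin

lemma shift_jump: "\<bar>g (j + l) k - g j k\<bar> \<le> (\<Sum>i<l. \<bar>g (Suc (j + i)) k - g (j + i) k\<bar>)"
  by (induction l) auto

text \<open>Every column is reached from the first one through jumps in x: one \<open>C\<close> for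
  the trace, one for the variation. The box of size \<open>j + J\<close> contains both index
  ranges.\<close>

lemma column_l1: "h * (\<Sum>k<J. \<bar>g j k\<bar>) \<le> 2 * C"
proof -
  have "\<bar>g j k\<bar> \<le> \<bar>g 0 k\<bar> + (\<Sum>i<j + J. \<bar>g (Suc i) k - g i k\<bar>)" for k
  proof -
    have "(\<Sum>i<j. \<bar>g (Suc i) k - g i k\<bar>) \<le> (\<Sum>i<j + J. \<bar>g (Suc i) k - g i k\<bar>)"
      by (rule sum_mono2) auto
    then show ?thesis using shift_jump[of 0 j k] by simp
  qed
  then have "(\<Sum>k<J. \<bar>g j k\<bar>) \<le> (\<Sum>k<J. \<bar>g 0 k\<bar>) + (\<Sum>k<J. \<Sum>i<j + J. \<bar>g (Suc i) k - g i k\<bar>)"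
    unfolding sum.distrib[symmetric] by (intro sum_mono)
  also have "(\<Sum>k<J. \<Sum>i<j + J. \<bar>g (Suc i) k - g i k\<bar>) \<le> box_sum (j + J) (\<lambda>i k. \<bar>g (Suc i) k - g i k\<bar>)"
    unfolding box_sum_def by (subst sum.swap) (intro sum_mono sum_mono2, auto)
  finally have "h * (\<Sum>k<J. \<bar>g j k\<bar>) \<le> h * ((\<Sum>k<J. \<bar>g 0 k\<bar>) + box_sum (j + J) (\<lambda>i k. \<bar>g (Suc i) k - g i k\<bar>))"
    using h by (intro mult_left_mono) auto
  then show ?thesis using trace_x[of J] var_x[of "j + J"] by (simp add: distrib_left)
qed

text \<open>A shift by \<open>z\<close> moves the index by at most \<open>m\<close> cells. Points
  that stay in the quadrant see at most \<open>m\<close> jumps, contributing \<open>C\<close> per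
  cell width. Points that enter across the western edge, where the function is extended by zero, see
  whole columns, \<open>2 * C\<close> each. With \<open>real m * h \<le> z + h\<close> this gives
  the constant 3.\<close>

lemma translation_x_pos:
  assumes z: "0 \<le> z"
  shows "(\<integral>\<^sup>+ x. ennreal \<bar>step_fun h g (x + (z, 0)) - step_fun h g x\<bar> \<partial>lborel) \<le> ennreal (3 * C * (z + h))"
proof -
  define m where "m = nat \<lceil>z / h\<rceil>"
  have zm: "z / h \<le> real m" "real m \<le> z / h + 1"
    using z h by (auto simp: m_def)
  have mh: "real m * h \<le> z + h"
    using mult_right_mono[OF zm(2), of h] h by (simp add: distrib_right)
  define G where "G j k = (\<Sum>l<m. \<bar>g (Suc (j + l)) k - g (j + l) k\<bar>)" for j k
  define B where "B j k = (if j < m then \<bar>g j k\<bar> else 0)" for j k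
  have idx: "nat \<lfloor>s / h\<rfloor> \<le> nat \<lfloor>(s + z) / h\<rfloor>" "nat \<lfloor>(s + z) / h\<rfloor> \<le> nat \<lfloor>s / h\<rfloor> + m" if "0 \<le> s" for s
  proof -
    have d: "(s + z) / h = s / h + z / h" "0 \<le> z / h" "0 \<le> s / h"
      using z h that by (auto simp: add_divide_distrib)
    then show "nat \<lfloor>s / h\<rfloor> \<le> nat \<lfloor>(s + z) / h\<rfloor>" by (intro nat_mono floor_mono) simp
    have "(s + z) / h \<le> s / h + real_of_int (int m)" using d zm(1) by simp
    then have "\<lfloor>(s + z) / h\<rfloor> \<le> \<lfloor>s / h\<rfloor> + int m" using floor_mono floor_add_int by metis
    then show "nat \<lfloor>(s + z) / h\<rfloor> \<le> nat \<lfloor>s / h\<rfloor> + m" using d by linarith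
  qed
  have pt: "\<bar>step_fun h g (x + (z, 0)) - step_fun h g x\<bar> \<le> step_fun h G x + step_fun h B (x + (z, 0))" for x
  proof -
    obtain s t where x: "x = (s, t)" by (cases x)
    consider "t < 0 \<or> s + z < 0" | "0 \<le> t" "s < 0" "0 \<le> s + z" | "0 \<le> t" "0 \<le> s" by linarith
    then show ?thesis
    proof cases
      case 1
      then show ?thesis using z by (auto simp: x step_fun_def)
    next
      case 2
      have "(s + z) / h < z / h" using 2 h by (simp add: divide_strict_right_mono)
      then have "(s + z) / h < real m" using zm(1) by linarith
      then have "nat \<lfloor>(s + z) / h\<rfloor> < m" using 2 h by (simp add: floor_less_iff nat_less_iff)
      then show ?thesis using 2 by (simp add: x step_fun_def B_def)
    next
      case 3
      define j k l where "j = nat \<lfloor>s / h\<rfloor>" and "k = nat \<lfloor>t / h\<rfloor>" and "l = nat \<lfloor>(s + z) / h\<rfloor> - nat \<lfloor>s / h\<rfloor>"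
      have l: "l \<le> m" "nat \<lfloor>(s + z) / h\<rfloor> = j + l" using idx[OF 3(2)] by (auto simp: l_def j_def)
      have "\<bar>g (j + l) k - g j k\<bar> \<le> G j k"
        unfolding G_def by (rule order_trans[OF shift_jump sum_mono2]) (use l in auto)
      moreover have "0 \<le> step_fun h B (x + (z, 0))" by (simp add: step_fun_def B_def)
      ultimately show ?thesis using 3 z l by (simp add: x step_fun_def j_def[symmetric] k_def[symmetric])
    qed
  qed
  have Gp: "0 \<le> G j k" and Bp: "0 \<le> B j k" for j k by (auto simp: G_def B_def sum_nonneg)
  have "h\<^sup>2 * box_sum J G \<le> real m * h * C" for J
  proof -
    \<comment> \<open>Exchanging the sums leaves \<open>m\<close> shifted copies of the variation in
      x, each contained in a larger box.\<close>
    have "box_sum J G = (\<Sum>l<m. box_sum J (\<lambda>j k. \<bar>g (Suc (j + l)) k - g (j + l) k\<bar>))"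
      unfolding box_sum_def G_def by (subst sum.swap[of _ "{..<m}"], subst sum.swap[of _ "{..<m}"]) (rule refl)
    also have "\<dots> \<le> (\<Sum>l<m. C / h)"
    proof (rule sum_mono)
      fix l
      have "box_sum J (\<lambda>j k. \<bar>g (Suc (j + l)) k - g (j + l) k\<bar>) \<le> box_sum (l + J) (\<lambda>j k. \<bar>g (Suc j) k - g j k\<bar>)"
      proof (induction l)
        case (Suc l)
        have "box_sum J (\<lambda>j k. \<bar>g (Suc (j + Suc l)) k - g (j + Suc l) k\<bar>)
          \<le> box_sum (J + Suc l) (\<lambda>j k. \<bar>g (Suc j) k - g j k\<bar>)"
        proof -
          have "(\<Sum>j<J. \<Sum>k<J. \<bar>g (Suc (j + Suc l)) k - g (j + Suc l) k\<bar>)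
            = (\<Sum>j=Suc l..<J + Suc l. \<Sum>k<J. \<bar>g (Suc j) k - g j k\<bar>)"
            using sum.shift_bounds_nat_ivl[of "\<lambda>j. \<Sum>k<J. \<bar>g (Suc j) k - g j k\<bar>" 0 "Suc l" J]
            by (simp add: atLeast0LessThan)
          also have "\<dots> \<le> (\<Sum>j<J + Suc l. \<Sum>k<J. \<bar>g (Suc j) k - g j k\<bar>)"
            by (rule sum_mono2) (auto intro: sum_nonneg)
          also have "\<dots> \<le> (\<Sum>j<J + Suc l. \<Sum>k<J + Suc l. \<bar>g (Suc j) k - g j k\<bar>)"
            by (intro sum_mono sum_mono2) auto
          finally show ?thesis by (simp add: box_sum_def)
        qed
        then show ?case by (simp add: add.commute)
      qed simp
      also have "\<dots> \<le> C / h" using var_x[of "l + J"] h by (simp add: pos_le_divide_eq mult.commute)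
      finally show "box_sum J (\<lambda>j k. \<bar>g (Suc (j + l)) k - g (j + l) k\<bar>) \<le> C / h" .
    qed
    finally have "h\<^sup>2 * box_sum J G \<le> h\<^sup>2 * (\<Sum>l<m. C / h)" by (intro mult_left_mono) auto
    then show ?thesis using h by (simp add: power2_eq_square algebra_simps)
  qed
  then have GI: "(\<integral>\<^sup>+ x. ennreal (step_fun h G x) \<partial>lborel) \<le> ennreal (real m * h * C)"
    by (intro nn_integral_step_fun_le h Gp)
  have "h\<^sup>2 * box_sum J B \<le> real m * h * (2 * C)" for J
  proof -
    have "box_sum J B = (\<Sum>j\<in>{..<J} \<inter> {..<m}. \<Sum>k<J. \<bar>g j k\<bar>)"
    proof -
      have "box_sum J B = (\<Sum>j<J. if j \<in> {..<m} then \<Sum>k<J. \<bar>g j k\<bar> else 0)"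
        unfolding box_sum_def by (intro sum.cong refl) (auto simp: B_def)
      then show ?thesis by (simp add: sum.inter_restrict)
    qed
    also have "\<dots> \<le> (\<Sum>j<m. \<Sum>k<J. \<bar>g j k\<bar>)" by (rule sum_mono2) (auto intro: sum_nonneg)
    also have "\<dots> \<le> (\<Sum>j<m. 2 * C / h)"
      using column_l1[where J = J] h by (intro sum_mono) (simp add: pos_le_divide_eq mult.commute)
    finally have "h\<^sup>2 * box_sum J B \<le> h\<^sup>2 * (\<Sum>j<m. 2 * C / h)" by (intro mult_left_mono) auto
    then show ?thesis using h by (simp add: power2_eq_square algebra_simps)
  qed
  then have "(\<integral>\<^sup>+ x. ennreal (step_fun h B x) \<partial>lborel) \<le> ennreal (real m * h * (2 * C))"
    by (intro nn_integral_step_fun_le h Bp)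
  then have BI: "(\<integral>\<^sup>+ x. ennreal (step_fun h B (x + (z, 0))) \<partial>lborel) \<le> ennreal (real m * h * (2 * C))"
    by (subst nn_integral_translate_lborel[of "\<lambda>x. ennreal (step_fun h B x)"]) auto
  have sp: "0 \<le> step_fun h G x" "0 \<le> step_fun h B x" for x by (auto simp: step_fun_def Gp Bp)
  have "(\<integral>\<^sup>+ x. ennreal \<bar>step_fun h g (x + (z, 0)) - step_fun h g x\<bar> \<partial>lborel)
    \<le> (\<integral>\<^sup>+ x. ennreal (step_fun h G x) + ennreal (step_fun h B (x + (z, 0))) \<partial>lborel)"
    using pt by (intro nn_integral_mono) (simp add: ennreal_leI sp flip: ennreal_plus)
  also have "\<dots> = (\<integral>\<^sup>+ x. ennreal (step_fun h G x) \<partial>lborel) + (\<integral>\<^sup>+ x. ennreal (step_fun h B (x + (z, 0))) \<partial>lborel)"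
    by (rule nn_integral_add) measurable
  also have "\<dots> \<le> ennreal (real m * h * C) + ennreal (real m * h * (2 * C))" by (intro add_mono GI BI)
  also have "\<dots> = ennreal (3 * C * (real m * h))"
    using h C by (simp add: ennreal_plus[symmetric] del: ennreal_plus)
  also have "\<dots> \<le> ennreal (3 * C * (z + h))" using mh C by (intro ennreal_leI mult_left_mono) auto
  finally show ?thesis .
qed

lemma translation_x:
  "(\<integral>\<^sup>+ x. ennreal \<bar>step_fun h g (x + (z, 0)) - step_fun h g x\<bar> \<partial>lborel) \<le> ennreal (3 * C * (\<bar>z\<bar> + h))"
proof (cases "0 \<le> z")
  case True
  then show ?thesis using translation_x_pos[of z] by simp
next
  case False
  have "(\<integral>\<^sup>+ x. ennreal \<bar>step_fun h g (x + (z, 0)) - step_fun h g x\<bar> \<partial>lborel)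
    = (\<integral>\<^sup>+ x. ennreal \<bar>step_fun h g (x + (- z, 0) + (z, 0)) - step_fun h g (x + (- z, 0))\<bar> \<partial>lborel)"
    by (rule nn_integral_translate_lborel[of "\<lambda>x. ennreal \<bar>step_fun h g (x + (z, 0)) - step_fun h g x\<bar>", symmetric])
       measurable
  also have "\<dots> = (\<integral>\<^sup>+ x. ennreal \<bar>step_fun h g (x + (- z, 0)) - step_fun h g x\<bar> \<partial>lborel)"
    by (intro nn_integral_cong) (simp add: add.assoc abs_minus_commute flip: zero_prod_def)
  also have "\<dots> \<le> ennreal (3 * C * (\<bar>z\<bar> + h))" using translation_x_pos[of "- z"] False by simp
  finally show ?thesis .
qed

lemma swapped: "bv_step h C (\<lambda>j k. g k j)"
proof
  show "h * box_sum J (\<lambda>j k. \<bar>g k (Suc j) - g k j\<bar>) \<le> C" for J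
    using var_y[of J] box_sum_swap[of J "\<lambda>j k. \<bar>g j (Suc k) - g j k\<bar>"] by simp
  show "h * box_sum J (\<lambda>j k. \<bar>g (Suc k) j - g k j\<bar>) \<le> C" for J
    using var_x[of J] box_sum_swap[of J "\<lambda>j k. \<bar>g (Suc j) k - g j k\<bar>"] by simp
qed (use h C trace_x trace_y in auto)

end

context bv_step
begin

lemma translation_y:
  "(\<integral>\<^sup>+ x. ennreal \<bar>step_fun h g (x + (0, z)) - step_fun h g x\<bar> \<partial>lborel) \<le> ennreal (3 * C * (\<bar>z\<bar> + h))"
proof -
  interpret sw: bv_step h C "\<lambda>j k. g k j" by (rule swapped)
  have "(\<integral>\<^sup>+ x. ennreal \<bar>step_fun h g (x + (0, z)) - step_fun h g x\<bar> \<partial>lborel)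
    = (\<integral>\<^sup>+ x. ennreal \<bar>step_fun h g (prod.swap x + (0, z)) - step_fun h g (prod.swap x)\<bar> \<partial>lborel)"
    by (rule nn_integral_swap_lborel[of "\<lambda>x. ennreal \<bar>step_fun h g (x + (0, z)) - step_fun h g x\<bar>", symmetric])
       measurable
  also have "\<dots> = (\<integral>\<^sup>+ x. ennreal \<bar>step_fun h (\<lambda>j k. g k j) (x + (z, 0)) - step_fun h (\<lambda>j k. g k j) x\<bar> \<partial>lborel)"
  proof (intro nn_integral_cong)
    fix x :: "real \<times> real"
    have "prod.swap x + (0, z) = prod.swap (x + (z, 0))" by (cases x) simp
    then show "ennreal \<bar>step_fun h g (prod.swap x + (0, z)) - step_fun h g (prod.swap x)\<bar>
      = ennreal \<bar>step_fun h (\<lambda>j k. g k j) (x + (z, 0)) - step_fun h (\<lambda>j k. g k j) x\<bar>"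
      by (simp only: step_fun_swap)
  qed
  also have "\<dots> \<le> ennreal (3 * C * (\<bar>z\<bar> + h))" by (rule sw.translation_x)
  finally show ?thesis .
qed

lemma translation:
  "(\<integral>\<^sup>+ x. ennreal \<bar>step_fun h g (x + z) - step_fun h g x\<bar> \<partial>lborel)
    \<le> ennreal (3 * C * (\<bar>fst z\<bar> + \<bar>snd z\<bar> + 2 * h))"
proof -
  let ?v = "step_fun h g"
  have z: "z = (0, snd z) + (fst z, 0)" by (cases z) simp
  have "(\<integral>\<^sup>+ x. ennreal \<bar>?v (x + z) - ?v x\<bar> \<partial>lborel)
    \<le> (\<integral>\<^sup>+ x. ennreal \<bar>?v ((x + (0, snd z)) + (fst z, 0)) - ?v (x + (0, snd z))\<bar> + ennreal \<bar>?v (x + (0, snd z)) - ?v x\<bar> \<partial>lborel)"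
    by (subst z) (intro nn_integral_mono, simp add: add.assoc ennreal_leI flip: ennreal_plus)
  also have "\<dots> = (\<integral>\<^sup>+ x. ennreal \<bar>?v ((x + (0, snd z)) + (fst z, 0)) - ?v (x + (0, snd z))\<bar> \<partial>lborel)
     + (\<integral>\<^sup>+ x. ennreal \<bar>?v (x + (0, snd z)) - ?v x\<bar> \<partial>lborel)"
    by (rule nn_integral_add) measurable
  also have "(\<integral>\<^sup>+ x. ennreal \<bar>?v ((x + (0, snd z)) + (fst z, 0)) - ?v (x + (0, snd z))\<bar> \<partial>lborel)
    = (\<integral>\<^sup>+ x. ennreal \<bar>?v (x + (fst z, 0)) - ?v x\<bar> \<partial>lborel)"
    by (rule nn_integral_translate_lborel[of "\<lambda>x. ennreal \<bar>?v (x + (fst z, 0)) - ?v x\<bar>"]) measurable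
  also have "\<dots> + (\<integral>\<^sup>+ x. ennreal \<bar>?v (x + (0, snd z)) - ?v x\<bar> \<partial>lborel)
    \<le> ennreal (3 * C * (\<bar>fst z\<bar> + h)) + ennreal (3 * C * (\<bar>snd z\<bar> + h))"
    by (intro add_mono translation_x translation_y)
  also have "\<dots> = ennreal (3 * C * (\<bar>fst z\<bar> + \<bar>snd z\<bar> + 2 * h))"
    using h C by (simp add: ennreal_plus[symmetric] del: ennreal_plus) (simp add: algebra_simps)
  finally show ?thesis .
qed

end

section \<open>Approximation by averages over coarse cells\<close>

abbreviation L1_dist :: "(real \<times> real \<Rightarrow> real) \<Rightarrow> (real \<times> real \<Rightarrow> real) \<Rightarrow> ennreal" where
  "L1_dist a b \<equiv> \<integral>\<^sup>+ x. ennreal \<bar>a x - b x\<bar> \<partial>lborel"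

definition coarse_avg :: "real \<Rightarrow> (real \<times> real \<Rightarrow> real) \<Rightarrow> nat \<Rightarrow> nat \<Rightarrow> real" where
  "coarse_avg \<delta> v j k = (LINT y|lborel. indicator (half_cell \<delta> j k) y * v y) / \<delta>\<^sup>2"

lemma integrable_half_cell:
  assumes "0 < \<delta>" "v \<in> borel_measurable borel" "\<And>x. \<bar>v x\<bar> \<le> (U::real)"
  shows "integrable lborel (\<lambda>y. indicator (half_cell \<delta> j k) y * v y)"
proof (rule Bochner_Integration.integrable_bound)
  show "integrable lborel (\<lambda>y. U * indicator (half_cell \<delta> j k) y)"
    by (intro integrable_mult_right integrable_real_indicator) (use assms(1) in \<open>auto simp: emeasure_half_cell\<close>)
  show "(\<lambda>y. indicator (half_cell \<delta> j k) y * v y) \<in> borel_measurable lborel"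
    using assms(2) by measurable
  show "AE y in lborel. norm (indicator (half_cell \<delta> j k) y * v y) \<le> norm (U * indicator (half_cell \<delta> j k) y)"
    using assms(3) order_trans[OF assms(3) abs_ge_self] by (intro AE_I2) (auto simp: indicator_def)
qed

lemma coarse_avg_bound:
  assumes d: "0 < \<delta>" and v: "v \<in> borel_measurable borel" and U: "\<And>x. \<bar>v x\<bar> \<le> (U::real)"
  shows "\<bar>coarse_avg \<delta> v j k\<bar> \<le> U"
proof -
  have m: "measure lborel (half_cell \<delta> j k) = \<delta>\<^sup>2"
    using d by (simp add: measure_def emeasure_half_cell)
  have "\<bar>LINT y|lborel. indicator (half_cell \<delta> j k) y * v y\<bar>
    \<le> (LINT y|lborel. \<bar>indicator (half_cell \<delta> j k) y * v y\<bar>)" by (rule integral_abs_bound)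
  also have "\<dots> \<le> (LINT y|lborel. U * indicator (half_cell \<delta> j k) y)"
  proof (rule integral_mono)
    show "integrable lborel (\<lambda>y. \<bar>indicator (half_cell \<delta> j k) y * v y\<bar>)"
      by (intro integrable_abs integrable_half_cell[OF d v U])
    show "integrable lborel (\<lambda>y. U * indicator (half_cell \<delta> j k) y)"
      by (intro integrable_mult_right integrable_real_indicator) (use d in \<open>auto simp: emeasure_half_cell\<close>)
  qed (use U in \<open>auto simp: indicator_def\<close>)
  also have "\<dots> = U * \<delta>\<^sup>2" by (simp add: m)
  finally show ?thesis using d by (simp add: coarse_avg_def pos_divide_le_eq)
qed

text \<open>The distance of \<open>v x\<close> to the average over its coarse cell is at most the
  average of \<open>\<bar>v (x + z) - v x\<bar>\<close> over displacements \<open>z\<close> within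
  the cell. Enlarging these to the square \<open>?B\<close> makes their range independent of
  \<open>x\<close>, so that the integrals can be exchanged; the square has four times the area of a
  cell, whence the factor 4.\<close>

lemma coarse_avg_deviation:
  assumes d: "0 < \<delta>" and v[measurable]: "v \<in> borel_measurable borel" and U: "\<And>x. \<bar>v x\<bar> \<le> (U::real)"
    and v0: "\<And>x. \<not> (0 \<le> fst x \<and> 0 \<le> snd x) \<Longrightarrow> v x = 0"
    and trans: "\<And>z. z \<in> {-\<delta>..\<delta>} \<times> {-\<delta>..\<delta>} \<Longrightarrow> (\<integral>\<^sup>+ x. ennreal \<bar>v (x + z) - v x\<bar> \<partial>lborel) \<le> ennreal K"
    and K: "0 \<le> K"
  shows "L1_dist v (step_fun \<delta> (coarse_avg \<delta> v)) \<le> ennreal (4 * K)"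
proof -
  let ?B = "{-\<delta>..\<delta>} \<times> {-\<delta>..\<delta>} :: (real \<times> real) set"
  have B[measurable]: "?B \<in> sets borel" unfolding borel_prod[symmetric] by auto
  have eB: "emeasure lborel ?B = ennreal (4 * \<delta>\<^sup>2)"
    using d by (subst emeasure_lborel_Times) (auto simp: ennreal_mult[symmetric] power2_eq_square)
  have pt: "ennreal \<bar>v x - step_fun \<delta> (coarse_avg \<delta> v) x\<bar>
    \<le> ennreal (1 / \<delta>\<^sup>2) * (\<integral>\<^sup>+ z. indicator ?B z * ennreal \<bar>v (x + z) - v x\<bar> \<partial>lborel)" for x
  proof (cases "0 \<le> fst x \<and> 0 \<le> snd x")
    case True
    define j k where "j = nat \<lfloor>fst x / \<delta>\<rfloor>" and "k = nat \<lfloor>snd x / \<delta>\<rfloor>"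
    let ?Q = "half_cell \<delta> j k"
    have xQ: "x \<in> ?Q" using True by (simp add: half_cell_iff[OF d] j_def k_def)
    have I1: "integrable lborel (\<lambda>y. indicator ?Q y * v x)"
      by (rule integrable_half_cell[OF d, of _ "\<bar>v x\<bar>"]) auto
    have I2: "integrable lborel (\<lambda>y. indicator ?Q y * v y)" by (rule integrable_half_cell[OF d v U])
    have m: "measure lborel ?Q = \<delta>\<^sup>2" using d by (simp add: measure_def emeasure_half_cell)
    have "(LINT y|lborel. indicator ?Q y * (v x - v y)) = \<delta>\<^sup>2 * v x - (LINT y|lborel. indicator ?Q y * v y)"
      unfolding right_diff_distrib using I1 I2 by (simp add: m)
    then have "v x - coarse_avg \<delta> v j k = (1 / \<delta>\<^sup>2) * (LINT y|lborel. indicator ?Q y * (v x - v y))"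
      using d by (simp add: coarse_avg_def field_simps)
    then have "ennreal \<bar>v x - coarse_avg \<delta> v j k\<bar>
      = ennreal (1 / \<delta>\<^sup>2) * ennreal (norm (LINT y|lborel. indicator ?Q y * (v x - v y)))"
      using d by (simp add: abs_mult ennreal_mult[symmetric] del: times_divide_eq_left)
    also have "\<dots> \<le> ennreal (1 / \<delta>\<^sup>2) * (\<integral>\<^sup>+ y. ennreal (norm (indicator ?Q y * (v x - v y))) \<partial>lborel)"
      using I1 I2 by (intro mult_left_mono integral_norm_bound_ennreal) (auto simp: right_diff_distrib)
    also have "(\<integral>\<^sup>+ y. ennreal (norm (indicator ?Q y * (v x - v y))) \<partial>lborel)
      = (\<integral>\<^sup>+ z. ennreal (norm (indicator ?Q (z + x) * (v x - v (z + x)))) \<partial>lborel)"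
      by (rule nn_integral_translate_lborel[of "\<lambda>y. ennreal (norm (indicator ?Q y * (v x - v y)))", symmetric])
         measurable
    also have "\<dots> \<le> (\<integral>\<^sup>+ z. indicator ?B z * ennreal \<bar>v (x + z) - v x\<bar> \<partial>lborel)"
    proof (rule nn_integral_mono)
      fix z :: "real \<times> real"
      have "z \<in> ?B" if zQ: "z + x \<in> ?Q"
      proof -
        have s: "- \<delta> \<le> a \<and> a \<le> \<delta>" if "a + b \<in> {real n * \<delta>..<(real n + 1) * \<delta>}" "b \<in> {real n * \<delta>..<(real n + 1) * \<delta>}" for a b n
          using that by (auto simp: distrib_right)
        show ?thesis using zQ xQ s[of "fst z" "fst x" j] s[of "snd z" "snd x" k]
          by (cases z, cases x) (auto simp: half_cell_def)
      qed
      then show "ennreal (norm (indicator ?Q (z + x) * (v x - v (z + x)))) \<le> indicator ?B z * ennreal \<bar>v (x + z) - v x\<bar>"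
        by (auto simp: indicator_def add.commute abs_minus_commute)
    qed
    finally show ?thesis
      using True by (simp add: step_fun_def j_def k_def mult_left_mono)
  qed (auto simp: step_fun_def v0)
  have [measurable]: "(\<lambda>p :: (real \<times> real) \<times> (real \<times> real). v (fst p + snd p)) \<in> borel_measurable (borel \<Otimes>\<^sub>M borel)"
    by measurable
  have "L1_dist v (step_fun \<delta> (coarse_avg \<delta> v))
    \<le> (\<integral>\<^sup>+ x. ennreal (1 / \<delta>\<^sup>2) * (\<integral>\<^sup>+ z. indicator ?B z * ennreal \<bar>v (x + z) - v x\<bar> \<partial>lborel) \<partial>lborel)"
    by (intro nn_integral_mono pt)
  also have "\<dots> = ennreal (1 / \<delta>\<^sup>2) * (\<integral>\<^sup>+ x. (\<integral>\<^sup>+ z. indicator ?B z * ennreal \<bar>v (x + z) - v x\<bar> \<partial>lborel) \<partial>lborel)"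
    by (rule nn_integral_cmult) measurable
  also have "(\<integral>\<^sup>+ x. (\<integral>\<^sup>+ z. indicator ?B z * ennreal \<bar>v (x + z) - v x\<bar> \<partial>lborel) \<partial>lborel)
    = (\<integral>\<^sup>+ z. (\<integral>\<^sup>+ x. indicator ?B z * ennreal \<bar>v (x + z) - v x\<bar> \<partial>lborel) \<partial>lborel)"
    by (rule lborel_pair.Fubini'[symmetric]) measurable
  also have "\<dots> \<le> (\<integral>\<^sup>+ z. ennreal K * indicator ?B z \<partial>lborel)"
  proof (rule nn_integral_mono)
    fix z :: "real \<times> real"
    have "(\<integral>\<^sup>+ x. indicator ?B z * ennreal \<bar>v (x + z) - v x\<bar> \<partial>lborel)
      = indicator ?B z * (\<integral>\<^sup>+ x. ennreal \<bar>v (x + z) - v x\<bar> \<partial>lborel)"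
      by (rule nn_integral_cmult) measurable
    then show "(\<integral>\<^sup>+ x. indicator ?B z * ennreal \<bar>v (x + z) - v x\<bar> \<partial>lborel) \<le> ennreal K * indicator ?B z"
      using trans[of z] by (auto simp: indicator_def)
  qed
  also have "\<dots> = ennreal K * ennreal (4 * \<delta>\<^sup>2)" by (simp add: nn_integral_cmult_indicator eB)
  also have "ennreal (1 / \<delta>\<^sup>2) * (ennreal K * ennreal (4 * \<delta>\<^sup>2)) = ennreal (4 * K)"
    using d K by (simp add: ennreal_mult[symmetric])
  finally show ?thesis by (simp add: mult_left_mono)
qed

text \<open>Shifts up to \<open>\<delta>\<close> along each axis cost
  \<open>6 * C * (\<delta> + h)\<close> by \<open>translation\<close>, and the averaging multiplies
  this by 4.\<close>

lemma bv_step_deviation: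
  assumes bv: "bv_step h C g" and d: "0 < \<delta>" and U: "\<And>j k. \<bar>g j k\<bar> \<le> U"
  shows "L1_dist (step_fun h g) (step_fun \<delta> (coarse_avg \<delta> (step_fun h g)))
    \<le> ennreal (24 * C * (\<delta> + h))"
proof -
  interpret bv_step h C g by (rule bv)
  have U0: "0 \<le> U" using U[of 0 0] by linarith
  have "L1_dist (step_fun h g) (step_fun \<delta> (coarse_avg \<delta> (step_fun h g)))
    \<le> ennreal (4 * (6 * C * (\<delta> + h)))"
  proof (rule coarse_avg_deviation[OF d])
    show "\<bar>step_fun h g x\<bar> \<le> U" for x using U U0 by (simp add: step_fun_def)
    fix z :: "real \<times> real" assume "z \<in> {-\<delta>..\<delta>} \<times> {-\<delta>..\<delta>}"
    then have "3 * C * (\<bar>fst z\<bar> + \<bar>snd z\<bar> + 2 * h) \<le> 3 * C * (\<delta> + \<delta> + 2 * h)"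
      using C by (intro mult_left_mono add_mono) auto
    also have "\<dots> = 6 * C * (\<delta> + h)" by (simp add: algebra_simps)
    finally show "(\<integral>\<^sup>+ x. ennreal \<bar>step_fun h g (x + z) - step_fun h g x\<bar> \<partial>lborel) \<le> ennreal (6 * C * (\<delta> + h))"
      using translation[of z] ennreal_leI order_trans by blast
  next
    show "step_fun h g \<in> borel_measurable borel" by measurable
  next
    show "0 \<le> 6 * C * (\<delta> + h)" using d h C by simp
  qed (auto simp: step_fun_def)
  then show ?thesis by (simp add: mult.assoc)
qed

text \<open>The quadrant splits into a square of side \<open>real M * \<delta>\<close>, where
  averages are compared, and a far region, where both functions are small. The discrepancy
  \<open>\<eta>\<close> is thus integrated only over a set of finite area.\<close>

lemma bv_step_close:
  assumes bv: "bv_step h C g" "bv_step h' C g'" and d: "0 < \<delta>"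
    and U: "\<And>j k. \<bar>g j k\<bar> \<le> U" "\<And>j k. \<bar>g' j k\<bar> \<le> U"
    and close: "\<And>j k. j < M \<Longrightarrow> k < M \<Longrightarrow> \<bar>coarse_avg \<delta> (step_fun h g) j k - coarse_avg \<delta> (step_fun h' g') j k\<bar> \<le> \<eta>"
    and tail: "(\<integral>\<^sup>+ x. indicator {x. real M * \<delta> \<le> fst x \<or> real M * \<delta> \<le> snd x} x * ennreal \<bar>step_fun h g x\<bar> \<partial>lborel) \<le> ennreal \<epsilon>"
      "(\<integral>\<^sup>+ x. indicator {x. real M * \<delta> \<le> fst x \<or> real M * \<delta> \<le> snd x} x * ennreal \<bar>step_fun h' g' x\<bar> \<partial>lborel) \<le> ennreal \<epsilon>"
    and pos: "0 \<le> \<eta>" "0 \<le> \<epsilon>"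
  shows "L1_dist (step_fun h g) (step_fun h' g')
    \<le> ennreal (24 * C * (\<delta> + h) + 24 * C * (\<delta> + h') + \<eta> * (real M * \<delta>)\<^sup>2 + \<epsilon> + \<epsilon>)"
proof -
  let ?v = "step_fun h g" and ?v' = "step_fun h' g'"
  let ?a = "step_fun \<delta> (coarse_avg \<delta> ?v)" and ?a' = "step_fun \<delta> (coarse_avg \<delta> ?v')"
  let ?E = "{x :: real \<times> real. real M * \<delta> \<le> fst x \<or> real M * \<delta> \<le> snd x}"
  let ?Q = "{0 ..< real M * \<delta>} \<times> {0 ..< real M * \<delta>}"
  have h: "0 < h" "0 < h'" "0 \<le> C" using bv by (auto simp: bv_step_def)
  have fs [measurable]: "fst \<in> borel_measurable (borel :: (real \<times> real) measure)"
    "snd \<in> borel_measurable (borel :: (real \<times> real) measure)"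
    unfolding borel_prod[symmetric] by measurable
  have E [measurable]: "?E \<in> sets borel" by measurable
  have Q [measurable]: "?Q \<in> sets borel" unfolding borel_prod[symmetric] by auto
  have eQ: "emeasure lborel ?Q = ennreal ((real M * \<delta>)\<^sup>2)"
    using d by (subst emeasure_lborel_Times) (auto simp: ennreal_mult[symmetric] power2_eq_square)
  have pt: "ennreal \<bar>?v x - ?v' x\<bar> \<le> ennreal \<bar>?v x - ?a x\<bar> + ennreal \<bar>?v' x - ?a' x\<bar> + ennreal \<eta> * indicator ?Q x
     + indicator ?E x * ennreal \<bar>?v x\<bar> + indicator ?E x * ennreal \<bar>?v' x\<bar>" for x
  proof -
    consider "\<not> (0 \<le> fst x \<and> 0 \<le> snd x)" | "0 \<le> fst x" "0 \<le> snd x" "x \<in> ?E" | "0 \<le> fst x" "0 \<le> snd x" "x \<notin> ?E" by blast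
    then show ?thesis
    proof cases
      case 1
      then have "?v x = 0" "?v' x = 0" by (auto simp: step_fun_def)
      then show ?thesis by simp
    next
      case 2
      have "ennreal \<bar>?v x - ?v' x\<bar> \<le> ennreal (\<bar>?v x\<bar> + \<bar>?v' x\<bar>)" by (intro ennreal_leI) linarith
      also have "\<dots> = indicator ?E x * ennreal \<bar>?v x\<bar> + indicator ?E x * ennreal \<bar>?v' x\<bar>"
        using 2(3) by (simp add: ennreal_plus)
      finally show ?thesis by (simp add: add.assoc add_increasing)
    next
      case 3
      have Qx: "x \<in> ?Q" using 3 by (cases x) auto
      have "nat \<lfloor>fst x / \<delta>\<rfloor> < M" "nat \<lfloor>snd x / \<delta>\<rfloor> < M"
        using 3 d by (auto simp: floor_less_iff nat_less_iff pos_divide_less_eq)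
      then have "\<bar>?a x - ?a' x\<bar> \<le> \<eta>" using close 3 by (simp add: step_fun_def)
      then have "\<bar>?v x - ?v' x\<bar> \<le> \<bar>?v x - ?a x\<bar> + \<bar>?v' x - ?a' x\<bar> + \<eta>" by linarith
      then have "ennreal \<bar>?v x - ?v' x\<bar> \<le> ennreal (\<bar>?v x - ?a x\<bar> + \<bar>?v' x - ?a' x\<bar> + \<eta>)" by (rule ennreal_leI)
      also have "\<dots> = ennreal \<bar>?v x - ?a x\<bar> + ennreal \<bar>?v' x - ?a' x\<bar> + ennreal \<eta>" using pos by (simp add: ennreal_plus)
      finally show ?thesis using Qx 3 by simp
    qed
  qed
  have "L1_dist ?v ?v' \<le> (\<integral>\<^sup>+ x. ennreal \<bar>?v x - ?a x\<bar> + ennreal \<bar>?v' x - ?a' x\<bar> + ennreal \<eta> * indicator ?Q x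
     + indicator ?E x * ennreal \<bar>?v x\<bar> + indicator ?E x * ennreal \<bar>?v' x\<bar> \<partial>lborel)"
    by (intro nn_integral_mono pt)
  also have "\<dots> = L1_dist ?v ?a + L1_dist ?v' ?a'
     + (\<integral>\<^sup>+ x. ennreal \<eta> * indicator ?Q x \<partial>lborel)
     + (\<integral>\<^sup>+ x. indicator ?E x * ennreal \<bar>?v x\<bar> \<partial>lborel) + (\<integral>\<^sup>+ x. indicator ?E x * ennreal \<bar>?v' x\<bar> \<partial>lborel)"
    by (subst nn_integral_add, measurable)+
  also have "(\<integral>\<^sup>+ x. ennreal \<eta> * indicator ?Q x \<partial>lborel) = ennreal \<eta> * ennreal ((real M * \<delta>)\<^sup>2)"
    by (simp add: nn_integral_cmult_indicator eQ)
  also have "L1_dist ?v ?a + L1_dist ?v' ?a'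
     + ennreal \<eta> * ennreal ((real M * \<delta>)\<^sup>2)
     + (\<integral>\<^sup>+ x. indicator ?E x * ennreal \<bar>?v x\<bar> \<partial>lborel) + (\<integral>\<^sup>+ x. indicator ?E x * ennreal \<bar>?v' x\<bar> \<partial>lborel)
     \<le> ennreal (24 * C * (\<delta> + h)) + ennreal (24 * C * (\<delta> + h')) + ennreal \<eta> * ennreal ((real M * \<delta>)\<^sup>2) + ennreal \<epsilon> + ennreal \<epsilon>"
    by (intro add_mono bv_step_deviation[OF bv(1) d U(1)] bv_step_deviation[OF bv(2) d U(2)] tail order_refl)
  also have "\<dots> = ennreal (24 * C * (\<delta> + h) + 24 * C * (\<delta> + h') + \<eta> * (real M * \<delta>)\<^sup>2 + \<epsilon> + \<epsilon>)"
  proof -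
    have "ennreal a + ennreal b + ennreal \<eta> * ennreal c + ennreal \<epsilon> + ennreal \<epsilon> = ennreal (a + b + \<eta> * c + \<epsilon> + \<epsilon>)"
      if "0 \<le> a" "0 \<le> b" "0 \<le> c" for a b c
      using that pos by (simp add: ennreal_mult[symmetric] ennreal_plus[symmetric] del: ennreal_plus)
    then show ?thesis using h d by simp
  qed
  finally show ?thesis .
qed

text \<open>Summable consecutive differences give convergence almost everywhere, and Fatou's lemma
  keeps the rate. The limit is the concrete term \<open>lim\<close>, which stays measurable when
  \<open>w\<close> depends on a parameter such as time; limits chosen separately for each parameter
  need not.\<close>

lemma L1_cauchy_limit:
  fixes w :: "nat \<Rightarrow> 'a \<Rightarrow> real"
  assumes w[measurable]: "\<And>n. w n \<in> borel_measurable M"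
    and cauchy: "\<And>k p q. k < p \<Longrightarrow> k < q \<Longrightarrow> (\<integral>\<^sup>+ x. ennreal \<bar>w p x - w q x\<bar> \<partial>M) \<le> ennreal ((1/2) ^ k)"
  shows "AE x in M. (\<lambda>n. w n x) \<longlonglongrightarrow> lim (\<lambda>n. w n x)"
    and "k < p \<Longrightarrow> (\<integral>\<^sup>+ x. ennreal \<bar>w p x - lim (\<lambda>n. w n x)\<bar> \<partial>M) \<le> ennreal ((1/2) ^ k)"
proof -
  \<comment> \<open>The indices \<open>n + 1\<close> and \<open>n + 2\<close> appear because the
    rate \<open>(1/2) ^ n\<close> holds only strictly beyond \<open>n\<close>.\<close>
  have "(\<integral>\<^sup>+ x. (\<Sum>n. ennreal \<bar>w (n + 2) x - w (n + 1) x\<bar>) \<partial>M) = (\<Sum>n. \<integral>\<^sup>+ x. ennreal \<bar>w (n + 2) x - w (n + 1) x\<bar> \<partial>M)"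
    by (rule nn_integral_suminf) measurable
  also have "\<dots> \<le> (\<Sum>n. ennreal ((1/2) ^ n))"
    by (intro suminf_le cauchy) auto
  also have "\<dots> = ennreal (\<Sum>n. (1/2) ^ n)"
    by (intro suminf_ennreal2 summable_geometric) auto
  also have "\<dots> < \<infinity>" by simp
  finally have "(\<integral>\<^sup>+ x. (\<Sum>n. ennreal \<bar>w (n + 2) x - w (n + 1) x\<bar>) \<partial>M) \<noteq> \<infinity>" by simp
  then have "AE x in M. (\<Sum>n. ennreal \<bar>w (n + 2) x - w (n + 1) x\<bar>) \<noteq> \<infinity>"
    by (intro nn_integral_PInf_AE) measurable
  then show conv: "AE x in M. (\<lambda>n. w n x) \<longlonglongrightarrow> lim (\<lambda>n. w n x)"
  proof eventually_elim
    case (elim x)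
    have "summable (\<lambda>n. \<bar>w (n + 2) x - w (n + 1) x\<bar>)"
      by (rule summable_suminf_not_top) (use elim in auto)
    then have s: "summable (\<lambda>n. w (n + 2) x - w (n + 1) x)" by (rule summable_rabs_cancel)
    have tel: "(\<Sum>i<n. w (i + 2) x - w (i + 1) x) = w (n + 1) x - w 1 x" for n
      by (induction n) simp_all
    have "convergent (\<lambda>n. w (n + 1) x - w 1 x)"
      using s unfolding summable_iff_convergent tel .
    from convergent_add[OF this convergent_const[of "w 1 x"]]
    have "convergent (\<lambda>n. w (n + 1) x)" by simp
    then have "convergent (\<lambda>n. w n x)" by (rule convergent_ignore_initial_segment[THEN iffD1])
    then show ?case by (simp add: convergent_LIMSEQ_iff)
  qed
  show "(\<integral>\<^sup>+ x. ennreal \<bar>w p x - lim (\<lambda>n. w n x)\<bar> \<partial>M) \<le> ennreal ((1/2) ^ k)" if "k < p"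
  proof -
    have "(\<integral>\<^sup>+ x. ennreal \<bar>w p x - lim (\<lambda>n. w n x)\<bar> \<partial>M)
      \<le> (\<integral>\<^sup>+ x. liminf (\<lambda>q. ennreal \<bar>w p x - w q x\<bar>) \<partial>M)"
    proof (rule nn_integral_mono_AE, use conv in eventually_elim)
      case (elim x)
      have "(\<lambda>q. ennreal \<bar>w p x - w q x\<bar>) \<longlonglongrightarrow> ennreal \<bar>w p x - lim (\<lambda>n. w n x)\<bar>"
        by (intro tendsto_ennrealI tendsto_rabs tendsto_diff tendsto_const elim)
      then show ?case using lim_imp_Liminf[OF sequentially_bot] by fastforce
    qed
    also have "\<dots> \<le> liminf (\<lambda>q. \<integral>\<^sup>+ x. ennreal \<bar>w p x - w q x\<bar> \<partial>M)"
      by (rule nn_integral_liminf) measurable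
    also have "\<dots> \<le> liminf (\<lambda>q. ennreal ((1/2) ^ k))"
      by (intro Liminf_mono eventually_sequentiallyI[of "Suc k"] cauchy that) auto
    also have "\<dots> = ennreal ((1/2) ^ k)" by (rule Liminf_const) (rule sequentially_bot)
    finally show ?thesis .
  qed
qed

text \<open>The hypotheses of a Riesz-Kolmogorov argument in discrete form: a uniform bound, bounded
  variation in space, Lipschitz dependence on the time level, and uniformly small tails. Sums of
  jumps carry one factor \<open>h p\<close> since they are of order \<open>1 / h p\<close>;
  \<open>\<nu>\<close> is the lattice speed.\<close>

locale bv_family =
  fixes T \<nu> U C :: real and h :: "nat \<Rightarrow> real" and N :: "nat \<Rightarrow> nat"
    and v :: "nat \<Rightarrow> nat \<Rightarrow> nat \<Rightarrow> nat \<Rightarrow> real"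
  assumes T: "0 < T" and \<nu>: "0 < \<nu>" and h_pos: "\<And>p. 0 < h p" and h_lim: "h \<longlonglongrightarrow> 0"
    and N: "\<And>p. real (N p) * (h p / \<nu>) = T"
    and bound: "\<And>p n j k. n < N p \<Longrightarrow> \<bar>v p n j k\<bar> \<le> U"
    and bv: "\<And>p n. n < N p \<Longrightarrow> bv_step (h p) C (v p n)"
    and time: "\<And>p n J. Suc n < N p \<Longrightarrow> h p * box_sum J (\<lambda>j k. \<bar>v p (Suc n) j k - v p n j k\<bar>) \<le> C"
    and tail: "\<And>\<epsilon>::real. 0 < \<epsilon> \<Longrightarrow> \<exists>X. \<forall>p n. n < N p \<longrightarrow>
       (\<integral>\<^sup>+ x. indicator {x. X \<le> fst x \<or> X \<le> snd x} x * ennreal \<bar>step_fun (h p) (v p n) x\<bar> \<partial>lborel) \<le> ennreal \<epsilon>"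
begin

section \<open>Equicontinuity in time and extraction of the limit\<close>

definition level :: "nat \<Rightarrow> real \<Rightarrow> nat" where
  "level p t = nat \<lfloor>t / (h p / \<nu>)\<rfloor>"

definition W :: "nat \<Rightarrow> real \<Rightarrow> real \<times> real \<Rightarrow> real" where
  "W p t = step_fun (h p) (v p (level p t))"

lemma \<tau>_pos: "0 < h p / \<nu>" using h_pos \<nu> by simp

lemma N_pos: "0 < N p" using N[of p] T by (cases "N p") auto

lemma level_less: "t < T \<Longrightarrow> level p t < N p"
proof -
  assume "t < T"
  then have "t / (h p / \<nu>) < T / (h p / \<nu>)" using \<tau>_pos by (intro divide_strict_right_mono)
  also have "T / (h p / \<nu>) = real (N p)" by (metis N \<tau>_pos less_irrefl nonzero_mult_div_cancel_right)
  finally have "\<lfloor>t / (h p / \<nu>)\<rfloor> < int (N p)" by (simp only: floor_less_iff of_int_of_nat_eq)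
  then show ?thesis using N_pos[of p] unfolding level_def by linarith
qed

lemma level_mono: "s \<le> t \<Longrightarrow> level p s \<le> level p t"
  unfolding level_def using \<tau>_pos[of p] by (intro nat_mono floor_mono divide_right_mono) auto

text \<open>Rounding both times down to the grid lengthens their distance by at most one step, which
  accounts for the additional \<open>h p\<close>.\<close>

lemma level_diff:
  assumes "0 \<le> s" "s \<le> t"
  shows "(real (level p t) - real (level p s)) * h p \<le> \<nu> * (t - s) + h p"
proof -
  have 0: "0 \<le> s / (h p / \<nu>)" "0 \<le> t / (h p / \<nu>)" 
    using divide_nonneg_pos[OF _ \<tau>_pos[of p]] assms order_trans[OF assms] by blast+
  then have "real (level p t) \<le> t / (h p / \<nu>)" "s / (h p / \<nu>) - 1 \<le> real (level p s)"
    by (auto simp: level_def)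
  then have "real (level p t) - real (level p s) \<le> (t - s) / (h p / \<nu>) + 1"
    unfolding diff_divide_distrib by linarith
  then have "(real (level p t) - real (level p s)) * h p \<le> ((t - s) / (h p / \<nu>) + 1) * h p"
    using h_pos[of p] by (intro mult_right_mono) auto
  also have "\<dots> = \<nu> * (t - s) + h p" using h_pos[of p] \<nu> by (simp add: field_simps)
  finally show ?thesis .
qed

lemma C_nonneg: "0 \<le> C" using bv[OF N_pos] by (simp add: bv_step_def)

lemma U_nonneg: "0 \<le> U" using bound[OF N_pos, of 0 0 0] by linarith

lemma measurable_W [measurable]: "W p t \<in> borel_measurable borel"
  unfolding W_def by measurable

lemma W_bound: "t < T \<Longrightarrow> \<bar>W p t x\<bar> \<le> U"
  using bound[OF level_less] U_nonneg by (simp add: W_def step_fun_def)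

lemma W_outside: "\<not> (0 \<le> fst x \<and> 0 \<le> snd x) \<Longrightarrow> W p t x = 0"
  by (auto simp: W_def step_fun_def)

lemma step_time_close:
  assumes "m + l < N p"
  shows "L1_dist (step_fun (h p) (v p (m + l))) (step_fun (h p) (v p m))
    \<le> ennreal (real l * h p * C)"
proof -
  let ?g = "\<lambda>j k. \<bar>v p (m + l) j k - v p m j k\<bar>"
  have "\<bar>step_fun (h p) (v p (m + l)) x - step_fun (h p) (v p m) x\<bar> = step_fun (h p) ?g x" for x
    by (simp add: step_fun_def)
  moreover have "(\<integral>\<^sup>+ x. ennreal (step_fun (h p) ?g x) \<partial>lborel) \<le> ennreal (real l * h p * C)"
  proof (rule nn_integral_step_fun_le[OF h_pos])
    fix J
    have "h p * box_sum J (\<lambda>j k. \<bar>v p (m + l) j k - v p m j k\<bar>) \<le> real l * C"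
      using assms
    proof (induction l)
      case 0
      then show ?case by (simp add: box_sum_def)
    next
      case (Suc l)
      have "box_sum J (\<lambda>j k. \<bar>v p (m + Suc l) j k - v p m j k\<bar>)
        \<le> box_sum J (\<lambda>j k. \<bar>v p (Suc (m + l)) j k - v p (m + l) j k\<bar> + \<bar>v p (m + l) j k - v p m j k\<bar>)"
        by (rule box_sum_mono) auto
      then have "h p * box_sum J (\<lambda>j k. \<bar>v p (m + Suc l) j k - v p m j k\<bar>)
        \<le> h p * (box_sum J (\<lambda>j k. \<bar>v p (Suc (m + l)) j k - v p (m + l) j k\<bar>) + box_sum J (\<lambda>j k. \<bar>v p (m + l) j k - v p m j k\<bar>))"
        unfolding box_sum_add using h_pos[of p] by (intro mult_left_mono) auto
      also have "\<dots> \<le> C + real l * C"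
        using Suc.IH Suc.prems time[of "m + l" p J] unfolding distrib_left by (intro add_mono) auto
      finally show ?case by (simp add: distrib_right)
    qed
    then have "h p * (h p * box_sum J ?g) \<le> h p * (real l * C)"
      using h_pos[of p] by (intro mult_left_mono) auto
    then show "(h p)\<^sup>2 * box_sum J ?g \<le> real l * h p * C"
      by (simp add: power2_eq_square algebra_simps)
  qed simp
  ultimately show ?thesis by simp
qed

lemma time_close:
  assumes "0 \<le> s" "s \<le> t" "t < T"
  shows "L1_dist (W p t) (W p s) \<le> ennreal (C * (\<nu> * (t - s) + h p))"
proof -
  have le: "level p s \<le> level p t" by (rule level_mono) (use assms in simp)
  define l where "l = level p t - level p s"
  have l: "level p t = level p s + l" using le by (simp add: l_def)
  have "L1_dist (W p t) (W p s) \<le> ennreal (real l * h p * C)"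
    unfolding W_def l using level_less[OF assms(3), of p] l by (intro step_time_close) simp
  also have "real l * h p = (real (level p t) - real (level p s)) * h p" using l by simp
  also have "\<dots> * C \<le> (\<nu> * (t - s) + h p) * C"
    by (intro mult_right_mono level_diff assms C_nonneg)
  finally show ?thesis by (simp add: mult.commute ennreal_leI)
qed

lemma nn_integral_W_finite:
  assumes "t < T"
  shows "(\<integral>\<^sup>+ x. ennreal \<bar>W p t x\<bar> \<partial>lborel) < \<infinity>"
proof -
  obtain X where X: "(\<integral>\<^sup>+ x. indicator {x. X \<le> fst x \<or> X \<le> snd x} x * ennreal \<bar>W p t x\<bar> \<partial>lborel) \<le> ennreal 1"
    using tail[of 1] level_less[OF assms] unfolding W_def by auto
  let ?Q = "{0..<X} \<times> {0..<X}"
  have Q [measurable]: "?Q \<in> sets borel" unfolding borel_prod[symmetric] by auto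
  have fs [measurable]: "fst \<in> borel_measurable (borel :: (real \<times> real) measure)"
    "snd \<in> borel_measurable (borel :: (real \<times> real) measure)"
    unfolding borel_prod[symmetric] by measurable
  have E [measurable]: "{x :: real \<times> real. X \<le> fst x \<or> X \<le> snd x} \<in> sets borel" by measurable
  have "emeasure lborel ?Q < \<infinity>"
    by (cases "0 \<le> X") (auto simp: emeasure_lborel_Times ennreal_mult_less_top)
  then have fin: "ennreal U * emeasure lborel ?Q < \<infinity>" by (simp add: ennreal_mult_less_top)
  have "(\<integral>\<^sup>+ x. ennreal \<bar>W p t x\<bar> \<partial>lborel)
    \<le> (\<integral>\<^sup>+ x. indicator {x. X \<le> fst x \<or> X \<le> snd x} x * ennreal \<bar>W p t x\<bar> + ennreal U * indicator ?Q x \<partial>lborel)"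
  proof (rule nn_integral_mono)
    fix x :: "real \<times> real"
    show "ennreal \<bar>W p t x\<bar> \<le> indicator {x. X \<le> fst x \<or> X \<le> snd x} x * ennreal \<bar>W p t x\<bar> + ennreal U * indicator ?Q x"
      using W_outside[of x p t] W_bound[OF assms, of p x]
      by (cases "0 \<le> fst x \<and> 0 \<le> snd x"; cases "x \<in> ?Q") (auto simp: indicator_def mem_Times_iff ennreal_leI add_increasing)
  qed
  also have "\<dots> = (\<integral>\<^sup>+ x. indicator {x. X \<le> fst x \<or> X \<le> snd x} x * ennreal \<bar>W p t x\<bar> \<partial>lborel)
      + ennreal U * emeasure lborel ?Q"
    by (subst nn_integral_add) (measurable, simp add: nn_integral_cmult_indicator)
  also have "\<dots> < \<infinity>" using X fin by (simp add: ennreal_add_less_top[unfolded top_ennreal_def[symmetric]] order_le_less_trans)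
  finally show ?thesis .
qed

lemma nn_integral_triangle:
  fixes a b c :: "real \<times> real \<Rightarrow> real"
  assumes [measurable]: "a \<in> borel_measurable borel" "b \<in> borel_measurable borel" "c \<in> borel_measurable borel"
  shows "L1_dist a c
    \<le> L1_dist a b + L1_dist b c"
proof -
  have "L1_dist a c \<le> (\<integral>\<^sup>+ x. ennreal \<bar>a x - b x\<bar> + ennreal \<bar>b x - c x\<bar> \<partial>lborel)"
    by (intro nn_integral_mono) (simp add: ennreal_leI flip: ennreal_plus)
  also have "\<dots> = L1_dist a b + L1_dist b c"
    by (rule nn_integral_add) measurable
  finally show ?thesis .
qed

text \<open>Near equality at finitely many times on finitely many coarse cells has to control a
  supremum over all times. The budget in eighths of \<open>\<epsilon>\<close>: two for moving from
  \<open>t\<close> to a coarse time and back, one for the cell size \<open>\<delta>\<close>, one for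
  the two meshes, one for the quantisation \<open>\<eta>\<close>, two for the tails; one is left
  over.\<close>

lemma colouring:
  assumes \<epsilon>: "0 < \<epsilon>"
  shows "\<exists>(c :: nat \<Rightarrow> nat \<times> nat \<times> nat \<Rightarrow> int) P. finite (range c) \<and>
     (\<forall>p\<ge>P. \<forall>q\<ge>P. c p = c q \<longrightarrow>
        (SUP t\<in>{0<..<T}. \<integral>\<^sup>+ x. ennreal \<bar>W p t x - W q t x\<bar> \<partial>lborel) \<le> ennreal \<epsilon>)"
proof -
  have e8: "0 < \<epsilon> / 8" using \<epsilon> by simp
  obtain X where X: "\<And>p n. n < N p \<Longrightarrow>
       (\<integral>\<^sup>+ x. indicator {x. X \<le> fst x \<or> X \<le> snd x} x * ennreal \<bar>step_fun (h p) (v p n) x\<bar> \<partial>lborel) \<le> ennreal (\<epsilon> / 8)"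
    using tail[OF e8] by blast
  \<comment> \<open>The added 1 keeps the divisor positive when \<open>C\<close> vanishes; in
    \<open>\<eta>\<close> it does so when \<open>M\<close> is zero.\<close>
  define \<delta> where "\<delta> = \<epsilon> / 8 / (48 * C + 1)"
  have \<delta>: "0 < \<delta>" "48 * C * \<delta> \<le> \<epsilon> / 8"
    using \<epsilon> C_nonneg by (auto simp: \<delta>_def field_simps)
  define M where "M = nat \<lceil>X / \<delta>\<rceil>"
  have "X / \<delta> \<le> real M" unfolding M_def by linarith
  then have M: "X \<le> real M * \<delta>" using \<delta> by (simp add: pos_divide_le_eq)
  define \<eta> where "\<eta> = \<epsilon> / 8 / ((real M * \<delta>)\<^sup>2 + 1)"
  have M1: "0 < (real M * \<delta>)\<^sup>2 + 1" by (simp add: add_nonneg_pos)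
  have \<eta>: "0 < \<eta>" using \<epsilon> M1 by (simp add: \<eta>_def)
  have "\<eta> * (real M * \<delta>)\<^sup>2 \<le> \<eta> * ((real M * \<delta>)\<^sup>2 + 1)" using \<eta> by (intro mult_left_mono) auto
  also have "\<eta> * ((real M * \<delta>)\<^sup>2 + 1) = \<epsilon> / 8" using M1 by (metis \<eta>_def less_irrefl nonzero_eq_divide_eq)
  finally have \<eta>M: "\<eta> * (real M * \<delta>)\<^sup>2 \<le> \<epsilon> / 8" .
  obtain L0 :: nat where L0: "16 * C * \<nu> * T / \<epsilon> < real L0" using reals_Archimedean2 by blast
  define L where "L = Suc L0"
  have "16 * C * \<nu> * T / \<epsilon> \<le> real L" using L0 by (simp add: L_def)
  then have L: "0 < L" "C * (\<nu> * (T / real L)) \<le> \<epsilon> / 16"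
    using \<epsilon> by (auto simp: L_def field_simps)
  have "(\<lambda>p. 24 * C * h p) \<longlonglongrightarrow> 24 * C * 0" by (intro tendsto_mult tendsto_const h_lim)
  then have "\<forall>\<^sub>F p in sequentially. 24 * C * h p < \<epsilon> / 16"
    by (rule order_tendstoD(2)) (use \<epsilon> in simp)
  then obtain P where P: "\<And>p. P \<le> p \<Longrightarrow> 24 * C * h p < \<epsilon> / 16" unfolding eventually_sequentially by blast
  define D where "D = {..<L} \<times> {..<M} \<times> {..<M}"
  define s where "s l = real l * T / real L" for l :: nat
  \<comment> \<open>The restriction to the finite set \<open>D\<close> puts all colours into a
    finite product of integer intervals, since the averages are bounded by \<open>U\<close>.\<close>
  define c where "c p = (\<lambda>d\<in>D. case d of (l, j, k) \<Rightarrow> \<lfloor>coarse_avg \<delta> (W p (s l)) j k / \<eta>\<rfloor>)" for p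
  have s: "0 \<le> s l" "l < L \<Longrightarrow> s l < T" for l using T L by (auto simp: s_def field_simps)
  have "finite (range c)"
  proof (rule finite_subset)
    show "range c \<subseteq> (\<Pi>\<^sub>E d\<in>D. {- \<lceil>U / \<eta>\<rceil> .. \<lceil>U / \<eta>\<rceil>})"
    proof
      fix f assume "f \<in> range c"
      then obtain p where f: "f = c p" by blast
      have "\<lfloor>coarse_avg \<delta> (W p (s l)) j k / \<eta>\<rfloor> \<in> {- \<lceil>U / \<eta>\<rceil> .. \<lceil>U / \<eta>\<rceil>}" if "l < L" for l j k
      proof -
        have "\<bar>coarse_avg \<delta> (W p (s l)) j k\<bar> \<le> U"
          by (rule coarse_avg_bound[OF \<delta>(1)]) (use W_bound s(2)[OF that] in auto)
        then have "\<bar>coarse_avg \<delta> (W p (s l)) j k / \<eta>\<bar> \<le> U / \<eta>" using \<eta> by (simp add: divide_right_mono)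
        then show ?thesis by (auto; linarith)
      qed
      then show "f \<in> (\<Pi>\<^sub>E d\<in>D. {- \<lceil>U / \<eta>\<rceil> .. \<lceil>U / \<eta>\<rceil>})"
        unfolding f c_def by (intro restrict_PiE_iff[THEN iffD2] ballI) (auto simp: D_def)
    qed
    show "finite (\<Pi>\<^sub>E d\<in>D. {- \<lceil>U / \<eta>\<rceil> .. \<lceil>U / \<eta>\<rceil>})" by (intro finite_PiE) (auto simp: D_def)
  qed
  moreover have "(SUP t\<in>{0<..<T}. \<integral>\<^sup>+ x. ennreal \<bar>W p t x - W q t x\<bar> \<partial>lborel) \<le> ennreal \<epsilon>"
    if pq: "P \<le> p" "P \<le> q" "c p = c q" for p q
  proof (rule SUP_least)
    fix t assume t: "t \<in> {0<..<T}"
    define l where "l = nat \<lfloor>t * real L / T\<rfloor>"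
    have tl: "0 \<le> t * real L / T" "t * real L / T < real L" using t L T by (auto simp: pos_divide_less_eq)
    have l: "l < L" using tl L by (simp add: l_def nat_less_iff floor_less_iff)
    have "real l \<le> t * real L / T" "t * real L / T < real l + 1" using tl(1) unfolding l_def by linarith+
    then have "real l * (T / real L) \<le> t" "t \<le> (real l + 1) * (T / real L)"
      using T L by (auto simp: field_simps)
    then have st: "s l \<le> t" "t - s l \<le> T / real L" by (auto simp: s_def distrib_right add_divide_distrib)
    have ts: "L1_dist (W r t) (W r (s l)) \<le> ennreal (\<epsilon> / 8)" if "P \<le> r" for r
    proof -
      \<comment> \<open>The mesh error \<open>C * h r\<close> is enlarged to
        \<open>24 * C * h r\<close>, so that the threshold \<open>P\<close> of the spatial
        comparison serves here as well.\<close>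
      have "C * (\<nu> * (t - s l) + h r) \<le> C * (\<nu> * (T / real L)) + 24 * C * h r"
        using C_nonneg h_pos[of r] \<nu> st(2) unfolding distrib_left
        by (intro add_mono mult_left_mono) (auto simp: mult_right_mono)
      also have "\<dots> \<le> \<epsilon> / 8" using L(2) P[OF that] by linarith
      finally show ?thesis
        using time_close[OF s(1) st(1), of r] t ennreal_leI order_trans by (metis greaterThanLessThan_iff)
    qed
    have mid: "L1_dist (W p (s l)) (W q (s l)) \<le> ennreal (5 * (\<epsilon> / 8))"
    proof -
      have lv: "level p (s l) < N p" "level q (s l) < N q" by (intro level_less s(2) l)+
      have tl: "(\<integral>\<^sup>+ x. indicator {x. real M * \<delta> \<le> fst x \<or> real M * \<delta> \<le> snd x} x * ennreal \<bar>step_fun (h r) (v r n) x\<bar> \<partial>lborel)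
        \<le> ennreal (\<epsilon> / 8)" if "n < N r" for r n
        by (rule order_trans[OF nn_integral_mono X[OF that]]) (use M in \<open>auto simp: indicator_def\<close>)
      have "L1_dist (W p (s l)) (W q (s l))
        \<le> ennreal (24 * C * (\<delta> + h p) + 24 * C * (\<delta> + h q) + \<eta> * (real M * \<delta>)\<^sup>2 + \<epsilon> / 8 + \<epsilon> / 8)"
        unfolding W_def
      proof (rule bv_step_close[OF bv[OF lv(1)] bv[OF lv(2)] \<delta>(1) bound[OF lv(1)] bound[OF lv(2)] _ tl[OF lv(1)] tl[OF lv(2)]])
        fix j k assume jk: "j < M" "k < M"
        have "c p (l, j, k) = c q (l, j, k)" using pq(3) by simp
        then have "\<lfloor>coarse_avg \<delta> (W p (s l)) j k / \<eta>\<rfloor> = \<lfloor>coarse_avg \<delta> (W q (s l)) j k / \<eta>\<rfloor>"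
          using jk l by (simp add: c_def D_def)
        then have "\<bar>coarse_avg \<delta> (W p (s l)) j k / \<eta> - coarse_avg \<delta> (W q (s l)) j k / \<eta>\<bar> \<le> 1" by linarith
        then have "\<bar>(coarse_avg \<delta> (W p (s l)) j k - coarse_avg \<delta> (W q (s l)) j k) / \<eta>\<bar> \<le> 1"
          by (simp add: diff_divide_distrib)
        then show "\<bar>coarse_avg \<delta> (step_fun (h p) (v p (level p (s l)))) j k
            - coarse_avg \<delta> (step_fun (h q) (v q (level q (s l)))) j k\<bar> \<le> \<eta>"
          using \<eta> by (simp add: W_def)
      qed (use \<eta> \<epsilon> in auto)
      also have "\<dots> \<le> ennreal (5 * (\<epsilon> / 8))"
        using \<delta>(2) P[OF pq(1)] P[OF pq(2)] \<eta>M by (intro ennreal_leI) (simp add: distrib_left)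
      finally show ?thesis .
    qed
    have "L1_dist (W p t) (W q t) \<le> L1_dist (W p t) (W p (s l))
      + (L1_dist (W p (s l)) (W q (s l)) + L1_dist (W q (s l)) (W q t))"
      by (intro order_trans[OF nn_integral_triangle[of "W p t" "W p (s l)"] add_left_mono] nn_integral_triangle) measurable
    also have "\<dots> \<le> ennreal (\<epsilon> / 8) + (ennreal (5 * (\<epsilon> / 8)) + ennreal (\<epsilon> / 8))"
      using ts[OF pq(1)] ts[OF pq(2)] mid by (intro add_mono) (simp_all add: abs_minus_commute)
    also have "\<dots> \<le> ennreal \<epsilon>" using \<epsilon> by (simp add: ennreal_plus[symmetric] ennreal_leI del: ennreal_plus)
    finally show "L1_dist (W p t) (W q t) \<le> ennreal \<epsilon>" .
  qed
  ultimately show ?thesis by blast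
qed

lemma measurable_step_fun_level:
  "(\<lambda>(t, x). step_fun (h p) (g (level p t)) x) \<in> borel_measurable (borel \<Otimes>\<^sub>M borel)"
proof -
  have [measurable]: "level p \<in> borel \<rightarrow>\<^sub>M count_space UNIV" unfolding level_def[abs_def] by measurable
  have "(\<lambda>z. (\<lambda>n z. step_fun (h p) (g n) (snd z)) (level p (fst z)) z) \<in> borel_measurable (borel \<Otimes>\<^sub>M borel)"
    by (rule measurable_compose_countable) measurable
  then show ?thesis by (simp add: case_prod_unfold)
qed

lemma measurable_W_joint: "(\<lambda>(t, x). W p t x) \<in> borel_measurable (borel \<Otimes>\<^sub>M borel)"
  unfolding W_def by (rule measurable_step_fun_level)

theorem compactness:
  obtains r u where "strict_mono r" "(\<lambda>(t, x). u t x) \<in> borel_measurable (borel \<Otimes>\<^sub>M borel)"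
    "\<And>t. t \<in> {0<..<T} \<Longrightarrow> AE x in lborel. \<bar>u t x\<bar> \<le> U"
    "\<And>k p t. k < p \<Longrightarrow> t \<in> {0<..<T} \<Longrightarrow> L1_dist (W (r p) t) (u t) \<le> ennreal ((1/2) ^ k)"
proof -
  have "\<exists>r. strict_mono r \<and> (\<forall>k p q. k < p \<longrightarrow> k < q \<longrightarrow>
      (SUP t\<in>{0<..<T}. \<integral>\<^sup>+ x. ennreal \<bar>W (r p) t x - W (r q) t x\<bar> \<partial>lborel) \<le> ennreal ((1/2) ^ k))"
    by (rule cauchy_subsequence[OF colouring]) (assumption, intro exI conjI allI impI, assumption+)
  then obtain r where r: "strict_mono r" "\<And>k p q. k < p \<Longrightarrow> k < q \<Longrightarrow>
      (SUP t\<in>{0<..<T}. \<integral>\<^sup>+ x. ennreal \<bar>W (r p) t x - W (r q) t x\<bar> \<partial>lborel) \<le> ennreal ((1/2) ^ k)"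
    by blast
  \<comment> \<open>For each \<open>t\<close> the limit exists for almost every \<open>x\<close>;
    taking \<open>lim\<close> everywhere yields one function that is Borel in the pair.\<close>
  define u where "u t x = lim (\<lambda>k. W (r k) t x)" for t x
  have cauchy: "L1_dist (W (r p) t) (W (r q) t) \<le> ennreal ((1/2) ^ k)"
    if "t \<in> {0<..<T}" "k < p" "k < q" for t k p q
    using order_trans[OF SUP_upper[OF that(1)] r(2)[OF that(2,3)]] .
  show thesis
  proof (rule that[OF r(1), of u])
    have "(\<lambda>z. lim (\<lambda>k. (\<lambda>(t, x). W (r k) t x) z)) \<in> borel_measurable (borel \<Otimes>\<^sub>M borel)"
      by (intro borel_measurable_lim_metric measurable_W_joint)
    then show "(\<lambda>(t, x). u t x) \<in> borel_measurable (borel \<Otimes>\<^sub>M borel)"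
      by (simp add: u_def case_prod_unfold)
  next
    fix t assume t: "t \<in> {0<..<T}"
    have "AE x in lborel. (\<lambda>k. W (r k) t x) \<longlonglongrightarrow> u t x"
      unfolding u_def by (rule L1_cauchy_limit(1)[where w = "\<lambda>k. W (r k) t", OF _ cauchy[OF t]]) auto
    then show "AE x in lborel. \<bar>u t x\<bar> \<le> U"
    proof eventually_elim
      case (elim x)
      then have "(\<lambda>k. \<bar>W (r k) t x\<bar>) \<longlonglongrightarrow> \<bar>u t x\<bar>" by (rule tendsto_rabs)
      then show ?case by (rule LIMSEQ_le_const2) (use W_bound t in auto)
    qed
  next
    fix k p :: nat and t assume "k < p" and t: "t \<in> {0<..<T}"
    then show "L1_dist (W (r p) t) (u t) \<le> ennreal ((1/2) ^ k)"
      unfolding u_def by (intro L1_cauchy_limit(2)[where w = "\<lambda>k. W (r k) t", OF _ cauchy[OF t]]) auto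
  qed
qed

end

section \<open>Convergence of the scheme\<close>

lemma Linf_norm_AE:
  assumes "in_Linf \<Omega> u" "Linf_norm \<Omega> u \<le> m" "m < \<infinity>"
  shows "AE x in lebesgue_on \<Omega>. \<bar>u x\<bar> \<le> enn2real m"
proof -
  have "AE x in lebesgue_on \<Omega>. ennreal \<bar>u x\<bar> \<le> Linf_norm \<Omega> u"
    unfolding Linf_norm_def by (rule esssup_AE)
  then show ?thesis
  proof eventually_elim
    case (elim x)
    then have "ennreal \<bar>u x\<bar> \<le> m" using assms(2) by simp
    then have "enn2real (ennreal \<bar>u x\<bar>) \<le> enn2real m" by (rule enn2real_mono) (use assms(3) in simp)
    then show ?case by simp
  qed
qed

section \<open>Discretised initial and boundary data\<close>

definition rect_integral :: "(real \<times> real \<Rightarrow> real) \<Rightarrow> real \<Rightarrow> real \<Rightarrow> nat \<Rightarrow> nat \<Rightarrow> real" where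
  "rect_integral u h h' a c = (LINT x:{real a * h<..<(real a + 1) * h} \<times> {real c * h'<..<(real c + 1) * h'}|lebesgue. u x)"

lemma rect_eq_grid_cell:
  "{real a * h<..<(real a + 1) * h} \<times> {real c * h'<..<(real c + 1) * h'} = grid_cell (1,0) (0,1) h h' a c"
  "{real a * h<..<(real a + 1) * h} \<times> {real c * h'<..<(real c + 1) * h'} = grid_cell (0,1) (1,0) h' h c a"
  by (auto simp: grid_cell_def)

text \<open>The grid parameter \<^term>\<open>None\<close> stands for a quadrant, \<^term>\<open>Some N\<close> for a strip of
  exactly \<^term>\<open>N\<close> cells in the first coordinate.\<close>

locale bv_datum =
  fixes \<Omega> :: "(real \<times> real) set" and u :: "real \<times> real \<Rightarrow> real" and V U h h' :: real and M :: "nat option"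
  assumes u: "u absolutely_integrable_on \<Omega>"
    and V: "\<And>\<psi>. \<psi> \<in> test_fields \<Omega> \<Longrightarrow> (LINT x:\<Omega>|lebesgue. u x * divergence \<psi> x) \<le> V"
    and \<Omega>: "\<Omega> = (case M of None \<Rightarrow> {0<..} | Some N \<Rightarrow> {0<..<real N * h}) \<times> {0<..}"
    and U: "AE x in lebesgue_on \<Omega>. \<bar>u x\<bar> \<le> U"
    and h: "0 < h" "0 < h'"
begin

abbreviation inside :: "nat \<Rightarrow> bool" where
  "inside a \<equiv> (case M of None \<Rightarrow> True | Some N \<Rightarrow> a < N)"

lemma \<Omega>_open: "open \<Omega>"
  unfolding \<Omega> by (auto intro!: open_Times split: option.split)

lemma \<Omega>_lebesgue: "\<Omega> \<in> sets lebesgue"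
  using \<Omega>_open by (intro sets_completionI_sets) (simp add: borel_open)

lemma rect_subset:
  assumes "inside a"
  shows "{real a * h<..<(real a + 1) * h} \<times> {real c * h'<..<(real c + 1) * h'} \<subseteq> \<Omega>"
proof -
  have p: "0 \<le> real a * h" "0 \<le> real c * h'" using h by auto
  show ?thesis
  proof (cases M)
    case None
    then show ?thesis using p by (auto simp: \<Omega>)
  next
    case (Some N)
    then have "real a + 1 \<le> real N" using assms by auto
    then have "(real a + 1) * h \<le> real N * h" using h by (intro mult_right_mono) auto
    then show ?thesis using p Some by (auto simp: \<Omega>)
  qed
qed

lemma rect_integral_bound: "inside a \<Longrightarrow> \<bar>rect_integral u h h' a c\<bar> \<le> U * (h * h')"
  using abs_integral_le_measure[OF u \<Omega>_lebesgue U rect_subset, of a c]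
    grid_cell_measure[of "(1,0)" "(0,1)" h h' a c] h
  unfolding rect_integral_def rect_eq_grid_cell(1) by simp

text \<open>The \<open>m\<close> jumps involve columns up to \<open>m\<close>, so column
  \<open>m\<close> itself has to lie in the domain. For a strip of \<open>N\<close> columns this
  allows \<open>m = N - 1\<close>, the number of time increments.\<close>

lemma rect_jumps_fst:
  assumes "inside m"
  shows "(\<Sum>a<m. \<Sum>c<K. \<bar>rect_integral u h h' (Suc a) c - rect_integral u h h' a c\<bar>) \<le> h * V"
  unfolding rect_integral_def rect_eq_grid_cell(1)
proof (rule cell_jumps_le_total_variation[OF u \<Omega>_lebesgue V _ h])
  fix x :: "real \<times> real"
  assume x: "0 < x \<bullet> (1,0)" "x \<bullet> (1,0) < (real m + 1) * h" "0 < x \<bullet> (0,1)"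
  show "x \<in> \<Omega>"
  proof (cases M)
    case None
    then show ?thesis using x by (cases x) (auto simp: \<Omega>)
  next
    case (Some N)
    then have "real m + 1 \<le> real N" using assms by auto
    then have "(real m + 1) * h \<le> real N * h" using h by (intro mult_right_mono) auto
    then show ?thesis using x Some by (cases x) (auto simp: \<Omega>)
  qed
qed auto

lemma rect_jumps_snd:
  assumes "inside (m - 1)"
  shows "(\<Sum>a<m. \<Sum>c<K. \<bar>rect_integral u h h' a (Suc c) - rect_integral u h h' a c\<bar>) \<le> h' * V"
proof -
  have "(\<Sum>c<K. \<Sum>a<m. \<bar>rect_integral u h h' a (Suc c) - rect_integral u h h' a c\<bar>) \<le> h' * V"
    unfolding rect_integral_def rect_eq_grid_cell(2)
  proof (rule cell_jumps_le_total_variation[OF u \<Omega>_lebesgue V _ h(2,1)])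
    fix x :: "real \<times> real"
    assume x: "0 < x \<bullet> (0,1)" "0 < x \<bullet> (1,0)" "x \<bullet> (1,0) < real m * h"
    show "x \<in> \<Omega>"
    proof (cases M)
      case None
      then show ?thesis using x by (cases x) (auto simp: \<Omega>)
    next
      case (Some N)
      then have "real m \<le> real N" using assms by auto
      then have "real m * h \<le> real N * h" using h by (intro mult_right_mono) auto
      then show ?thesis using x Some by (cases x) (auto simp: \<Omega>)
    qed
  qed auto
  then show ?thesis by (subst sum.swap)
qed

lemma rect_l1:
  assumes "inside (m - 1)" and u': "u absolutely_integrable_on \<Omega>'"
    and sub: "\<And>a c. a < m \<Longrightarrow> c < K \<Longrightarrow> P a c \<Longrightarrow>
       {real a * h<..<(real a + 1) * h} \<times> {real c * h'<..<(real c + 1) * h'} \<subseteq> \<Omega>'"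
  shows "(\<Sum>a<m. \<Sum>c<K. if P a c then \<bar>rect_integral u h h' a c\<bar> else 0) \<le> (LINT x:\<Omega>'|lebesgue. \<bar>u x\<bar>)"
  unfolding rect_integral_def rect_eq_grid_cell(1)
  by (rule grid_l1_le[OF u' h]) (use sub in \<open>auto simp: rect_eq_grid_cell(1)\<close>)

lemma rect_l1_all:
  assumes "inside (m - 1)"
  shows "(\<Sum>a<m. \<Sum>c<K. \<bar>rect_integral u h h' a c\<bar>) \<le> (LINT x:\<Omega>|lebesgue. \<bar>u x\<bar>)"
  using rect_l1[OF assms u, of K "\<lambda>_ _. True"] rect_subset assms by (force split: option.splits)

text \<open>Averaging over \<open>m\<close> columns controls a single one by mass and variation;
  this takes the place of the trace theorem for functions of bounded variation.\<close>

lemma rect_trace: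
  assumes "inside (m - 1)" "n < m"
  shows "real m * (\<Sum>c<K. \<bar>rect_integral u h h' n c\<bar>) \<le> (LINT x:\<Omega>|lebesgue. \<bar>u x\<bar>) + real m * (h * V)"
proof -
  let ?r = "rect_integral u h h'"
  have "real m * (\<Sum>c<K. \<bar>?r n c\<bar>) = (\<Sum>c<K. real m * \<bar>?r n c\<bar>)" by (rule sum_distrib_left)
  also have "\<dots> \<le> (\<Sum>c<K. (\<Sum>a<m. \<bar>?r a c\<bar>) + real m * (\<Sum>a<m - 1. \<bar>?r (Suc a) c - ?r a c\<bar>))"
    by (intro sum_mono trace_le assms(2))
  also have "\<dots> = (\<Sum>a<m. \<Sum>c<K. \<bar>?r a c\<bar>) + real m * (\<Sum>a<m - 1. \<Sum>c<K. \<bar>?r (Suc a) c - ?r a c\<bar>)"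
    unfolding sum.distrib sum_distrib_left[symmetric]
    by (subst sum.swap, subst (2) sum.swap) (rule refl)
  also have "\<dots> \<le> (LINT x:\<Omega>|lebesgue. \<bar>u x\<bar>) + real m * (h * V)"
    by (intro add_mono mult_left_mono rect_l1_all rect_jumps_fst assms) simp
  finally show ?thesis .
qed

end

locale lbm_bv_data = monotone_lbm +
  assumes T: "0 < T"
    and init: "in_Linf quadrant (u_init S)" "in_BV quadrant (u_init S)"
    and west: "in_Linf ({0<..<T} \<times> {0<..}) (u_west S)" "in_BV ({0<..<T} \<times> {0<..}) (u_west S)"
    and south: "in_Linf ({0<..<T} \<times> {0<..}) (u_south S)" "in_BV ({0<..<T} \<times> {0<..}) (u_south S)"
begin

abbreviation strip :: "(real \<times> real) set" where
  "strip \<equiv> {0<..<T} \<times> {0<..}"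

lemma data_AE_bound:
  "AE x in lebesgue_on quadrant. \<bar>u_init S x\<bar> \<le> U"
  "AE x in lebesgue_on strip. \<bar>u_west S x\<bar> \<le> U"
  "AE x in lebesgue_on strip. \<bar>u_south S x\<bar> \<le> U"
  unfolding U_def u_inf_def
  by (rule Linf_norm_AE; use init west south in \<open>auto simp: in_Linf_def le_max_iff_disj\<close>)+

text \<open>The box is a product over velocities, so transport, which assembles components from
  different cells, stays inside; what it inserts at the boundary are equilibria of averages bounded
  by \<open>U\<close>.\<close>

lemma fsol_invariant_box:
  assumes "\<And>j. \<bar>init_avg S h j\<bar> \<le> U"
    and "\<And>n k. n < N \<Longrightarrow> \<bar>bdry_avg S (u_west S) h n k\<bar> \<le> U"
    and "\<And>n k. n < N \<Longrightarrow> \<bar>bdry_avg S (u_south S) h n k\<bar> \<le> U"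
  shows "n \<le> N \<Longrightarrow> invariant_box (fsol S h n j)"
proof (induction n arbitrary: j)
  case 0
  then show ?case using assms(1) invariant_box_feq by (simp add: invariant_box_def)
next
  case (Suc n)
  have R: "relax S (fsol S h n j') i \<in> {feq S i (- U)..feq S i U}" for j' i
    using invariant_box_relax[OF Suc.IH, of j'] Suc.prems by (simp add: invariant_box_def)
  have n: "n < N" using Suc.prems by simp
  show ?case
    unfolding invariant_box_def
  proof
    fix i
    obtain jx jy where j: "j = (jx, jy)" by (cases j)
    show "fsol S h (Suc n) j i \<in> {feq S i (- U)..feq S i U}"
    proof (cases i)
      case (Plus a)
      then show ?thesis unfolding j fsol.simps
        using R[of "(jx - 1, jy)" "Plus AX"] R[of "(jx, jy - 1)" "Plus AY"]
          invariant_box_feq[OF assms(2)[OF n], of "Plus AX" jy] invariant_box_feq[OF assms(3)[OF n], of "Plus AY" jx]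
        by (cases a) (simp_all del: feq.simps relax.simps)
    next
      case (Minus a)
      then show ?thesis unfolding j fsol.simps
        using R[of "(jx + 1, jy)" "Minus AX"] R[of "(jx, jy + 1)" "Minus AY"]
        by (cases a) (simp_all del: feq.simps relax.simps)
    qed (use R j in \<open>simp del: feq.simps relax.simps\<close>)
  qed
qed

lemma data_variation:
  obtains V where "0 \<le> V"
    "\<And>\<psi>. \<psi> \<in> test_fields quadrant \<Longrightarrow> (LINT x:quadrant|lebesgue. u_init S x * divergence \<psi> x) \<le> V"
    "\<And>\<psi>. \<psi> \<in> test_fields strip \<Longrightarrow> (LINT x:strip|lebesgue. u_west S x * divergence \<psi> x) \<le> V"
    "\<And>\<psi>. \<psi> \<in> test_fields strip \<Longrightarrow> (LINT x:strip|lebesgue. u_south S x * divergence \<psi> x) \<le> V"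
proof -
  have tv: "total_variation quadrant (u_init S) < \<infinity>" "total_variation strip (u_west S) < \<infinity>"
    "total_variation strip (u_south S) < \<infinity>"
    using init west south by (auto simp: in_BV_def)
  obtain V0 where V0: "0 \<le> V0" "\<And>\<psi>. \<psi> \<in> test_fields quadrant \<Longrightarrow> (LINT x:quadrant|lebesgue. u_init S x * divergence \<psi> x) \<le> V0"
    by (rule bounded_total_variation[OF tv(1)]) blast
  obtain Vw where Vw: "0 \<le> Vw" "\<And>\<psi>. \<psi> \<in> test_fields strip \<Longrightarrow> (LINT x:strip|lebesgue. u_west S x * divergence \<psi> x) \<le> Vw"
    by (rule bounded_total_variation[OF tv(2)]) blast
  obtain Vs where Vs: "0 \<le> Vs" "\<And>\<psi>. \<psi> \<in> test_fields strip \<Longrightarrow> (LINT x:strip|lebesgue. u_south S x * divergence \<psi> x) \<le> Vs"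
    by (rule bounded_total_variation[OF tv(3)]) blast
  show thesis
    by (rule that[of "V0 + Vw + Vs"])
      (use V0 Vw Vs in \<open>auto intro: order_trans[OF V0(2)] order_trans[OF Vw(2)] order_trans[OF Vs(2)]\<close>)
qed

lemma bv_datum_init:
  assumes "\<And>\<psi>. \<psi> \<in> test_fields quadrant \<Longrightarrow> (LINT x:quadrant|lebesgue. u_init S x * divergence \<psi> x) \<le> V" "0 < h"
  shows "bv_datum quadrant (u_init S) V U h h None"
  using assms init data_AE_bound by unfold_locales (auto simp: in_BV_def quadrant_def)

lemma bv_datum_boundary:
  assumes "\<And>\<psi>. \<psi> \<in> test_fields strip \<Longrightarrow> (LINT x:strip|lebesgue. w x * divergence \<psi> x) \<le> V"
    and "0 < h" and N: "real N * time_step S h = T" and "w = u_west S \<or> w = u_south S"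
  shows "bv_datum strip w V U (time_step S h) h (Some N)"
proof
  show "w absolutely_integrable_on strip" using assms west south by (auto simp: in_BV_def)
  show "AE x in lebesgue_on strip. \<bar>w x\<bar> \<le> U" using assms data_AE_bound by auto
  show "0 < time_step S h" using assms speed by (simp add: time_step_def)
qed (use assms in auto)

lemma init_avg_rect: "init_avg S h (j, k) = rect_integral (u_init S) h h j k / h\<^sup>2"
  by (simp add: init_avg_def rect_integral_def cell_def)

lemma bdry_avg_rect: "bdry_avg S w h n k = rect_integral w (time_step S h) h n k / (time_step S h * h)"
  by (simp add: bdry_avg_def rect_integral_def)

text \<open>Averages divide integrals by \<open>time_step S h * h\<close>. Jumps in time gain one
  time step and jumps in space one \<open>h\<close>, which leaves \<open>V / h\<close> and
  \<open>speed S * V / h\<close>. For the traces all \<open>N\<close> columns are averaged, and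
  these fill the time interval of length \<open>T\<close>.\<close>

lemma boundary_estimates:
  assumes w: "bv_datum strip w V U (time_step S h) h (Some N)"
    and h: "0 < h" and N: "1 \<le> N" "real N * time_step S h = T"
  shows "n < N \<Longrightarrow> \<bar>bdry_avg S w h n k\<bar> \<le> U"
    "(\<Sum>n<N - 1. \<Sum>k<J. \<bar>bdry_avg S w h (Suc n) k - bdry_avg S w h n k\<bar>) \<le> V / h"
    "(\<Sum>n<N. \<Sum>k<J. \<bar>bdry_avg S w h n (Suc k) - bdry_avg S w h n k\<bar>) \<le> speed S * V / h"
    "n < N \<Longrightarrow> (\<Sum>k<J. \<bar>bdry_avg S w h n k\<bar>) \<le> ((LINT x:strip|lebesgue. \<bar>w x\<bar>) / T + V) / h"
proof -
  interpret bv_datum "strip" w V U "time_step S h" h "Some N" by (rule w)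
  let ?\<tau> = "time_step S h" and ?r = "rect_integral w (time_step S h) h"
  have \<tau>: "0 < ?\<tau>" "0 < ?\<tau> * h" using h by auto
  have d: "\<bar>x / (?\<tau> * h) - y / (?\<tau> * h)\<bar> = \<bar>x - y\<bar> / (?\<tau> * h)" "\<bar>x / (?\<tau> * h)\<bar> = \<bar>x\<bar> / (?\<tau> * h)" for x y
    using \<tau> unfolding diff_divide_distrib[symmetric] abs_divide by simp_all
  show "\<bar>bdry_avg S w h n k\<bar> \<le> U" if "n < N"
    using rect_integral_bound[of n k] that \<tau> unfolding bdry_avg_rect d by (simp add: pos_divide_le_eq)
  have "(\<Sum>n<N - 1. \<Sum>k<J. \<bar>bdry_avg S w h (Suc n) k - bdry_avg S w h n k\<bar>)
    = (\<Sum>n<N - 1. \<Sum>k<J. \<bar>?r (Suc n) k - ?r n k\<bar>) / (?\<tau> * h)"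
    unfolding bdry_avg_rect d by (simp only: sum_divide_distrib)
  also have "\<dots> \<le> (?\<tau> * V) / (?\<tau> * h)"
    using \<tau> N by (intro divide_right_mono rect_jumps_fst) auto
  finally show "(\<Sum>n<N - 1. \<Sum>k<J. \<bar>bdry_avg S w h (Suc n) k - bdry_avg S w h n k\<bar>) \<le> V / h"
    using \<tau> by simp
  have "(\<Sum>n<N. \<Sum>k<J. \<bar>bdry_avg S w h n (Suc k) - bdry_avg S w h n k\<bar>)
    = (\<Sum>n<N. \<Sum>k<J. \<bar>?r n (Suc k) - ?r n k\<bar>) / (?\<tau> * h)"
    unfolding bdry_avg_rect d by (simp only: sum_divide_distrib)
  also have "\<dots> \<le> (h * V) / (?\<tau> * h)"
    using \<tau> N by (intro divide_right_mono rect_jumps_snd) auto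
  also have "\<dots> = speed S * V / h" using h speed by (simp add: time_step_def)
  finally show "(\<Sum>n<N. \<Sum>k<J. \<bar>bdry_avg S w h n (Suc k) - bdry_avg S w h n k\<bar>) \<le> speed S * V / h" .
  show "(\<Sum>k<J. \<bar>bdry_avg S w h n k\<bar>) \<le> ((LINT x:strip|lebesgue. \<bar>w x\<bar>) / T + V) / h" if "n < N"
  proof -
    have "(\<Sum>k<J. \<bar>bdry_avg S w h n k\<bar>) = (\<Sum>k<J. \<bar>?r n k\<bar>) / (?\<tau> * h)"
      unfolding bdry_avg_rect d by (simp only: sum_divide_distrib)
    also have "\<dots> = (real N * (\<Sum>k<J. \<bar>?r n k\<bar>)) / (real N * ?\<tau> * h)" using N(1) by simp
    also have "\<dots> \<le> ((LINT x:strip|lebesgue. \<bar>w x\<bar>) + real N * (?\<tau> * V)) / (real N * ?\<tau> * h)"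
      using that h \<tau>(1) by (intro divide_right_mono rect_trace mult_nonneg_nonneg) auto
    also have "\<dots> = ((LINT x:strip|lebesgue. \<bar>w x\<bar>) + T * V) / (T * h)"
      using N(2) by (simp add: mult.assoc[symmetric])
    also have "\<dots> = ((LINT x:strip|lebesgue. \<bar>w x\<bar>) / T + V) / h"
      using T h by (simp add: field_simps)
    finally show ?thesis .
  qed
qed

text \<open>The traces are averaged over the first \<open>N\<close> cells, a layer of width
  \<open>T * speed S\<close> whatever the mesh. This is how the number of time steps enters an
  estimate of the initial data.\<close>

lemma init_estimates:
  assumes w: "bv_datum quadrant (u_init S) V U h h None"
    and h: "0 < h" and N: "1 \<le> N" "real N * time_step S h = T"
  shows "\<bar>init_avg S h j\<bar> \<le> U"
    "box_sum J (\<lambda>j k. \<bar>init_avg S h (Suc j, k) - init_avg S h (j, k)\<bar>) \<le> V / h"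
    "box_sum J (\<lambda>j k. \<bar>init_avg S h (j, Suc k) - init_avg S h (j, k)\<bar>) \<le> V / h"
    "(\<Sum>k<J. \<bar>init_avg S h (0, k)\<bar>) \<le> ((LINT x:quadrant|lebesgue. \<bar>u_init S x\<bar>) / (T * speed S) + V) / h"
    "(\<Sum>j<J. \<bar>init_avg S h (j, 0)\<bar>) \<le> ((LINT x:quadrant|lebesgue. \<bar>u_init S x\<bar>) / (T * speed S) + V) / h"
proof -
  interpret bv_datum quadrant "u_init S" V U h h None by (rule w)
  let ?r = "rect_integral (u_init S) h h"
  let ?I = "LINT x:quadrant|lebesgue. \<bar>u_init S x\<bar>"
  have d: "\<bar>x / h\<^sup>2 - y / h\<^sup>2\<bar> = \<bar>x - y\<bar> / h\<^sup>2" "\<bar>x / h\<^sup>2\<bar> = \<bar>x\<bar> / h\<^sup>2" for x y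
    unfolding diff_divide_distrib[symmetric] abs_divide by simp_all
  have Nh: "real N * h = T * speed S" using N(2) speed by (simp add: time_step_def field_simps)
  show "\<bar>init_avg S h j\<bar> \<le> U"
    using rect_integral_bound[of "fst j" "snd j"] h init_avg_rect[of h "fst j" "snd j"]
    by (simp add: d pos_divide_le_eq power2_eq_square)
  have vx: "(\<Sum>j<M. \<Sum>k<J. \<bar>init_avg S h (Suc j, k) - init_avg S h (j, k)\<bar>) \<le> V / h" for M J
  proof -
    have "(\<Sum>j<M. \<Sum>k<J. \<bar>init_avg S h (Suc j, k) - init_avg S h (j, k)\<bar>)
      = (\<Sum>j<M. \<Sum>k<J. \<bar>?r (Suc j) k - ?r j k\<bar>) / h\<^sup>2"
      unfolding init_avg_rect d by (simp only: sum_divide_distrib)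
    also have "\<dots> \<le> (h * V) / h\<^sup>2" by (intro divide_right_mono rect_jumps_fst) auto
    also have "\<dots> = V / h" using h by (simp add: power2_eq_square)
    finally show ?thesis .
  qed
  have vy: "(\<Sum>j<M. \<Sum>k<J. \<bar>init_avg S h (j, Suc k) - init_avg S h (j, k)\<bar>) \<le> V / h" for M J
  proof -
    have "(\<Sum>j<M. \<Sum>k<J. \<bar>init_avg S h (j, Suc k) - init_avg S h (j, k)\<bar>)
      = (\<Sum>j<M. \<Sum>k<J. \<bar>?r j (Suc k) - ?r j k\<bar>) / h\<^sup>2"
      unfolding init_avg_rect d by (simp only: sum_divide_distrib)
    also have "\<dots> \<le> (h * V) / h\<^sup>2" by (intro divide_right_mono rect_jumps_snd) auto
    also have "\<dots> = V / h" using h by (simp add: power2_eq_square)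
    finally show ?thesis .
  qed
  have l1: "(\<Sum>j<M. \<Sum>k<J. \<bar>init_avg S h (j, k)\<bar>) \<le> ?I / h\<^sup>2" for M J
  proof -
    have "(\<Sum>j<M. \<Sum>k<J. \<bar>init_avg S h (j, k)\<bar>) = (\<Sum>j<M. \<Sum>k<J. \<bar>?r j k\<bar>) / h\<^sup>2"
      unfolding init_avg_rect d by (simp only: sum_divide_distrib)
    also have "\<dots> \<le> ?I / h\<^sup>2" by (intro divide_right_mono rect_l1_all) auto
    finally show ?thesis .
  qed
  show "box_sum J (\<lambda>j k. \<bar>init_avg S h (Suc j, k) - init_avg S h (j, k)\<bar>) \<le> V / h"
    "box_sum J (\<lambda>j k. \<bar>init_avg S h (j, Suc k) - init_avg S h (j, k)\<bar>) \<le> V / h"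
    unfolding box_sum_def by (rule vx vy)+
  have tr: "X \<le> (?I / (T * speed S) + V) / h" if X: "real N * X \<le> ?I / h\<^sup>2 + real N * (V / h)" for X
  proof -
    have "X \<le> (?I / h\<^sup>2 + real N * (V / h)) / real N" using X N(1) by (simp add: pos_le_divide_eq mult.commute)
    also have "\<dots> = ?I / (real N * h * h) + V / h"
      using N(1) by (simp add: add_divide_distrib power2_eq_square mult.commute)
    also have "\<dots> = (?I / (T * speed S) + V) / h" unfolding Nh by (simp add: add_divide_distrib)
    finally show ?thesis .
  qed
  show "(\<Sum>k<J. \<bar>init_avg S h (0, k)\<bar>) \<le> (?I / (T * speed S) + V) / h"
  proof (rule tr)
    have "real N * (\<Sum>k<J. \<bar>init_avg S h (0, k)\<bar>)
      \<le> (\<Sum>k<J. (\<Sum>a<N. \<bar>init_avg S h (a, k)\<bar>) + real N * (\<Sum>a<N - 1. \<bar>init_avg S h (Suc a, k) - init_avg S h (a, k)\<bar>))"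
      unfolding sum_distrib_left[of "real N" "\<lambda>k. \<bar>init_avg S h (0, k)\<bar>"] using N(1) by (intro sum_mono trace_le) auto
    also have "\<dots> = (\<Sum>a<N. \<Sum>k<J. \<bar>init_avg S h (a, k)\<bar>)
      + real N * (\<Sum>a<N - 1. \<Sum>k<J. \<bar>init_avg S h (Suc a, k) - init_avg S h (a, k)\<bar>)"
      unfolding sum.distrib sum_distrib_left[symmetric] by (subst sum.swap, subst (2) sum.swap) (rule refl)
    also have "\<dots> \<le> ?I / h\<^sup>2 + real N * (V / h)" by (intro add_mono mult_left_mono l1 vx) simp
    finally show "real N * (\<Sum>k<J. \<bar>init_avg S h (0, k)\<bar>) \<le> ?I / h\<^sup>2 + real N * (V / h)" .
  qed
  show "(\<Sum>j<J. \<bar>init_avg S h (j, 0)\<bar>) \<le> (?I / (T * speed S) + V) / h"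
  proof (rule tr)
    have "real N * (\<Sum>j<J. \<bar>init_avg S h (j, 0)\<bar>)
      \<le> (\<Sum>j<J. (\<Sum>a<N. \<bar>init_avg S h (j, a)\<bar>) + real N * (\<Sum>a<N - 1. \<bar>init_avg S h (j, Suc a) - init_avg S h (j, a)\<bar>))"
      unfolding sum_distrib_left[of "real N" "\<lambda>j. \<bar>init_avg S h (j, 0)\<bar>"] using N(1) by (intro sum_mono trace_le) auto
    also have "\<dots> = (\<Sum>j<J. \<Sum>a<N. \<bar>init_avg S h (j, a)\<bar>)
      + real N * (\<Sum>j<J. \<Sum>a<N - 1. \<bar>init_avg S h (j, Suc a) - init_avg S h (j, a)\<bar>)"
      unfolding sum.distrib sum_distrib_left[symmetric] by (rule refl)
    also have "\<dots> \<le> ?I / h\<^sup>2 + real N * (V / h)" by (intro add_mono mult_left_mono l1 vy) simp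
    finally show "real N * (\<Sum>j<J. \<bar>init_avg S h (j, 0)\<bar>) \<le> ?I / h\<^sup>2 + real N * (V / h)" .
  qed
qed

text \<open>The point is uniformity: \<open>C\<close> is built from the data, \<open>T\<close> and
  the speed, and the mesh enters only through \<open>C / h\<close>.\<close>

theorem uniform_grid_scheme:
  obtains C where "0 \<le> C" "\<And>h N. 0 < h \<Longrightarrow> 1 \<le> N \<Longrightarrow> real N * time_step S h = T \<Longrightarrow>
     grid_scheme (feq S) (relax S) U N (C / h) (\<lambda>n j k. fsol S h n (j, k))
       (bdry_avg S (u_west S) h) (bdry_avg S (u_south S) h) (\<lambda>j k. init_avg S h (j, k))"
proof -
  obtain V where V: "0 \<le> V"
    "\<And>\<psi>. \<psi> \<in> test_fields quadrant \<Longrightarrow> (LINT x:quadrant|lebesgue. u_init S x * divergence \<psi> x) \<le> V"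
    "\<And>\<psi>. \<psi> \<in> test_fields strip \<Longrightarrow> (LINT x:strip|lebesgue. u_west S x * divergence \<psi> x) \<le> V"
    "\<And>\<psi>. \<psi> \<in> test_fields strip \<Longrightarrow> (LINT x:strip|lebesgue. u_south S x * divergence \<psi> x) \<le> V"
    by (rule data_variation) blast
  define Ii where "Ii = (LINT x:quadrant|lebesgue. \<bar>u_init S x\<bar>) / (T * speed S)"
  define Iw where "Iw = (LINT x:strip|lebesgue. \<bar>u_west S x\<bar>) / T"
  define Is where "Is = (LINT x:strip|lebesgue. \<bar>u_south S x\<bar>) / T"
  have I: "0 \<le> Ii" "0 \<le> Iw" "0 \<le> Is"
    unfolding Ii_def Iw_def Is_def set_lebesgue_integral_def using T speed
    by (auto intro!: divide_nonneg_pos Bochner_Integration.integral_nonneg)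
  define C where "C = T * speed S * U + (1 + speed S) * V + Ii + Iw + Is"
  have p: "0 \<le> T * speed S * U" "0 \<le> speed S * V" using T speed U_nonneg V(1) by auto
  have C: "T * speed S * U \<le> C" "V \<le> C" "speed S * V \<le> C" "Ii + V \<le> C" "Iw + V \<le> C" "Is + V \<le> C"
    using p I V(1) unfolding C_def distrib_right by linarith+
  have "grid_scheme (feq S) (relax S) U N (C / h) (\<lambda>n j k. fsol S h n (j, k))
       (bdry_avg S (u_west S) h) (bdry_avg S (u_south S) h) (\<lambda>j k. init_avg S h (j, k))"
    if h: "0 < h" and N: "1 \<le> N" "real N * time_step S h = T" for h N
  proof -
    note le = order_trans[OF _ divide_right_mono[OF _ less_imp_le[OF h]]]
    note bi = bv_datum_init[OF V(2) h]
    note bw = bv_datum_boundary[OF V(3) h N(2), simplified]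
    note bs = bv_datum_boundary[OF V(4) h N(2), simplified]
    note ei = init_estimates[OF bi h N]
    note ew = boundary_estimates[OF bw h N]
    note es = boundary_estimates[OF bs h N]
    note inv = fsol_invariant_box[of h N, OF ei(1) ew(1) es(1)]
    show ?thesis
    proof
      show "(\<Sum>i\<in>UNIV. feq S i v) = v" for v by (rule feq_sum)
      show "\<bar>v\<bar> \<le> U \<Longrightarrow> \<bar>v'\<bar> \<le> U \<Longrightarrow> (\<Sum>i\<in>UNIV. \<bar>feq S i v - feq S i v'\<bar>) = \<bar>v - v'\<bar>" for v v'
        by (rule feq_l1_isometry)
      show "feq S i 0 = 0" for i by (rule feq_0)
      show "relax S (\<lambda>i. feq S i v) i = feq S i v" for i v by (rule relax_feq)
      show "\<bar>\<Sum>i\<in>UNIV. g i\<bar> \<le> U \<Longrightarrow> \<bar>\<Sum>i\<in>UNIV. g' i\<bar> \<le> U \<Longrightarrow>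
        (\<Sum>i\<in>UNIV. \<bar>relax S g i - relax S g' i\<bar>) \<le> (\<Sum>i\<in>UNIV. \<bar>g i - g' i\<bar>)" for g g'
        by (rule relax_contraction)
      show "n \<le> N \<Longrightarrow> \<bar>\<Sum>i\<in>UNIV. fsol S h n (j, k) i\<bar> \<le> U" for n j k
        by (intro invariant_box_sum inv)
      \<comment> \<open>\<open>N\<close> steps of size \<open>h / speed S\<close> fill
        \<open>T\<close>, so the corner errors amount to a multiple of
        \<open>T * speed S * U / h\<close>.\<close>
      have "real N * h = T * speed S" using N(2) speed by (simp add: time_step_def field_simps)
      then have "real N * U * h = T * speed S * U" by (metis mult.assoc mult.commute)
      then show "real N * U \<le> C / h" using C(1) by (simp only: pos_le_divide_eq[OF h])
      show "box_sum J (\<lambda>j k. \<bar>init_avg S h (Suc j, k) - init_avg S h (j, k)\<bar>) \<le> C / h"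
        "box_sum J (\<lambda>j k. \<bar>init_avg S h (j, Suc k) - init_avg S h (j, k)\<bar>) \<le> C / h" for J
        using le[OF ei(2) C(2)] le[OF ei(3) C(2)] by blast+
      show "(\<Sum>k<J. \<bar>init_avg S h (0, k)\<bar>) \<le> C / h" "(\<Sum>j<J. \<bar>init_avg S h (j, 0)\<bar>) \<le> C / h" for J
        using le[OF ei(4)[folded Ii_def] C(4)] le[OF ei(5)[folded Ii_def] C(4)] by blast+
      show "(\<Sum>n<N - 1. \<Sum>k<J. \<bar>bdry_avg S (u_west S) h (Suc n) k - bdry_avg S (u_west S) h n k\<bar>) \<le> C / h"
        "(\<Sum>n<N - 1. \<Sum>k<J. \<bar>bdry_avg S (u_south S) h (Suc n) k - bdry_avg S (u_south S) h n k\<bar>) \<le> C / h" for J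
        using le[OF ew(2) C(2)] le[OF es(2) C(2)] by blast+
      show "(\<Sum>n<N. \<Sum>k<J. \<bar>bdry_avg S (u_west S) h n (Suc k) - bdry_avg S (u_west S) h n k\<bar>) \<le> C / h"
        "(\<Sum>n<N. \<Sum>k<J. \<bar>bdry_avg S (u_south S) h n (Suc k) - bdry_avg S (u_south S) h n k\<bar>) \<le> C / h" for J
        using le[OF ew(3) C(3)] le[OF es(3) C(3)] by blast+
      show "n < N \<Longrightarrow> (\<Sum>k<J. \<bar>bdry_avg S (u_west S) h n k\<bar>) \<le> C / h"
        "n < N \<Longrightarrow> (\<Sum>k<J. \<bar>bdry_avg S (u_south S) h n k\<bar>) \<le> C / h" for n J
        using le[OF ew(4)[folded Iw_def] C(5)] le[OF es(4)[folded Is_def] C(6)] by blast+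
    qed (use ew(1) es(1) U_nonneg in \<open>simp_all del: relax.simps feq.simps\<close>)
  qed
  moreover have "0 \<le> C" using C(2) V(1) by simp
  ultimately show thesis using that by blast
qed

end

text \<open>Bounding the essential supremum by \<open>esssup_I\<close> requires the inner integral
  to be measurable in \<open>t\<close>. This comes from the jointly Borel representative
  \<open>F\<close>, which at each \<open>t\<close> agrees with \<open>g\<close> almost everywhere on
  the quadrant.\<close>

lemma LinfL1_norm_le:
  assumes F: "(\<lambda>(t, x). F t x) \<in> borel_measurable (borel \<Otimes>\<^sub>M borel)"
    and eq: "\<And>t. t \<in> {0<..<T} \<Longrightarrow> AE x in lborel. x \<in> quadrant \<longrightarrow> g t x = F t x"
    and le: "\<And>t. t \<in> {0<..<T} \<Longrightarrow> (\<integral>\<^sup>+ x. ennreal \<bar>F t x\<bar> * indicator quadrant x \<partial>lborel) \<le> c"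
  shows "LinfL1_norm T g \<le> c"
proof -
  have Q: "quadrant \<in> sets borel" unfolding quadrant_def borel_prod[symmetric] by auto
  have QL: "quadrant \<inter> space lebesgue \<in> sets lebesgue" using Q by auto
  have F': "(\<lambda>(t, x). ennreal \<bar>F t x\<bar> * indicator quadrant x) \<in> borel_measurable (borel \<Otimes>\<^sub>M lborel)"
  proof -
    have [measurable]: "(\<lambda>z. F (fst z) (snd z)) \<in> borel_measurable (borel \<Otimes>\<^sub>M lborel)"
      using F by (simp add: case_prod_unfold)
    show ?thesis using Q unfolding case_prod_unfold by measurable
  qed
  define \<Phi> where "\<Phi> t = (\<integral>\<^sup>+ x. ennreal \<bar>F t x\<bar> * indicator quadrant x \<partial>lborel)" for t
  have "\<Phi> \<in> borel_measurable borel"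
    using lborel.borel_measurable_nn_integral[OF F'] by (simp add: \<Phi>_def[abs_def])
  then have "\<Phi> \<in> borel_measurable lborel" by simp
  then have \<Phi>: "\<Phi> \<in> borel_measurable (lebesgue_on {0<..<T})"
    by (intro measurable_restrict_space1 measurable_completion)
  have inner: "(\<integral>\<^sup>+ x. ennreal \<bar>g t x\<bar> \<partial>lebesgue_on quadrant) = \<Phi> t" if "t \<in> {0<..<T}" for t
  proof -
    have "(\<integral>\<^sup>+ x. ennreal \<bar>g t x\<bar> \<partial>lebesgue_on quadrant) = (\<integral>\<^sup>+ x. ennreal \<bar>g t x\<bar> * indicator quadrant x \<partial>lebesgue)"
      by (rule nn_integral_restrict_space[OF QL])
    also have "\<dots> = (\<integral>\<^sup>+ x. ennreal \<bar>g t x\<bar> * indicator quadrant x \<partial>lborel)" by (rule nn_integral_completion)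
    also have "\<dots> = \<Phi> t"
      unfolding \<Phi>_def by (rule nn_integral_cong_AE, use eq[OF that] in eventually_elim) (auto simp: indicator_def)
    finally show ?thesis .
  qed
  show ?thesis
    unfolding LinfL1_norm_def
  proof (rule esssup_I)
    show "(\<lambda>t. \<integral>\<^sup>+ x. ennreal \<bar>g t x\<bar> \<partial>lebesgue_on quadrant) \<in> borel_measurable (lebesgue_on {0<..<T})"
      by (rule measurable_cong[THEN iffD2, OF _ \<Phi>]) (simp add: inner)
    show "AE t in lebesgue_on {0<..<T}. (\<integral>\<^sup>+ x. ennreal \<bar>g t x\<bar> \<partial>lebesgue_on quadrant) \<le> c"
      by (rule AE_I2) (use le in \<open>simp add: inner \<Phi>_def\<close>)
  qed
qed

section \<open>Reconstructions as step functions\<close>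

lemma AE_off_grid: "AE x in lborel. \<forall>m::nat. fst x \<noteq> real m * h \<and> snd x \<noteq> real m * h"
  for h :: real
proof -
  have "AE x::real \<times> real in lebesgue. x \<bullet> b \<noteq> c" if "b \<in> Basis" for b c
    using AE_not_in[of "{x. x \<bullet> b = c}" lebesgue] negligible_standard_hyperplane[OF that, of c]
    by (simp add: negligible_iff_null_sets)
  then have "AE x::real \<times> real in lborel. x \<bullet> b \<noteq> c" if "b \<in> Basis" for b c
    using that by (simp add: AE_completion_iff)
  from this[of "(1,0)"] this[of "(0,1)"] have "AE x in lborel. fst x \<noteq> c \<and> snd x \<noteq> c" for c :: real
    by (auto simp: Basis_prod_def inner_prod_def)
  then show ?thesis by (subst AE_all_countable) auto
qed

text \<open>Off the grid lines, a null set, a point of the quadrant lies in exactly one open cell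
  and in the half-open cell of the same index, so the sum over cells has one nonzero term; so has
  the sum over levels.\<close>

lemma reconstruct_AE:
  assumes h: "0 < h" and \<tau>: "0 < time_step S h" and t: "0 \<le> t" and n: "nat \<lfloor>t / time_step S h\<rfloor> < N"
  shows "AE x in lborel. x \<in> quadrant \<longrightarrow>
    reconstruct S h N v t x = step_fun h (\<lambda>j k. v (nat \<lfloor>t / time_step S h\<rfloor>) (j, k)) x"
  using AE_off_grid[of h]
proof eventually_elim
  case (elim x)
  show ?case
  proof
    assume x: "x \<in> quadrant"
    then have x0: "0 \<le> fst x" "0 \<le> snd x" by (auto simp: quadrant_def)
    define j where "j = (nat \<lfloor>fst x / h\<rfloor>, nat \<lfloor>snd x / h\<rfloor>)"
    have fl: "fst x \<in> {real (fst j) * h ..< (real (fst j) + 1) * h}" "snd x \<in> {real (snd j) * h ..< (real (snd j) + 1) * h}"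
      using floor_div_iff[OF h, of "fst x"] floor_div_iff[OF h, of "snd x"] x0 by (auto simp: j_def)
    have "fst x \<noteq> real (fst j) * h" "snd x \<noteq> real (snd j) * h" using elim by blast+
    then have xj: "x \<in> cell h j" using fl by (cases x) (auto simp: cell_def)
    have other: "x \<notin> cell h i" if "i \<noteq> j" for i
    proof
      assume "x \<in> cell h i"
      then have "fst x \<in> {real (fst i) * h ..< (real (fst i) + 1) * h}" "snd x \<in> {real (snd i) * h ..< (real (snd i) + 1) * h}"
        by (auto simp: cell_def)
      then have "i = j"
        using floor_div_iff[OF h, of "fst x" "fst i"] floor_div_iff[OF h, of "snd x" "snd i"] by (auto simp: j_def)
      then show False using that by simp
    qed
    have space: "(\<Sum>\<^sub>\<infinity>i\<in>UNIV. v n i * indicat_real (cell h i) x) = v n j" for n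
    proof -
      have "(\<Sum>\<^sub>\<infinity>i\<in>UNIV. v n i * indicat_real (cell h i) x) = (\<Sum>\<^sub>\<infinity>i\<in>{j}. v n i * indicat_real (cell h i) x)"
        by (rule infsum_cong_neutral) (use other in auto)
      then show ?thesis using xj by simp
    qed
    have time: "indicat_real {real n * time_step S h ..< (real n + 1) * time_step S h} t
      = (if n = nat \<lfloor>t / time_step S h\<rfloor> then 1 else 0)" for n
      using floor_div_iff[OF \<tau>, of t n] t by (auto simp: indicator_def)
    show "reconstruct S h N v t x = step_fun h (\<lambda>j k. v (nat \<lfloor>t / time_step S h\<rfloor>) (j, k)) x"
      unfolding reconstruct_def space time using n x0
      by (simp add: step_fun_def j_def if_distrib[of "\<lambda>z. _ * z"] cong: if_cong)
  qed
qed

section \<open>Uniform smallness far away\<close>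

context lbm_bv_data
begin

lemma integral_tail_ge:
  fixes u :: "real \<times> real \<Rightarrow> real"
  assumes "u absolutely_integrable_on \<Omega>" "\<Omega> \<in> sets lebesgue" "0 < \<epsilon>"
  shows "\<exists>X\<ge>0::real. (LINT x:{x\<in>\<Omega>. X \<le> x \<bullet> d}|lebesgue. \<bar>u x\<bar>) \<le> \<epsilon> \<and> u absolutely_integrable_on {x\<in>\<Omega>. X \<le> x \<bullet> d}"
  by (rule integral_tail[OF assms, of d]) (auto intro: less_imp_le)

text \<open>A point is influenced only by data within distance \<open>T * speed S\<close> along each
  axis, so tails of the data beyond \<open>X0\<close> control the tails of all solutions. A tail in
  x draws on the initial and the southern data, a tail in y on the initial and the western data; a
  quarter of \<open>\<epsilon>\<close> for each of the four gives the claim.\<close>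

lemma uniform_tail:
  assumes \<epsilon>: "0 < \<epsilon>"
  obtains X where "\<And>h N n. 0 < h \<Longrightarrow> 1 \<le> N \<Longrightarrow> real N * time_step S h = T \<Longrightarrow> n < N \<Longrightarrow>
     (\<integral>\<^sup>+ x. indicator {x. X \<le> fst x \<or> X \<le> snd x} x * ennreal \<bar>step_fun h (\<lambda>j k. usol S h n (j, k)) x\<bar> \<partial>lborel)
       \<le> ennreal \<epsilon>"
proof -
  obtain C where grid: "\<And>h N. 0 < h \<Longrightarrow> 1 \<le> N \<Longrightarrow> real N * time_step S h = T \<Longrightarrow>
     grid_scheme (feq S) (relax S) U N (C / h) (\<lambda>n j k. fsol S h n (j, k))
       (bdry_avg S (u_west S) h) (bdry_avg S (u_south S) h) (\<lambda>j k. init_avg S h (j, k))"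
    by (rule uniform_grid_scheme) blast
  obtain V where V: "0 \<le> V"
    "\<And>\<psi>. \<psi> \<in> test_fields quadrant \<Longrightarrow> (LINT x:quadrant|lebesgue. u_init S x * divergence \<psi> x) \<le> V"
    "\<And>\<psi>. \<psi> \<in> test_fields strip \<Longrightarrow> (LINT x:strip|lebesgue. u_west S x * divergence \<psi> x) \<le> V"
    "\<And>\<psi>. \<psi> \<in> test_fields strip \<Longrightarrow> (LINT x:strip|lebesgue. u_south S x * divergence \<psi> x) \<le> V"
    by (rule data_variation) blast
  have "open quadrant" "open strip" unfolding quadrant_def by (auto intro: open_Times)
  then have meas: "quadrant \<in> sets lebesgue" "strip \<in> sets lebesgue"
    by (auto intro!: sets_completionI_sets simp: borel_open)
  have ai: "u_init S absolutely_integrable_on quadrant" "u_west S absolutely_integrable_on strip"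
    "u_south S absolutely_integrable_on strip" using init west south by (auto simp: in_BV_def)
  \<comment> \<open>Boundary averages carry \<open>1 / (time_step S h * h)\<close>, so the cell area
    \<open>h\<^sup>2\<close> leaves a factor \<open>speed S\<close>, which is divided out
    here.\<close>
  have e: "0 < \<epsilon> / 4" "0 < \<epsilon> / (4 * speed S)" using \<epsilon> speed by auto
  obtain X1 where X1: "0 \<le> X1" "(LINT x:{x\<in>quadrant. X1 \<le> x \<bullet> (1,0)}|lebesgue. \<bar>u_init S x\<bar>) \<le> \<epsilon> / 4"
      "u_init S absolutely_integrable_on {x\<in>quadrant. X1 \<le> x \<bullet> (1,0)}"
    using integral_tail_ge[OF ai(1) meas(1) e(1), of "(1,0)"] by blast
  obtain X2 where X2: "0 \<le> X2" "(LINT x:{x\<in>quadrant. X2 \<le> x \<bullet> (0,1)}|lebesgue. \<bar>u_init S x\<bar>) \<le> \<epsilon> / 4"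
      "u_init S absolutely_integrable_on {x\<in>quadrant. X2 \<le> x \<bullet> (0,1)}"
    using integral_tail_ge[OF ai(1) meas(1) e(1), of "(0,1)"] by blast
  obtain X3 where X3: "0 \<le> X3" "(LINT x:{x\<in>strip. X3 \<le> x \<bullet> (0,1)}|lebesgue. \<bar>u_west S x\<bar>) \<le> \<epsilon> / (4 * speed S)"
      "u_west S absolutely_integrable_on {x\<in>strip. X3 \<le> x \<bullet> (0,1)}"
    using integral_tail_ge[OF ai(2) meas(2) e(2), of "(0,1)"] by blast
  obtain X4 where X4: "0 \<le> X4" "(LINT x:{x\<in>strip. X4 \<le> x \<bullet> (0,1)}|lebesgue. \<bar>u_south S x\<bar>) \<le> \<epsilon> / (4 * speed S)"
      "u_south S absolutely_integrable_on {x\<in>strip. X4 \<le> x \<bullet> (0,1)}"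
    using integral_tail_ge[OF ai(3) meas(2) e(2), of "(0,1)"] by blast
  define X0 where "X0 = max (max X1 X2) (max X3 X4)"
  have X0: "0 \<le> X0" "X1 \<le> X0" "X2 \<le> X0" "X3 \<le> X0" "X4 \<le> X0" using X1 by (auto simp: X0_def)
  show thesis
  proof (rule that[of "X0 + T * speed S"])
    fix h N n assume h: "0 < h" and N: "1 \<le> N" "real N * time_step S h = T" and n: "n < N"
    interpret grid_scheme "feq S" "relax S" U N "C / h" "\<lambda>n j k. fsol S h n (j, k)"
      "bdry_avg S (u_west S) h" "bdry_avg S (u_south S) h" "\<lambda>j k. init_avg S h (j, k)"
      by (rule grid[OF h N])
    interpret i: bv_datum quadrant "u_init S" V U h h None by (rule bv_datum_init[OF V(2) h])
    interpret w: bv_datum strip "u_west S" V U "time_step S h" h "Some N"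
      by (rule bv_datum_boundary[OF V(3) h N(2)]) auto
    interpret s: bv_datum strip "u_south S" V U "time_step S h" h "Some N"
      by (rule bv_datum_boundary[OF V(4) h N(2)]) auto
    let ?\<tau> = "time_step S h"
    have \<tau>: "0 < ?\<tau>" by (rule w.h(1))
    define a where "a = nat \<lceil>X0 / h\<rceil>"
    have "X0 / h \<le> real a" "real a \<le> X0 / h + 1" using X0(1) h by (auto simp: a_def)
    then have a: "X0 \<le> real a * h" "real a * h \<le> X0 + h"
      using h mult_right_mono[of "real a" "X0 / h + 1" h] by (auto simp: pos_divide_le_eq distrib_right)
    have above: "X0 < s" if "a \<le> m" "real m * h < s" for m :: nat and s
      using a(1) that mult_right_mono[of "real a" "real m" h] h by linarith
    have subx: "{real j * h<..<(real j + 1) * h} \<times> B \<subseteq> {x \<in> \<Omega>. X \<le> x \<bullet> (1,0)}"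
      if "{real j * h<..<(real j + 1) * h} \<times> B \<subseteq> \<Omega>" "X \<le> X0" "a \<le> j" for j X \<Omega> and B :: "real set"
    proof
      fix x assume x: "x \<in> {real j * h<..<(real j + 1) * h} \<times> B"
      then have "X0 < fst x" by (intro above[OF that(3)]) auto
      then show "x \<in> {x \<in> \<Omega>. X \<le> x \<bullet> (1,0)}" using x that by (auto simp: inner_prod_def)
    qed
    have suby: "B \<times> {real k * h<..<(real k + 1) * h} \<subseteq> {x \<in> \<Omega>. X \<le> x \<bullet> (0,1)}"
      if "B \<times> {real k * h<..<(real k + 1) * h} \<subseteq> \<Omega>" "X \<le> X0" "a \<le> k" for k X \<Omega> and B :: "real set"
    proof
      fix x assume x: "x \<in> B \<times> {real k * h<..<(real k + 1) * h}"
      then have "X0 < snd x" by (intro above[OF that(3)]) auto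
      then show "x \<in> {x \<in> \<Omega>. X \<le> x \<bullet> (0,1)}" using x that by (auto simp: inner_prod_def)
    qed
    have initc: "box_sum J (\<lambda>j k. if P j k then \<bar>init_avg S h (j, k)\<bar> else 0)
      = box_sum J (\<lambda>j k. if P j k then \<bar>rect_integral (u_init S) h h j k\<bar> else 0) / h\<^sup>2" for J P
      unfolding box_sum_def init_avg_rect sum_divide_distrib by (intro sum.cong refl) auto
    have bdc: "h\<^sup>2 * (\<Sum>m<n. \<Sum>k<J. if a \<le> k then \<bar>bdry_avg S g h m k\<bar> else 0)
      = speed S * (\<Sum>m<n. \<Sum>k<J. if a \<le> k then \<bar>rect_integral g ?\<tau> h m k\<bar> else 0)" for J g
    proof -
      have "h\<^sup>2 * (if a \<le> k then \<bar>bdry_avg S g h m k\<bar> else 0)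
        = speed S * (if a \<le> k then \<bar>rect_integral g ?\<tau> h m k\<bar> else 0)" for m k
        using h speed by (auto simp: bdry_avg_rect time_step_def power2_eq_square abs_mult field_simps)
      then show ?thesis by (simp only: sum_distrib_left)
    qed
    define gx gy where "gx j k = (if a + n \<le> j then \<bar>usol S h n (j, k)\<bar> else 0)"
      and "gy j k = (if a + n \<le> k then \<bar>usol S h n (j, k)\<bar> else 0)" for j k
    have gx: "h\<^sup>2 * box_sum J gx \<le> \<epsilon> / 2" for J
    proof -
      have "box_sum (J + n) (\<lambda>j k. if a \<le> j then \<bar>rect_integral (u_init S) h h j k\<bar> else 0) \<le> \<epsilon> / 4"
        unfolding box_sum_def
        by (rule order_trans[OF i.rect_l1[OF _ X1(3)] X1(2)], simp,
            rule subx[OF i.rect_subset X0(2)], simp)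
      then have 1: "h\<^sup>2 * box_sum (J + n) (\<lambda>j k. if a \<le> j then \<bar>init_avg S h (j, k)\<bar> else 0) \<le> \<epsilon> / 4"
        using h by (simp add: initc)
      have "(\<Sum>m<n. \<Sum>k<J + n. if a \<le> k then \<bar>rect_integral (u_south S) ?\<tau> h m k\<bar> else 0) \<le> \<epsilon> / (4 * speed S)"
        by (rule order_trans[OF s.rect_l1[OF _ X4(3)] X4(2)], use n in simp,
            rule suby[OF s.rect_subset X0(5)], use n in simp)
      then have "h\<^sup>2 * (\<Sum>m<n. \<Sum>k<J + n. if a \<le> k then \<bar>bdry_avg S (u_south S) h m k\<bar> else 0) \<le> \<epsilon> / 4"
        using speed by (simp add: bdc pos_le_divide_eq mult.commute)
      moreover have "h\<^sup>2 * box_sum J gx \<le> h\<^sup>2 * (box_sum (J + n) (\<lambda>j k. if a \<le> j then \<bar>init_avg S h (j, k)\<bar> else 0)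
         + (\<Sum>m<n. \<Sum>j<J + n. if a \<le> j then \<bar>bdry_avg S (u_south S) h m j\<bar> else 0))"
        unfolding gx_def usol_def using mass_tail[of n J a] n by (intro mult_left_mono) auto
      ultimately show ?thesis using 1 unfolding distrib_left by linarith
    qed
    have gy: "h\<^sup>2 * box_sum J gy \<le> \<epsilon> / 2" for J
    proof -
      have "box_sum (J + n) (\<lambda>j k. if a \<le> k then \<bar>rect_integral (u_init S) h h j k\<bar> else 0) \<le> \<epsilon> / 4"
        unfolding box_sum_def
        by (rule order_trans[OF i.rect_l1[OF _ X2(3)] X2(2)], simp,
            rule suby[OF i.rect_subset X0(3)], simp)
      then have 1: "h\<^sup>2 * box_sum (J + n) (\<lambda>j k. if a \<le> k then \<bar>init_avg S h (j, k)\<bar> else 0) \<le> \<epsilon> / 4"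
        using h by (simp add: initc)
      have "(\<Sum>m<n. \<Sum>k<J + n. if a \<le> k then \<bar>rect_integral (u_west S) ?\<tau> h m k\<bar> else 0) \<le> \<epsilon> / (4 * speed S)"
        by (rule order_trans[OF w.rect_l1[OF _ X3(3)] X3(2)], use n in simp,
            rule suby[OF w.rect_subset X0(4)], use n in simp)
      then have "h\<^sup>2 * (\<Sum>m<n. \<Sum>k<J + n. if a \<le> k then \<bar>bdry_avg S (u_west S) h m k\<bar> else 0) \<le> \<epsilon> / 4"
        using speed by (simp add: bdc pos_le_divide_eq mult.commute)
      moreover have "h\<^sup>2 * box_sum J gy \<le> h\<^sup>2 * (box_sum (J + n) (\<lambda>j k. if a \<le> k then \<bar>init_avg S h (j, k)\<bar> else 0)
         + (\<Sum>m<n. \<Sum>j<J + n. if a \<le> j then \<bar>bdry_avg S (u_west S) h m j\<bar> else 0))"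
        unfolding gy_def usol_def using mass_tail_y[of n J a] n by (intro mult_left_mono) auto
      ultimately show ?thesis using 1 unfolding distrib_left by linarith
    qed
    have g0: "0 \<le> gx j k" "0 \<le> gy j k" for j k by (auto simp: gx_def gy_def)
    \<comment> \<open>Rounding \<open>X0\<close> up to the grid costs at most one cell, and
      \<open>n < N\<close> leaves one spare step to pay for it.\<close>
    have idx: "a + n \<le> nat \<lfloor>s / h\<rfloor>" if "X0 + T * speed S \<le> s" for s
    proof -
      have "real N * h = T * speed S" using N(2) speed by (simp add: time_step_def field_simps)
      moreover have "(real n + 1) * h \<le> real N * h" using n h by (intro mult_right_mono) auto
      ultimately have "(real a + real n) * h \<le> s" using a(2) that by (simp add: distrib_right)
      then have "real (a + n) \<le> s / h" using h by (simp add: pos_le_divide_eq)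
      then show ?thesis by (simp add: le_nat_floor)
    qed
    have "(\<integral>\<^sup>+ x. indicator {x. X0 + T * speed S \<le> fst x \<or> X0 + T * speed S \<le> snd x} x
        * ennreal \<bar>step_fun h (\<lambda>j k. usol S h n (j, k)) x\<bar> \<partial>lborel)
      \<le> (\<integral>\<^sup>+ x. ennreal (step_fun h gx x) + ennreal (step_fun h gy x) \<partial>lborel)"
    proof (rule nn_integral_mono)
      fix x :: "real \<times> real"
      have "0 \<le> step_fun h gx x" "0 \<le> step_fun h gy x" by (auto simp: step_fun_def g0)
      moreover have "\<bar>step_fun h (\<lambda>j k. usol S h n (j, k)) x\<bar> \<le> step_fun h gx x + step_fun h gy x"
        if "X0 + T * speed S \<le> fst x \<or> X0 + T * speed S \<le> snd x"
        using that idx by (auto simp: step_fun_def gx_def gy_def)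
      ultimately show "indicator {x. X0 + T * speed S \<le> fst x \<or> X0 + T * speed S \<le> snd x} x
        * ennreal \<bar>step_fun h (\<lambda>j k. usol S h n (j, k)) x\<bar> \<le> ennreal (step_fun h gx x) + ennreal (step_fun h gy x)"
        by (auto simp: indicator_def ennreal_leI simp flip: ennreal_plus)
    qed
    also have "\<dots> = (\<integral>\<^sup>+ x. ennreal (step_fun h gx x) \<partial>lborel) + (\<integral>\<^sup>+ x. ennreal (step_fun h gy x) \<partial>lborel)"
      by (rule nn_integral_add) measurable
    also have "\<dots> \<le> ennreal (\<epsilon> / 2) + ennreal (\<epsilon> / 2)"
      by (intro add_mono nn_integral_step_fun_le h g0 gx gy)
    also have "\<dots> = ennreal \<epsilon>" using \<epsilon> by (simp add: ennreal_plus[symmetric] del: ennreal_plus)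
    finally show "(\<integral>\<^sup>+ x. indicator {x. X0 + T * speed S \<le> fst x \<or> X0 + T * speed S \<le> snd x} x
        * ennreal \<bar>step_fun h (\<lambda>j k. usol S h n (j, k)) x\<bar> \<partial>lborel) \<le> ennreal \<epsilon>" .
  qed
qed

end

section \<open>Passage to the limit\<close>

context lbm_bv_data
begin

lemma continuous_feq: "continuous_on A (feq S i)"
proof -
  have fl: "continuous_on A (flux S a)" for a
    using C1_differentiable_imp_continuous_on[OF flux_C1[of a]] continuous_on_subset by blast
  show ?thesis
  proof (cases i)
    case Rest
    have "feq S i = (\<lambda>v. (1 - 2 * Lcoef S AX - 2 * Lcoef S AY) * v)" by (simp add: Rest fun_eq_iff)
    then show ?thesis by (auto intro!: continuous_intros)
  next
    case (Plus a)
    have "feq S i = (\<lambda>v. Lcoef S a * v + flux S a v / (2 * speed S))" by (simp add: Plus fun_eq_iff)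
    then show ?thesis using speed by (auto intro!: continuous_intros fl)
  next
    case (Minus a)
    have "feq S i = (\<lambda>v. Lcoef S a * v - flux S a v / (2 * speed S))" by (simp add: Minus fun_eq_iff)
    then show ?thesis using speed by (auto intro!: continuous_intros fl)
  qed
qed

lemma measurable_feq [measurable]: "feq S i \<in> borel_measurable borel"
  by (rule borel_measurable_continuous_onI[OF continuous_feq])

text \<open>The cell area times \<open>90 * (C / h)\<close> is of order \<open>h\<close>; the factor
  in front comes from \<open>nonequilibrium_le\<close>. Outside the quadrant the integrand vanishes
  because \<open>feq\<close> maps zero to zero.\<close>

lemma nonequilibrium_l1:
  assumes grid: "grid_scheme (feq S) (relax S) U N (C / h) (\<lambda>n j k. fsol S h n (j, k)) w s u0"
    and h: "0 < h" and n: "n < N"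
  shows "(\<integral>\<^sup>+ x. ennreal (\<Sum>i\<in>UNIV. \<bar>step_fun h (\<lambda>j k. fsol S h n (j, k) i) x
       - feq S i (step_fun h (\<lambda>j k. usol S h n (j, k)) x)\<bar>) \<partial>lborel)
     \<le> ennreal ((1 / omega_s S + 1 / omega_a S) * 90 * C * h)"
proof -
  interpret grid_scheme "feq S" "relax S" U N "C / h" "\<lambda>n j k. fsol S h n (j, k)" w s u0 by (rule grid)
  let ?\<kappa> = "1 / omega_s S + 1 / omega_a S"
  let ?g = "\<lambda>j k. \<Sum>i\<in>UNIV. \<bar>fsol S h n (j, k) i - feq S i (usol S h n (j, k))\<bar>"
  have "(\<Sum>i\<in>UNIV. \<bar>step_fun h (\<lambda>j k. fsol S h n (j, k) i) x
       - feq S i (step_fun h (\<lambda>j k. usol S h n (j, k)) x)\<bar>) = step_fun h ?g x" for x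
    by (cases "0 \<le> fst x \<and> 0 \<le> snd x") (auto simp: step_fun_def feq_0 simp del: feq.simps)
  moreover have "(\<integral>\<^sup>+ x. ennreal (step_fun h ?g x) \<partial>lborel) \<le> ennreal (?\<kappa> * 90 * C * h)"
  proof (rule nn_integral_step_fun_le[OF h])
    show "0 \<le> ?g j k" for j k by (intro sum_nonneg) simp
    fix J
    have \<kappa>: "0 \<le> ?\<kappa>" using omega_pos by simp
    have "box_sum J ?g \<le> box_sum J (\<lambda>j k. ?\<kappa> * (\<Sum>i\<in>UNIV. \<bar>fsol S h n (j, k) i - relax S (fsol S h n (j, k)) i\<bar>))"
      unfolding usol_def by (rule box_sum_mono) (rule nonequilibrium_le)
    also have "\<dots> \<le> ?\<kappa> * (90 * (C / h))"
      unfolding box_sum_cmult by (rule mult_left_mono[OF relaxation_gap_bound[OF n] \<kappa>])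
    finally have "h\<^sup>2 * box_sum J ?g \<le> h\<^sup>2 * (?\<kappa> * (90 * (C / h)))" by (intro mult_left_mono) auto
    also have "\<dots> = ?\<kappa> * 90 * C * h" using h by (simp add: power2_eq_square)
    finally show "h\<^sup>2 * box_sum J ?g \<le> ?\<kappa> * 90 * C * h" .
  qed
  ultimately show ?thesis by simp
qed

text \<open>The populations are compared with the equilibria of the scalar limit: the error splits
  into their distance to equilibrium, of order dx, and the error of u, which the isometry of
  \<open>feq\<close> transfers to the equilibria.\<close>

theorem convergence:
  fixes dx :: "nat \<Rightarrow> real" and N :: "nat \<Rightarrow> nat"
  assumes steps: "\<And>p. dx p > 0" "dx \<longlonglongrightarrow> 0"
    and N: "\<And>p. N p \<ge> 1" "\<And>p. real (N p) * time_step S (dx p) = T"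
  obtains r u where "strict_mono r" "(\<lambda>(t, x). u t x) \<in> borel_measurable (borel \<Otimes>\<^sub>M borel)"
    "\<And>t. t \<in> {0<..<T} \<Longrightarrow> AE x in lborel. \<bar>u t x\<bar> \<le> U"
    "\<And>t. t \<in> {0<..<T} \<Longrightarrow> (\<integral>\<^sup>+ x. ennreal \<bar>u t x\<bar> \<partial>lborel) < \<infinity>"
    "(\<lambda>p. LinfL1_norm T (\<lambda>t x. \<Sum>i\<in>UNIV. \<bar>f_rec S (dx (r p)) (N (r p)) t x i - feq S i (u t x)\<bar>)) \<longlonglongrightarrow> 0"
    "(\<lambda>p. LinfL1_norm T (\<lambda>t x. u_rec S (dx (r p)) (N (r p)) t x - u t x)) \<longlonglongrightarrow> 0"
proof -
  obtain C where C: "0 \<le> C" and grid: "\<And>h N. 0 < h \<Longrightarrow> 1 \<le> N \<Longrightarrow> real N * time_step S h = T \<Longrightarrow>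
     grid_scheme (feq S) (relax S) U N (C / h) (\<lambda>n j k. fsol S h n (j, k))
       (bdry_avg S (u_west S) h) (bdry_avg S (u_south S) h) (\<lambda>j k. init_avg S h (j, k))"
    by (rule uniform_grid_scheme) blast
  note gp = grid[OF steps(1) N]
  \<comment> \<open>48 dominates the constants 21 of the variation, 22 of the traces and 48 of the
    time increments.\<close>
  interpret bv_family T "speed S" U "48 * C" dx N "\<lambda>p n j k. usol S (dx p) n (j, k)"
  proof (rule bv_family.intro)
    fix p n
    interpret grid_scheme "feq S" "relax S" U "N p" "C / dx p" "\<lambda>n j k. fsol S (dx p) n (j, k)"
      "bdry_avg S (u_west S) (dx p)" "bdry_avg S (u_south S) (dx p)" "\<lambda>j k. init_avg S (dx p) (j, k)"
      by (rule gp)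
    have sc: "dx p * X \<le> 48 * C" if "X \<le> c * (C / dx p)" "c \<le> 48" for X c
    proof -
      have "dx p * X \<le> dx p * (c * (C / dx p))" using that steps(1)[of p] by (intro mult_left_mono) auto
      also have "\<dots> = c * C" using steps(1)[of p] by simp
      also have "\<dots> \<le> 48 * C" using that C by (intro mult_right_mono) auto
      finally show ?thesis .
    qed
    show "bv_step (dx p) (48 * C) (\<lambda>j k. usol S (dx p) n (j, k))" if n: "n < N p"
      unfolding usol_def
      by unfold_locales
        (use steps C sc[OF u_variation_x[OF n]] sc[OF u_variation_y[OF n]] sc[OF u_trace_x[OF n]] sc[OF u_trace_y[OF n]] in auto)
    show "dx p * box_sum J (\<lambda>j k. \<bar>usol S (dx p) (Suc n) (j, k) - usol S (dx p) n (j, k)\<bar>) \<le> 48 * C"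
      if "Suc n < N p" for J
      unfolding usol_def by (rule sc[OF u_time_step_bound]) (use that in simp_all)
    show "\<bar>usol S (dx p) n (j, k)\<bar> \<le> U" if "n < N p" for j k
      unfolding usol_def by (rule f_bound) (use that in simp)
  next
    fix \<epsilon> :: real assume "0 < \<epsilon>"
    then obtain X where "\<And>h N n. 0 < h \<Longrightarrow> 1 \<le> N \<Longrightarrow> real N * time_step S h = T \<Longrightarrow> n < N \<Longrightarrow>
     (\<integral>\<^sup>+ x. indicator {x. X \<le> fst x \<or> X \<le> snd x} x * ennreal \<bar>step_fun h (\<lambda>j k. usol S h n (j, k)) x\<bar> \<partial>lborel)
       \<le> ennreal \<epsilon>" by (rule uniform_tail) blast
    then show "\<exists>X. \<forall>p n. n < N p \<longrightarrow> (\<integral>\<^sup>+ x. indicator {x. X \<le> fst x \<or> X \<le> snd x} x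
        * ennreal \<bar>step_fun (dx p) (\<lambda>j k. usol S (dx p) n (j, k)) x\<bar> \<partial>lborel) \<le> ennreal \<epsilon>"
      using steps(1) N by blast
  qed (use T speed steps N in \<open>auto simp: time_step_def\<close>)
  have lev: "level p t = nat \<lfloor>t / time_step S (dx p)\<rfloor>" for p t by (simp add: level_def time_step_def)
  have W_eq: "W p t = step_fun (dx p) (\<lambda>j k. usol S (dx p) (level p t) (j, k))" for p t by (simp add: W_def)
  have ts: "0 < time_step S (dx p)" for p using steps speed by (simp add: time_step_def)
  obtain r u where r: "strict_mono r" and u: "(\<lambda>(t, x). u t x) \<in> borel_measurable (borel \<Otimes>\<^sub>M borel)"
    "\<And>t. t \<in> {0<..<T} \<Longrightarrow> AE x in lborel. \<bar>u t x\<bar> \<le> U"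
    and lim: "\<And>k p t. k < p \<Longrightarrow> t \<in> {0<..<T} \<Longrightarrow> L1_dist (W (r p) t) (u t) \<le> ennreal ((1/2) ^ k)"
    by (rule compactness) blast
  have u': "(\<lambda>z. u (fst z) (snd z)) \<in> borel_measurable (borel \<Otimes>\<^sub>M borel)"
    using u(1) by (simp add: case_prod_unfold)
  have ut [measurable]: "u t \<in> borel_measurable borel" for t
    using measurable_compose[OF measurable_Pair1' u(1), of t] by simp
  show thesis
  proof (rule that[of r u, OF r u])
    fix t assume t: "t \<in> {0<..<T}"
    have "(\<integral>\<^sup>+ x. ennreal \<bar>u t x\<bar> \<partial>lborel) \<le> L1_dist (u t) (W (r 1) t)
       + (\<integral>\<^sup>+ x. ennreal \<bar>W (r 1) t x - 0\<bar> \<partial>lborel)"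
      using nn_integral_triangle[of "u t" "W (r 1) t" "\<lambda>_. 0"] by simp
    also have "\<dots> < \<infinity>"
      using lim[of 0 1 t] t nn_integral_W_finite[of t "r 1"]
      by (simp add: abs_minus_commute order_le_less_trans)
    finally show "(\<integral>\<^sup>+ x. ennreal \<bar>u t x\<bar> \<partial>lborel) < \<infinity>" .
  next
    let ?\<kappa> = "(1 / omega_s S + 1 / omega_a S) * 90 * C"
    have \<kappa>: "0 \<le> ?\<kappa>" using omega_pos C by simp
    have sub: "(\<lambda>p. dx (r p)) \<longlonglongrightarrow> 0" using LIMSEQ_subseq_LIMSEQ[OF steps(2) r] by (simp add: o_def)
    have half: "(\<lambda>p. (1/2 :: real) ^ p) \<longlonglongrightarrow> 0" by (rule LIMSEQ_power_zero) simp
    \<comment> \<open>The index is shifted because the rate \<open>(1/2) ^ p\<close> is available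
      only strictly beyond \<open>p\<close>.\<close>
    have "(\<lambda>p. ennreal (?\<kappa> * dx (r (Suc p)) + (1/2) ^ p)) \<longlonglongrightarrow> ennreal (?\<kappa> * 0 + 0)"
      by (intro tendsto_ennrealI tendsto_add tendsto_mult tendsto_const LIMSEQ_Suc[OF sub] half)
    then have z: "(\<lambda>p. ennreal (?\<kappa> * dx (r (Suc p)) + (1/2) ^ p)) \<longlonglongrightarrow> 0" by simp
    have Fm: "(\<lambda>(t, x). \<Sum>i\<in>UNIV. \<bar>step_fun (dx p) (\<lambda>j k. fsol S (dx p) (level p t) (j, k) i) x - feq S i (u t x)\<bar>)
       \<in> borel_measurable (borel \<Otimes>\<^sub>M borel)" for p
    proof -
      have [measurable]: "(\<lambda>z. step_fun (dx p) (\<lambda>j k. fsol S (dx p) (level p (fst z)) (j, k) i) (snd z))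
         \<in> borel_measurable (borel \<Otimes>\<^sub>M borel)" for i
        using measurable_step_fun_level[of p "\<lambda>n j k. fsol S (dx p) n (j, k) i"] by (simp add: case_prod_unfold)
      show ?thesis using u' unfolding case_prod_unfold by measurable
    qed
    have "LinfL1_norm T (\<lambda>t x. \<Sum>i\<in>UNIV. \<bar>f_rec S (dx (r (Suc p))) (N (r (Suc p))) t x i - feq S i (u t x)\<bar>)
      \<le> ennreal (?\<kappa> * dx (r (Suc p)) + (1/2) ^ p)" for p
    proof (rule LinfL1_norm_le[OF Fm[of "r (Suc p)"]])
      fix t assume t: "t \<in> {0<..<T}"
      let ?q = "r (Suc p)"
      have lt: "level ?q t < N ?q" by (rule level_less) (use t in simp)
      have "AE x in lborel. x \<in> quadrant \<longrightarrow> f_rec S (dx ?q) (N ?q) t x i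
          = step_fun (dx ?q) (\<lambda>j k. fsol S (dx ?q) (level ?q t) (j, k) i) x" for i
        unfolding f_rec_def lev by (rule reconstruct_AE[OF steps(1) ts]) (use t lt in \<open>auto simp: lev\<close>)
      then have "AE x in lborel. \<forall>i. x \<in> quadrant \<longrightarrow> f_rec S (dx ?q) (N ?q) t x i
          = step_fun (dx ?q) (\<lambda>j k. fsol S (dx ?q) (level ?q t) (j, k) i) x"
        by (intro eventually_all_finite) auto
      then show "AE x in lborel. x \<in> quadrant \<longrightarrow>
         (\<Sum>i\<in>UNIV. \<bar>f_rec S (dx ?q) (N ?q) t x i - feq S i (u t x)\<bar>)
         = (\<Sum>i\<in>UNIV. \<bar>step_fun (dx ?q) (\<lambda>j k. fsol S (dx ?q) (level ?q t) (j, k) i) x - feq S i (u t x)\<bar>)"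
        by eventually_elim simp
      have "(\<integral>\<^sup>+ x. ennreal \<bar>\<Sum>i\<in>UNIV. \<bar>step_fun (dx ?q) (\<lambda>j k. fsol S (dx ?q) (level ?q t) (j, k) i) x - feq S i (u t x)\<bar>\<bar>
           * indicator quadrant x \<partial>lborel)
        \<le> (\<integral>\<^sup>+ x. ennreal (\<Sum>i\<in>UNIV. \<bar>step_fun (dx ?q) (\<lambda>j k. fsol S (dx ?q) (level ?q t) (j, k) i) x
           - feq S i (W ?q t x)\<bar>) + ennreal \<bar>W ?q t x - u t x\<bar> \<partial>lborel)"
      proof (rule nn_integral_mono_AE, use u(2)[OF t] in eventually_elim)
        case (elim x)
        let ?f = "\<lambda>i. step_fun (dx ?q) (\<lambda>j k. fsol S (dx ?q) (level ?q t) (j, k) i) x"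
        have "\<bar>W ?q t x\<bar> \<le> U" by (rule W_bound) (use t in simp)
        \<comment> \<open>The isometry needs both arguments in [-U, U]; for \<open>u t x\<close>
          this holds only almost everywhere, hence the pointwise argument under
          \<open>AE\<close>.\<close>
        from feq_l1_isometry[OF this elim]
        have "(\<Sum>i\<in>UNIV. \<bar>?f i - feq S i (u t x)\<bar>) \<le> (\<Sum>i\<in>UNIV. \<bar>?f i - feq S i (W ?q t x)\<bar>) + \<bar>W ?q t x - u t x\<bar>"
          by (subst \<open>(\<Sum>i\<in>UNIV. \<bar>feq S i (W ?q t x) - feq S i (u t x)\<bar>) = \<bar>W ?q t x - u t x\<bar>\<close>[symmetric])
             (unfold sum.distrib[symmetric], intro sum_mono, linarith)
        then have "ennreal (\<Sum>i\<in>UNIV. \<bar>?f i - feq S i (u t x)\<bar>)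
          \<le> ennreal (\<Sum>i\<in>UNIV. \<bar>?f i - feq S i (W ?q t x)\<bar>) + ennreal \<bar>W ?q t x - u t x\<bar>"
          by (simp add: sum_nonneg ennreal_leI flip: ennreal_plus del: feq.simps)
        then show ?case
          by (auto simp: indicator_def abs_of_nonneg[OF sum_nonneg] simp del: feq.simps)
      qed
      also have "\<dots> = (\<integral>\<^sup>+ x. ennreal (\<Sum>i\<in>UNIV. \<bar>step_fun (dx ?q) (\<lambda>j k. fsol S (dx ?q) (level ?q t) (j, k) i) x
           - feq S i (W ?q t x)\<bar>) \<partial>lborel) + L1_dist (W ?q t) (u t)"
        by (rule nn_integral_add) measurable
      also have "\<dots> \<le> ennreal (?\<kappa> * dx ?q) + ennreal ((1/2) ^ p)"
        by (intro add_mono lim t) (simp_all only: W_eq nonequilibrium_l1[OF gp steps(1) lt] lessI)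
      also have "\<dots> = ennreal (?\<kappa> * dx ?q + (1/2) ^ p)"
        by (rule ennreal_plus[symmetric]) (use \<kappa> steps(1)[of ?q] in \<open>auto intro: mult_nonneg_nonneg\<close>)
      finally show "(\<integral>\<^sup>+ x. ennreal \<bar>\<Sum>i\<in>UNIV. \<bar>step_fun (dx ?q) (\<lambda>j k. fsol S (dx ?q) (level ?q t) (j, k) i) x - feq S i (u t x)\<bar>\<bar>
           * indicator quadrant x \<partial>lborel) \<le> ennreal (?\<kappa> * dx ?q + (1/2) ^ p)" .
    qed
    then have "(\<lambda>p. LinfL1_norm T (\<lambda>t x. \<Sum>i\<in>UNIV. \<bar>f_rec S (dx (r (Suc p))) (N (r (Suc p))) t x i - feq S i (u t x)\<bar>)) \<longlonglongrightarrow> 0"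
      by (intro tendsto_sandwich[OF _ _ tendsto_const z]) auto
    then show "(\<lambda>p. LinfL1_norm T (\<lambda>t x. \<Sum>i\<in>UNIV. \<bar>f_rec S (dx (r p)) (N (r p)) t x i - feq S i (u t x)\<bar>)) \<longlonglongrightarrow> 0"
      by (rule LIMSEQ_imp_Suc)
    have z2: "(\<lambda>p. ennreal ((1/2) ^ p)) \<longlonglongrightarrow> 0" using tendsto_ennrealI[OF half] by simp
    have Wm: "(\<lambda>(t, x). W p t x - u t x) \<in> borel_measurable (borel \<Otimes>\<^sub>M borel)" for p
      using borel_measurable_diff[OF measurable_W_joint[of p] u(1)] by (simp add: case_prod_unfold)
    have "LinfL1_norm T (\<lambda>t x. u_rec S (dx (r (Suc p))) (N (r (Suc p))) t x - u t x) \<le> ennreal ((1/2) ^ p)" for p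
    proof (rule LinfL1_norm_le[OF Wm[of "r (Suc p)"]])
      fix t assume t: "t \<in> {0<..<T}"
      let ?q = "r (Suc p)"
      have lt: "level ?q t < N ?q" by (rule level_less) (use t in simp)
      have "AE x in lborel. x \<in> quadrant \<longrightarrow> u_rec S (dx ?q) (N ?q) t x = W ?q t x"
        unfolding u_rec_def W_eq lev by (rule reconstruct_AE[OF steps(1) ts]) (use t lt in \<open>auto simp: lev\<close>)
      then show "AE x in lborel. x \<in> quadrant \<longrightarrow> u_rec S (dx ?q) (N ?q) t x - u t x = W ?q t x - u t x"
        by eventually_elim simp
      have "(\<integral>\<^sup>+ x. ennreal \<bar>W ?q t x - u t x\<bar> * indicator quadrant x \<partial>lborel) \<le> L1_dist (W ?q t) (u t)"
        by (intro nn_integral_mono) (simp add: indicator_def)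
      also have "\<dots> \<le> ennreal ((1/2) ^ p)" by (rule lim[OF _ t]) simp
      finally show "(\<integral>\<^sup>+ x. ennreal \<bar>W ?q t x - u t x\<bar> * indicator quadrant x \<partial>lborel) \<le> ennreal ((1/2) ^ p)" .
    qed
    then have "(\<lambda>p. LinfL1_norm T (\<lambda>t x. u_rec S (dx (r (Suc p))) (N (r (Suc p))) t x - u t x)) \<longlonglongrightarrow> 0"
      by (intro tendsto_sandwich[OF _ _ tendsto_const z2]) auto
    then show "(\<lambda>p. LinfL1_norm T (\<lambda>t x. u_rec S (dx (r p)) (N (r p)) t x - u t x)) \<longlonglongrightarrow> 0"
      by (rule LIMSEQ_imp_Suc)
  qed
qed

end

theorem theorem3:
  fixes S :: lbm and T :: real and dx :: "nat \<Rightarrow> real" and N :: "nat \<Rightarrow> nat"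
  assumes T: "T > 0" and speed: "speed S > 0"
    and flux_C1: "\<And>a. flux S a C1_differentiable_on UNIV"
    and flux_0: "\<And>a. flux S a 0 = 0"
    and init: "in_Linf quadrant (u_init S)" "in_BV quadrant (u_init S)"
      "u_init S absolutely_integrable_on quadrant"
    and west: "in_Linf ({0<..<T} \<times> {0<..}) (u_west S)" "in_BV ({0<..<T} \<times> {0<..}) (u_west S)"
      "u_west S absolutely_integrable_on ({0<..<T} \<times> {0<..})"
    and south: "in_Linf ({0<..<T} \<times> {0<..}) (u_south S)" "in_BV ({0<..<T} \<times> {0<..}) (u_south S)"
      "u_south S absolutely_integrable_on ({0<..<T} \<times> {0<..})"
    and omega: "0 < omega_s S" "omega_s S \<le> 2" "0 < omega_a S" "omega_a S \<le> 2"
    and monotone: "monotonicity_cond S T"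
    and nontrivial: "\<not> (\<forall>a. max_flux_speed S T a = 0)"
    and steps: "\<And>p. dx p > 0" "dx \<longlonglongrightarrow> 0"
    and N: "\<And>p. N p \<ge> 1" "\<And>p. real (N p) * time_step S (dx p) = T"
  shows "\<exists>(r :: nat \<Rightarrow> nat) (fbar :: real \<Rightarrow> real \<times> real \<Rightarrow> vel \<Rightarrow> real). strict_mono r \<and>
    (\<forall>i. (\<lambda>(t, x). fbar t x i) \<in> borel_measurable (lebesgue_on ({0<..<T} \<times> quadrant))) \<and>
    (\<forall>t\<in>{0<..<T}.
       (\<forall>i. (\<lambda>x. fbar t x i) absolutely_integrable_on quadrant) \<and>
       (AE x in lebesgue_on quadrant. \<forall>i.
          fbar t x i \<in> {feq S i (- u_inf S T) .. feq S i (u_inf S T)})) \<and>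
    (\<lambda>p. LinfL1_norm T (\<lambda>t x.
       \<Sum>i\<in>UNIV. \<bar>f_rec S (dx (r p)) (N (r p)) t x i - fbar t x i\<bar>)) \<longlonglongrightarrow> 0 \<and>
    (let ubar = (\<lambda>t x. \<Sum>i\<in>UNIV. fbar t x i) in
       (\<forall>t\<in>{0<..<T}. AE x in lebesgue_on quadrant. ubar t x \<in> {- u_inf S T .. u_inf S T}) \<and>
       (\<lambda>p. LinfL1_norm T (\<lambda>t x.
          u_rec S (dx (r p)) (N (r p)) t x - ubar t x)) \<longlonglongrightarrow> 0 \<and>
       (\<forall>t\<in>{0<..<T}. AE x in lebesgue_on quadrant. \<forall>i. fbar t x i = feq S i (ubar t x)))"
proof -
  interpret lbm_bv_data S T
    by unfold_locales (use assms in auto)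
  obtain r u where r: "strict_mono r" and u: "(\<lambda>(t, x). u t x) \<in> borel_measurable (borel \<Otimes>\<^sub>M borel)"
    "\<And>t. t \<in> {0<..<T} \<Longrightarrow> AE x in lborel. \<bar>u t x\<bar> \<le> U"
    "\<And>t. t \<in> {0<..<T} \<Longrightarrow> (\<integral>\<^sup>+ x. ennreal \<bar>u t x\<bar> \<partial>lborel) < \<infinity>"
    and lim: "(\<lambda>p. LinfL1_norm T (\<lambda>t x. \<Sum>i\<in>UNIV. \<bar>f_rec S (dx (r p)) (N (r p)) t x i - feq S i (u t x)\<bar>)) \<longlonglongrightarrow> 0"
      "(\<lambda>p. LinfL1_norm T (\<lambda>t x. u_rec S (dx (r p)) (N (r p)) t x - u t x)) \<longlonglongrightarrow> 0"
    by (rule convergence[OF steps N]) blast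
  have Q: "quadrant \<in> sets borel" unfolding quadrant_def borel_prod[symmetric] by auto
  have m: "(\<lambda>(t, x). feq S i (u t x)) \<in> borel_measurable (lebesgue_on ({0<..<T} \<times> quadrant))" for i
  proof -
    have "(\<lambda>z. feq S i ((\<lambda>(t, x). u t x) z)) \<in> borel_measurable (borel \<Otimes>\<^sub>M borel)"
      by (rule measurable_compose[OF u(1) measurable_feq])
    then have "(\<lambda>(t, x). feq S i (u t x)) \<in> borel_measurable lborel"
      by (simp add: borel_prod case_prod_unfold)
    then show ?thesis by (intro measurable_restrict_space1 measurable_completion)
  qed
  have ut [measurable]: "u t \<in> borel_measurable borel" for t
    using measurable_compose[OF measurable_Pair1' u(1), of t] by simp
  \<comment> \<open>Null sets of the Borel measure stay null under completion, so statements about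
    \<open>lborel\<close> carry over to Lebesgue measure on the quadrant.\<close>
  have AEQ: "AE x in lebesgue_on quadrant. P x" if "AE x in lborel. P x" for P :: "real \<times> real \<Rightarrow> bool"
    using AE_completion[OF that] Q by (subst AE_restrict_space_iff) auto
  have box: "AE x in lebesgue_on quadrant. \<forall>i. feq S i (u t x) \<in> {feq S i (- u_inf S T) .. feq S i (u_inf S T)}"
    if "t \<in> {0<..<T}" for t
    using AEQ[OF u(2)[OF that]] by eventually_elim (use invariant_box_feq in \<open>simp add: U_def\<close>)
  have ai: "(\<lambda>x. feq S i (u t x)) absolutely_integrable_on quadrant" if t: "t \<in> {0<..<T}" for t i
  proof -
    have [measurable]: "(\<lambda>x. feq S i (u t x)) \<in> borel_measurable borel"
      by (rule measurable_compose[OF ut measurable_feq])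
    \<comment> \<open>Since \<open>feq\<close> vanishes at zero, the isometry bounds each component
      by \<open>\<bar>u t x\<bar>\<close>, whose integral is finite.\<close>
    have "(\<integral>\<^sup>+ x. ennreal (norm (feq S i (u t x))) \<partial>lborel) \<le> (\<integral>\<^sup>+ x. ennreal \<bar>u t x\<bar> \<partial>lborel)"
    proof (rule nn_integral_mono_AE, use u(2)[OF t] in eventually_elim)
      case (elim x)
      have "\<bar>feq S i (u t x) - feq S i 0\<bar> \<le> (\<Sum>i\<in>UNIV. \<bar>feq S i (u t x) - feq S i 0\<bar>)"
        by (rule member_le_sum) auto
      also have "\<dots> = \<bar>u t x\<bar>" using feq_l1_isometry[OF elim, of 0] U_nonneg by simp
      finally show ?case by (simp add: feq_0 ennreal_leI del: feq.simps)
    qed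
    also have "\<dots> < \<infinity>" by (rule u(3)[OF t])
    finally have "integrable lborel (\<lambda>x. feq S i (u t x))"
      by (intro integrableI_bounded) measurable
    then have "integrable lebesgue (\<lambda>x. feq S i (u t x))" by (simp add: integrable_completion)
    then have "set_integrable lebesgue quadrant (\<lambda>x. feq S i (u t x))"
      unfolding set_integrable_def using Q by (intro integrable_mult_indicator) auto
    then show ?thesis .
  qed
  have bound: "AE x in lebesgue_on quadrant. u t x \<in> {- u_inf S T .. u_inf S T}" if "t \<in> {0<..<T}" for t
    using AEQ[OF u(2)[OF that]] by eventually_elim (auto simp: U_def abs_le_iff)
  \<comment> \<open>With the equilibria of \<open>u\<close> as limit populations, their sum is
    \<open>u\<close> by \<open>feq_sum\<close>, and the claim of equilibrium becomes
    reflexivity.\<close>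
  show ?thesis
  proof (intro exI[of _ r] exI[of _ "\<lambda>t x i. feq S i (u t x)"] conjI)
    show "let ubar = (\<lambda>t x. \<Sum>i\<in>UNIV. feq S i (u t x)) in
       (\<forall>t\<in>{0<..<T}. AE x in lebesgue_on quadrant. ubar t x \<in> {- u_inf S T .. u_inf S T}) \<and>
       (\<lambda>p. LinfL1_norm T (\<lambda>t x.
          u_rec S (dx (r p)) (N (r p)) t x - ubar t x)) \<longlonglongrightarrow> 0 \<and>
       (\<forall>t\<in>{0<..<T}. AE x in lebesgue_on quadrant. \<forall>i. feq S i (u t x) = feq S i (ubar t x))"
      unfolding Let_def feq_sum using bound lim(2) by simp
  qed (use r m ai box lim(1) in \<open>blast+\<close>)
qed

end
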